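(* Let $\bar Q$ be a gentle bound quiver with finite reduced non-kissing complex $\widetilde{\mathcal K}(\bar Q)$. Then the fan $\{\mathbb R_{\ge0}\{\mathbf g(\omega):\omega\in F\}: F\text{ face of }\widetilde{\mathcal K}(\bar Q)\}$ is the normal fan of the polytope $\mathrm{Asso}(\bar Q)$ defined equivalently as (i) the convex hull of the points $\mathbf p(F)=\sum_{\omega\in F}\kappa(\omega)\,\mathbf c(\omega,F)$ for all facets $F$ of $\widetilde{\mathcal K}(\bar Q)$, or (ii) the intersection of the halfspaces $\{\mathbf x\in\mathbb R^{Q_0}:\langle\mathbf g(\omega),\mathbf x\rangle\le\kappa(\omega)\}$ for all non-self-kissing walks $\omega$ of $\bar Q$.
   Context: A gentle bound quiver is $\bar Q=(Q,I)$, $Q$ finite (paths composed left to right), $I$ admissible generated by length-two paths, each vertex with at most two incoming and two outgoing arrows, and for each arrow $\beta$ at most one $\alpha$ with $t(\alpha)=s(\beta),\alpha\beta\notin I$, at most one with $\alpha\beta\in I$, and dually at most one $\gamma$ with $s(\gamma)=t(\beta),\beta\gamma\notin I$ and at most one with $\beta\gamma\in I$. Strings: reduced words in arrows and inverse arrows, composable, with no factor $\pi^{\pm1}$ for a path $\pi\in I$ (or length-zero $\varepsilon_v$), up to inversion. Blossoming quiver $\bar Q^\circledast$: add at each $v\in Q_0$ new arrows to/from new blossom vertices so that $v$ has exactly two incoming and two outgoing arrows, with length-two relations at $v$ making it gentle. Walks: maximal strings of $\bar Q^\circledast$ (joining blossom vertices), up to inversion. A substring of a walk: occurrence of a factor (possibly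 a vertex) with all vertices in $Q_0$; top (bottom) if both adjacent arrows point away from (towards) it. Peak/deep: top/bottom substring of length zero. $\omega$ kisses $\omega'$ if a string is a top substring of $\omega$ and a bottom substring of $\omega'$. Straight walks: paths of $Q^\circledast$ or inverses. $\widetilde{\mathcal K}(\bar Q)$: complex of sets of pairwise non-kissing, non-self-kissing, non-straight walks. $\mathbf g(\omega)=\sum_{\text{peaks}}\mathbf e_v-\sum_{\text{deeps}}\mathbf e_v$ (with multiplicity). Kissing number: $\kappa(\omega,\omega')$ is the number of kisses of $\omega$ to $\omega'$ counted with multiplicity (pairs of an occurrence of a top substring of $\omega$ and an occurrence of a bottom substring of $\omega'$ equal as strings); $\mathrm{KN}(\omega,\omega')=\kappa(\omega,\omega')+\kappa(\omega',\omega)$ and $\kappa(\omega)=\sum_{\omega'}\mathrm{KN}(\omega,\omega')$ over all non-self-kissing walks $\omega'$. Distinguished arrows: for a facet $F$ of $\widetilde{\mathcal K}(\bar Q)$ together with all straight walks, and an arrow $\alpha$ of $Q^\circledast$, among walks of $F$ through $\alpha$ (marked at an occurrence of $\alpha^{\pm1}$, oriented so it reads $\alpha$), $\mu\prec_\alpha\nu$ if at the ends of their maximal common factor containing the mark where they separate, $\mu$ uses an arrow read forward and $\nu$ one read backward; the maximum is the distinguished walk at $\alpha$ and $\alpha$ is a distinguished arrow of it. Each bending walk $\omega\in F$ has two distinguished arrows; its distinguished string $\sigma(\omega,F)$ is the substring between them. $\mathbf c(\omega,F)=\pm\mathbf m_{\sigma(\omega,F)}$, where $\mathbf m_\sigma=\sum_{\text{vertices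 }v\text{ of }\sigma}\mathbf e_v$ (with multiplicity), with sign $+$ if $\sigma(\omega,F)$ is a top substring of $\omega$ and $-$ if it is a bottom substring. *)

theory Defs
  imports "HOL-Analysis.Analysis"
begin

text \<open>A bound quiver whose ideal is generated by length-two paths: the relation set
  rels consists of the pairs (alpha, beta) with alpha beta in I (paths composed left to right).\<close>

record ('w, 'c) bquiver =
  verts :: "'w set"
  arrs  :: "'c set"
  src   :: "'c \<Rightarrow> 'w"
  tgt   :: "'c \<Rightarrow> 'w"
  rels  :: "('c \<times> 'c) set"

definition is_path :: "('w,'c) bquiver \<Rightarrow> 'c list \<Rightarrow> bool" where
  "is_path B ps \<longleftrightarrow> set ps \<subseteq> arrs B \<and>
     (\<forall>k. Suc k < length ps \<longrightarrow> tgt B (ps ! k) = src B (ps ! Suc k))"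

definition gentle :: "('w,'c) bquiver \<Rightarrow> bool" where
  "gentle B \<longleftrightarrow> finite (verts B) \<and> finite (arrs B) \<and>
     (\<forall>a\<in>arrs B. src B a \<in> verts B \<and> tgt B a \<in> verts B) \<and>
     rels B \<subseteq> {(a, b). a \<in> arrs B \<and> b \<in> arrs B \<and> tgt B a = src B b} \<and>
     (\<forall>v\<in>verts B. card {a\<in>arrs B. tgt B a = v} \<le> 2 \<and> card {a\<in>arrs B. src B a = v} \<le> 2) \<and>
     (\<forall>b\<in>arrs B.
        card {a\<in>arrs B. tgt B a = src B b \<and> (a, b) \<notin> rels B} \<le> 1 \<and>
        card {a\<in>arrs B. tgt B a = src B b \<and> (a, b) \<in> rels B} \<le> 1 \<and>
        card {c\<in>arrs B. src B c = tgt B b \<and> (b, c) \<notin> rels B} \<le> 1 \<and>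
        card {c\<in>arrs B. src B c = tgt B b \<and> (b, c) \<in> rels B} \<le> 1)"

text \<open>Admissibility (finite-dimensionality): all sufficiently long paths lie in I, i.e.
  contain a length-two factor in the relation set.\<close>
definition admissible :: "('w,'c) bquiver \<Rightarrow> bool" where
  "admissible B \<longleftrightarrow> (\<exists>n. \<forall>ps. is_path B ps \<and> length ps = n \<longrightarrow>
      (\<exists>k. Suc k < length ps \<and> (ps ! k, ps ! Suc k) \<in> rels B))"

definition gentle_bound_quiver :: "('w,'c) bquiver \<Rightarrow> bool" where
  "gentle_bound_quiver B \<longleftrightarrow> gentle B \<and> admissible B"

text \<open>Vertices of the blossoming quiver: Inl v for v in Q0, and blossom vertices Inr x.
  Arrows: Inl a for a in Q1, and new arrows Inr (v, out, i), attached to v: if out then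
  the arrow goes from v to the blossom vertex Inr (v, out, i), else from that blossom
  vertex to v. The set N of new arrows and the relations Rs are data of the blossoming.\<close>

type_synonym 'v blo = "'v \<times> bool \<times> bool"

fun bsrc :: "('v,'a) bquiver \<Rightarrow> 'a + 'v blo \<Rightarrow> 'v + 'v blo" where
  "bsrc Q (Inl a) = Inl (src Q a)"
| "bsrc Q (Inr (v, out, i)) = (if out then Inl v else Inr (v, out, i))"

fun btgt :: "('v,'a) bquiver \<Rightarrow> 'a + 'v blo \<Rightarrow> 'v + 'v blo" where
  "btgt Q (Inl a) = Inl (tgt Q a)"
| "btgt Q (Inr (v, out, i)) = (if out then Inr (v, out, i) else Inl v)"

definition bloss :: "('v,'a) bquiver \<Rightarrow> 'v blo set \<Rightarrow> (('a + 'v blo) \<times> ('a + 'v blo)) set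
     \<Rightarrow> ('v + 'v blo, 'a + 'v blo) bquiver" where
  "bloss Q N Rs = \<lparr> verts = Inl ` verts Q \<union> Inr ` N, arrs = Inl ` arrs Q \<union> Inr ` N,
      src = bsrc Q, tgt = btgt Q, rels = Rs \<rparr>"

definition is_blossoming :: "('v,'a) bquiver \<Rightarrow> 'v blo set \<Rightarrow> (('a + 'v blo) \<times> ('a + 'v blo)) set \<Rightarrow> bool" where
  "is_blossoming Q N Rs \<longleftrightarrow>
     (\<forall>(v, out, i)\<in>N. v \<in> verts Q) \<and>
     gentle (bloss Q N Rs) \<and>
     (\<forall>v\<in>verts Q. card {c\<in>arrs (bloss Q N Rs). btgt Q c = Inl v} = 2 \<and>
                   card {c\<in>arrs (bloss Q N Rs). bsrc Q c = Inl v} = 2) \<and>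
     {(a, b). (Inl a, Inl b) \<in> Rs} = rels Q"

text \<open>A string is a start vertex together with a list of letters; the letter (a, True) is the
  arrow a read forward (from src a to tgt a), (a, False) is the inverse arrow.\<close>

type_synonym ('w,'c) str = "'w \<times> ('c \<times> bool) list"

fun lsrc :: "('w,'c) bquiver \<Rightarrow> 'c \<times> bool \<Rightarrow> 'w" where
  "lsrc B (a, d) = (if d then src B a else tgt B a)"

fun ltgt :: "('w,'c) bquiver \<Rightarrow> 'c \<times> bool \<Rightarrow> 'w" where
  "ltgt B (a, d) = (if d then tgt B a else src B a)"

text \<open>k-th vertex of a string (k = 0 .. length); letter k goes from vertex k to vertex k+1.\<close>
definition vtx :: "('w,'c) bquiver \<Rightarrow> ('w,'c) str \<Rightarrow> nat \<Rightarrow> 'w" where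
  "vtx B \<sigma> k = (if k = 0 then fst \<sigma> else ltgt B (snd \<sigma> ! (k - 1)))"

definition is_string :: "('w,'c) bquiver \<Rightarrow> ('w,'c) str \<Rightarrow> bool" where
  "is_string B \<sigma> \<longleftrightarrow> (let ls = snd \<sigma> in
     fst \<sigma> \<in> verts B \<and>
     (\<forall>k<length ls. fst (ls ! k) \<in> arrs B \<and> lsrc B (ls ! k) = vtx B \<sigma> k) \<and>
     (\<forall>k. Suc k < length ls \<longrightarrow>
        \<not> (fst (ls ! k) = fst (ls ! Suc k) \<and> snd (ls ! k) \<noteq> snd (ls ! Suc k)) \<and>
        \<not> (snd (ls ! k) \<and> snd (ls ! Suc k) \<and> (fst (ls ! k), fst (ls ! Suc k)) \<in> rels B) \<and>
        \<not> (\<not> snd (ls ! k) \<and> \<not> snd (ls ! Suc k) \<and> (fst (ls ! Suc k), fst (ls ! k)) \<in> rels B)))"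

definition str_inv :: "('w,'c) bquiver \<Rightarrow> ('w,'c) str \<Rightarrow> ('w,'c) str" where
  "str_inv B \<sigma> = (vtx B \<sigma> (length (snd \<sigma>)), rev (map (\<lambda>(a, d). (a, \<not> d)) (snd \<sigma>)))"

definition same_str :: "('w,'c) bquiver \<Rightarrow> ('w,'c) str \<Rightarrow> ('w,'c) str \<Rightarrow> bool" where
  "same_str B \<sigma> \<tau> \<longleftrightarrow> \<sigma> = \<tau> \<or> \<sigma> = str_inv B \<tau>"

definition maximal_string :: "('w,'c) bquiver \<Rightarrow> ('w,'c) str \<Rightarrow> bool" where
  "maximal_string B \<sigma> \<longleftrightarrow> is_string B \<sigma> \<and>
     \<not> (\<exists>l. is_string B (lsrc B l, l # snd \<sigma>)) \<and>
     \<not> (\<exists>l. is_string B (fst \<sigma>, snd \<sigma> @ [l]))"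

definition walks :: "('w,'c) bquiver \<Rightarrow> ('w,'c) str set set" where
  "walks B = {{\<sigma>, str_inv B \<sigma>} | \<sigma>. maximal_string B \<sigma>}"

definition rep :: "('w,'c) str set \<Rightarrow> ('w,'c) str" where
  "rep W = (SOME \<sigma>. \<sigma> \<in> W)"

definition straight :: "('w,'c) str set \<Rightarrow> bool" where
  "straight W \<longleftrightarrow> (\<forall>l\<in>set (snd (rep W)). snd l) \<or> (\<forall>l\<in>set (snd (rep W)). \<not> snd l)"

section \<open>Substrings, kisses, g-vectors (for a blossoming quiver, Q0 = range Inl)\<close>

text \<open>Occurrence (i, j) of a substring of sigma: letters i .. j-1, vertices i .. j, all in Q0.\<close>
definition occ :: "('v + 'x,'c) bquiver \<Rightarrow> ('v + 'x,'c) str \<Rightarrow> nat \<times> nat \<Rightarrow> bool" where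
  "occ B \<sigma> ij \<longleftrightarrow> (case ij of (i, j) \<Rightarrow> i \<le> j \<and> j \<le> length (snd \<sigma>) \<and>
      (\<forall>k\<in>{i..j}. isl (vtx B \<sigma> k)))"

definition top_occ :: "('v + 'x,'c) bquiver \<Rightarrow> ('v + 'x,'c) str \<Rightarrow> nat \<times> nat \<Rightarrow> bool" where
  "top_occ B \<sigma> ij \<longleftrightarrow> occ B \<sigma> ij \<and> (case ij of (i, j) \<Rightarrow> 0 < i \<and> j < length (snd \<sigma>) \<and>
      \<not> snd (snd \<sigma> ! (i - 1)) \<and> snd (snd \<sigma> ! j))"

definition bot_occ :: "('v + 'x,'c) bquiver \<Rightarrow> ('v + 'x,'c) str \<Rightarrow> nat \<times> nat \<Rightarrow> bool" where
  "bot_occ B \<sigma> ij \<longleftrightarrow> occ B \<sigma> ij \<and> (case ij of (i, j) \<Rightarrow> 0 < i \<and> j < length (snd \<sigma>) \<and>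
      snd (snd \<sigma> ! (i - 1)) \<and> \<not> snd (snd \<sigma> ! j))"

definition factor :: "('w,'c) bquiver \<Rightarrow> ('w,'c) str \<Rightarrow> nat \<times> nat \<Rightarrow> ('w,'c) str" where
  "factor B \<sigma> ij = (case ij of (i, j) \<Rightarrow> (vtx B \<sigma> i, take (j - i) (drop i (snd \<sigma>))))"

definition kiss_count :: "('v + 'x,'c) bquiver \<Rightarrow> ('v + 'x,'c) str set \<Rightarrow> ('v + 'x,'c) str set \<Rightarrow> nat" where
  "kiss_count B W W' = card {(o1, o2). top_occ B (rep W) o1 \<and> bot_occ B (rep W') o2 \<and>
       same_str B (factor B (rep W) o1) (factor B (rep W') o2)}"

definition kisses :: "('v + 'x,'c) bquiver \<Rightarrow> ('v + 'x,'c) str set \<Rightarrow> ('v + 'x,'c) str set \<Rightarrow> bool" where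
  "kisses B W W' \<longleftrightarrow> (\<exists>o1 o2. top_occ B (rep W) o1 \<and> bot_occ B (rep W') o2 \<and>
       same_str B (factor B (rep W) o1) (factor B (rep W') o2))"

definition KN :: "('v + 'x,'c) bquiver \<Rightarrow> ('v + 'x,'c) str set \<Rightarrow> ('v + 'x,'c) str set \<Rightarrow> nat" where
  "KN B W W' = kiss_count B W W' + kiss_count B W' W"

definition nsk_walks :: "('v + 'x,'c) bquiver \<Rightarrow> ('v + 'x,'c) str set set" where
  "nsk_walks B = {W\<in>walks B. \<not> kisses B W W}"

definition kappa :: "('v + 'x,'c) bquiver \<Rightarrow> ('v + 'x,'c) str set \<Rightarrow> real" where
  "kappa B W = real (\<Sum>W'\<in>nsk_walks B. KN B W W')"

definition nk_complex :: "('v + 'x,'c) bquiver \<Rightarrow> ('v + 'x,'c) str set set set" where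
  "nk_complex B = {F. F \<subseteq> {W\<in>nsk_walks B. \<not> straight W} \<and>
      (\<forall>W\<in>F. \<forall>W'\<in>F. W \<noteq> W' \<longrightarrow> \<not> kisses B W W')}"

definition facets :: "('v + 'x,'c) bquiver \<Rightarrow> ('v + 'x,'c) str set set set" where
  "facets B = {F\<in>nk_complex B. \<forall>G\<in>nk_complex B. F \<subseteq> G \<longrightarrow> G = F}"

definition gvec :: "('v::finite + 'x,'c) bquiver \<Rightarrow> ('v + 'x,'c) str set \<Rightarrow> real^'v" where
  "gvec B W = (\<chi> v. real (card {i. top_occ B (rep W) (i, i) \<and> vtx B (rep W) i = Inl v})
                   - real (card {i. bot_occ B (rep W) (i, i) \<and> vtx B (rep W) i = Inl v}))"

text \<open>A mark (W, k): position k of the representative of W carries the arrow alpha (in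
  either direction). The oriented marked string reads alpha forward at the mark.\<close>
definition marks :: "('w,'c) bquiver \<Rightarrow> ('w,'c) str set set \<Rightarrow> 'c \<Rightarrow> (('w,'c) str set \<times> nat) set" where
  "marks B S \<alpha> = {(W, k). W \<in> S \<and> k < length (snd (rep W)) \<and> fst (snd (rep W) ! k) = \<alpha>}"

definition orient :: "('w,'c) bquiver \<Rightarrow> ('w,'c) str set \<times> nat \<Rightarrow> ('c \<times> bool) list \<times> nat" where
  "orient B m = (case m of (W, k) \<Rightarrow>
      if snd (snd (rep W) ! k) then (snd (rep W), k)
      else (snd (str_inv B (rep W)), length (snd (rep W)) - 1 - k))"

definition rcommon :: "('c \<times> bool) list \<times> nat \<Rightarrow> ('c \<times> bool) list \<times> nat \<Rightarrow> nat" where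
  "rcommon m m' = (case m of (xs, p) \<Rightarrow> case m' of (ys, q) \<Rightarrow>
     (LEAST r. \<not> (p + r < length xs \<and> q + r < length ys \<and> xs ! (p + r) = ys ! (q + r))))"

definition lcommon :: "('c \<times> bool) list \<times> nat \<Rightarrow> ('c \<times> bool) list \<times> nat \<Rightarrow> nat" where
  "lcommon m m' = (case m of (xs, p) \<Rightarrow> case m' of (ys, q) \<Rightarrow>
     (LEAST r. \<not> (r < p \<and> r < q \<and> xs ! (p - r - 1) = ys ! (q - r - 1))))"

definition cc_prec :: "('c \<times> bool) list \<times> nat \<Rightarrow> ('c \<times> bool) list \<times> nat \<Rightarrow> bool" where
  "cc_prec m m' = (case m of (xs, p) \<Rightarrow> case m' of (ys, q) \<Rightarrow>
     (let R = rcommon m m'; L = lcommon m m' in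
       (p + R < length xs \<and> q + R < length ys \<longrightarrow> snd (xs ! (p + R)) \<and> \<not> snd (ys ! (q + R))) \<and>
       (L < p \<and> L < q \<longrightarrow> snd (xs ! (p - L - 1)) \<and> \<not> snd (ys ! (q - L - 1)))))"

definition straight_walks :: "('w,'c) bquiver \<Rightarrow> ('w,'c) str set set" where
  "straight_walks B = {W\<in>walks B. straight W}"

definition dist_pos :: "('w,'c) bquiver \<Rightarrow> ('w,'c) str set set \<Rightarrow> ('w,'c) str set \<Rightarrow> nat set" where
  "dist_pos B F W = {k. \<exists>\<alpha>\<in>arrs B. (W, k) \<in> marks B (F \<union> straight_walks B) \<alpha> \<and>
      (\<forall>m'\<in>marks B (F \<union> straight_walks B) \<alpha>. m' \<noteq> (W, k) \<longrightarrow> cc_prec (orient B m') (orient B (W, k)))}"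

text \<open>c(omega, F) = +/- m_sigma, sigma the substring between the two distinguished arrows
  (vertices k1+1 .. k2 of the representative), sign + iff sigma is a top substring.\<close>
definition cvec :: "('v::finite + 'x,'c) bquiver \<Rightarrow> ('v + 'x,'c) str set set \<Rightarrow> ('v + 'x,'c) str set \<Rightarrow> real^'v" where
  "cvec B F W = (let k1 = Min (dist_pos B F W); k2 = Max (dist_pos B F W); ls = snd (rep W);
       m = (\<chi> v. real (card {i. k1 < i \<and> i \<le> k2 \<and> vtx B (rep W) i = Inl v})) in
     (if \<not> snd (ls ! k1) \<and> snd (ls ! k2) then m else - m))"

definition pt :: "('v::finite + 'x,'c) bquiver \<Rightarrow> ('v + 'x,'c) str set set \<Rightarrow> real^'v" where
  "pt B F = (\<Sum>W\<in>F. kappa B W *\<^sub>R cvec B F W)"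

definition nonneg_span :: "'a::real_vector set \<Rightarrow> 'a set" where
  "nonneg_span S = {y. \<exists>c. (\<forall>x\<in>S. 0 \<le> c x) \<and> y = (\<Sum>x\<in>S. c x *\<^sub>R x)}"

definition normal_cone :: "('a::real_inner) set \<Rightarrow> 'a set \<Rightarrow> 'a set" where
  "normal_cone P G = {c. \<forall>x\<in>G. \<forall>y\<in>P. inner c y \<le> inner c x}"

definition normal_fan :: "('a::real_inner) set \<Rightarrow> 'a set set" where
  "normal_fan P = {normal_cone P G | G. G face_of P \<and> G \<noteq> {}}"

definition g_fan :: "('v::finite + 'x,'c) bquiver \<Rightarrow> (real^'v) set set" where
  "g_fan B = {nonneg_span (gvec B ` F) | F. F \<in> nk_complex B}"

definition asso_hull :: "('v::finite + 'x,'c) bquiver \<Rightarrow> (real^'v) set" where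
  "asso_hull B = convex hull (pt B ` facets B)"

definition asso_halfspaces :: "('v::finite + 'x,'c) bquiver \<Rightarrow> (real^'v) set" where
  "asso_halfspaces B = {x. \<forall>W\<in>nsk_walks B. inner (gvec B W) x \<le> kappa B W}"

end

theory Submission
  imports Defs
begin

text \<open>
  Fix a vector x. A walk is coherent if the coordinates of x sum to a nonnegative number over each of its
  top substrings and to a negative number over each of its bottom substrings; two coherent walks never
  kiss. Starting from an arrow and turning according to the sign of the running sum of x produces a
  coherent walk, and these greedy walks are exactly the distinguished walks at the arrows. Each bending
  coherent walk is greedy at exactly one arrow of each direction, so counting arrows shows that there are
  as many bending coherent walks as vertices. Counting maximal common factors shows that their g- and
  c-vectors are dual bases and that x has nonnegative coordinates, so x lies in the cone of its coherent
  walks. This requires the greedy walks to be finite; an infinite one is periodic for integral x, and its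
  period is orthogonal to all coherent walks and to x, which finiteness of the complex excludes by a
  generic segment argument. Hence the cones cover the space, and every facet arises in this way.

  For heights, fix a walk and the sets of its vertices bounded by incoming arrows. The sum of the
  g-vector of another walk over such a set is at most the number of kisses between them. For the walks of
  a facet, equality holds at a set maximising the sum of an interior point of the cone of the facet.
  Summing these maximisers over all walks gives the point p(F), which therefore is tight exactly at
  the walks of F.
\<close>

section \<open>Letters and words\<close>

text \<open>By gentleness a letter that ends at an inner vertex has exactly one continuation of each
  sign, so two words separate after a common part with opposite signs. One identity carries the
  proof: the sum of a g-vector over a set of vertices of a word is the number of top runs minus the
  number of bottom runs (\<open>run_lemma\<close>). For a distinguished string it gives the duality
  with c-vectors, for a closed set the bound by kissing numbers, for a high power of a period the
  orthogonality behind termination. Two obstacles shape the definitions. A common factor of length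
  zero has no orientation and must still be counted once. A vector may sum to zero over a substring,
  so ties must be broken independently of the reading direction: zero counts as positive, which
  gives a weak inequality to the right of a mark and a strict one to its left. Counting arrows,
  together with the segment argument, takes the place of exchanging walks between adjacent
  facets.\<close>

definition linv :: "'c \<times> bool \<Rightarrow> 'c \<times> bool" where
  "linv l = (fst l, \<not> snd l)"

definition winv :: "('c \<times> bool) list \<Rightarrow> ('c \<times> bool) list" where
  "winv w = rev (map linv w)"

definition ori :: "bool \<Rightarrow> ('c \<times> bool) list \<Rightarrow> ('c \<times> bool) list" where
  "ori b w = (if b then w else winv w)"

lemma linv_linv [simp]: "linv (linv l) = l"
  by (simp add: linv_def)

lemma snd_linv [simp]: "snd (linv l) = (\<not> snd l)"
  by (simp add: linv_def)

lemma fst_linv [simp]: "fst (linv l) = fst l"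
  by (simp add: linv_def)

lemma linv_eq_iff [simp]: "linv l = linv l' \<longleftrightarrow> l = l'"
  by (metis linv_linv)

lemma linv_neq [simp]: "linv l \<noteq> l" "l \<noteq> linv l"
  by (metis snd_linv)+

lemma length_winv [simp]: "length (winv w) = length w"
  by (simp add: winv_def)

lemma length_ori [simp]: "length (ori b w) = length w"
  by (simp add: ori_def)

lemma winv_winv [simp]: "winv (winv w) = w"
  by (simp add: winv_def rev_map comp_def)

lemma ori_True [simp]: "ori True w = w" and ori_False [simp]: "ori False w = winv w"
  by (simp_all add: ori_def)

lemma winv_nth: "k < length w \<Longrightarrow> winv w ! k = linv (w ! (length w - 1 - k))"
  by (simp add: winv_def rev_nth)

lemma winv_Nil [simp]: "winv w = [] \<longleftrightarrow> w = []"
  by (simp add: winv_def)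

lemma lsrc_linv [simp]: "lsrc B (linv l) = ltgt B l"
  by (cases l) (simp add: linv_def)

lemma ltgt_linv [simp]: "ltgt B (linv l) = lsrc B l"
  by (cases l) (simp add: linv_def)

text \<open>The internal vertices of a word carry the indices 1, ..., length - 1.\<close>

definition pv :: "('w, 'c) bquiver \<Rightarrow> ('c \<times> bool) list \<Rightarrow> nat \<Rightarrow> 'w" where
  "pv B u i = ltgt B (u ! (i - 1))"

section \<open>Local structure of a blossoming quiver\<close>

locale blossom_quiver =
  fixes B :: "('v::finite + 'x, 'c) bquiver"
  assumes finite_arrs: "finite (arrs B)"
    and inner_verts: "Inl v \<in> verts B"
    and end_verts: "a \<in> arrs B \<Longrightarrow> src B a \<in> verts B \<and> tgt B a \<in> verts B"
    and in_two: "card {a \<in> arrs B. tgt B a = Inl v} = 2"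
    and out_two: "card {a \<in> arrs B. src B a = Inl v} = 2"
    and nonrel_out: "a \<in> arrs B \<Longrightarrow> tgt B a = Inl v \<Longrightarrow> \<exists>!c. c \<in> arrs B \<and> src B c = Inl v \<and> (a, c) \<notin> rels B"
    and nonrel_in: "c \<in> arrs B \<Longrightarrow> src B c = Inl v \<Longrightarrow> \<exists>!a. a \<in> arrs B \<and> tgt B a = Inl v \<and> (a, c) \<notin> rels B"
    and blossom: "fst l \<in> arrs B \<Longrightarrow> fst l' \<in> arrs B \<Longrightarrow> lsrc B l = Inr y \<Longrightarrow> lsrc B l' = Inr y \<Longrightarrow> l = l'"
    and admissible: "admissible B"
begin

definition L :: "('c \<times> bool) set" where "L = {l. fst l \<in> arrs B}"

definition ok :: "'c \<times> bool \<Rightarrow> 'c \<times> bool \<Rightarrow> bool" where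
  "ok l l' \<longleftrightarrow> l \<in> L \<and> l' \<in> L \<and> ltgt B l = lsrc B l' \<and> l' \<noteq> linv l \<and>
     \<not> (snd l \<and> snd l' \<and> (fst l, fst l') \<in> rels B) \<and>
     \<not> (\<not> snd l \<and> \<not> snd l' \<and> (fst l', fst l) \<in> rels B)"

definition chain :: "('c \<times> bool) list \<Rightarrow> bool" where
  "chain u \<longleftrightarrow> set u \<subseteq> L \<and> (\<forall>k. Suc k < length u \<longrightarrow> ok (u ! k) (u ! Suc k))"

definition walk_word :: "('c \<times> bool) list \<Rightarrow> bool" where
  "walk_word w \<longleftrightarrow> chain w \<and> w \<noteq> [] \<and> \<not> isl (lsrc B (hd w)) \<and> \<not> isl (ltgt B (last w))"

lemma finite_L: "finite L"
proof -
  have "L = arrs B \<times> UNIV" by (auto simp: L_def)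
  then show ?thesis using finite_arrs by simp
qed

lemma linv_L [simp]: "linv l \<in> L \<longleftrightarrow> l \<in> L"
  by (simp add: L_def)

lemma ok_linv: "ok l l' \<Longrightarrow> ok (linv l') (linv l)"
  by (auto simp: ok_def)

text \<open>Only one letter leaves a blossom vertex, so any continuation there would be a
  backtrack.\<close>

lemma ok_isl: assumes "ok l l'" shows "isl (ltgt B l)"
proof (rule ccontr)
  assume "\<not> isl (ltgt B l)"
  then obtain y where y: "ltgt B l = Inr y" by (cases "ltgt B l") auto
  have "l' = linv l"
    by (rule blossom[of _ _ y]) (use assms y in \<open>auto simp: ok_def L_def\<close>)
  then show False using assms by (simp add: ok_def)
qed

lemma two_elem: assumes "card {a. P a} = 2" "P a" "P b" "P c" "a \<noteq> b" shows "c = a \<or> c = b"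
proof -
  obtain x y where "{a. P a} = {x, y}" using assms(1) by (metis card_2_iff)
  then show ?thesis using assms by (metis insert_iff mem_Collect_eq singletonD)
qed

lemma two_ex1: assumes "card {a. P a} = 2" "P a" shows "\<exists>!b. P b \<and> b \<noteq> a"
proof -
  obtain x y where xy: "{a. P a} = {x, y}" "x \<noteq> y" using assms(1) by (metis card_2_iff)
  then have "P b \<longleftrightarrow> b = x \<or> b = y" for b by blast
  then show ?thesis using assms(2) xy(2) by metis
qed

text \<open>This is where gentleness enters: a continuation of the same sign is the unique arrow
  without relation, and one of the opposite sign is the other of the two arrows with the same target
  or the same source.\<close>

lemma next_ex1:
  assumes l: "l \<in> L" and v: "ltgt B l = Inl v"
  shows "\<exists>!l'. ok l l' \<and> snd l' = s"
proof -
  obtain a d where ad: "l = (a, d)" by (cases l)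
  have a: "a \<in> arrs B" using l ad by (simp add: L_def)
  have R: "ok l l' \<and> snd l' = s \<longleftrightarrow> (\<exists>b. l' = (b, s) \<and> b \<in> arrs B \<and> lsrc B (b, s) = Inl v \<and>
      (if d = s then (if d then (a, b) \<notin> rels B else (b, a) \<notin> rels B) else b \<noteq> a))" for l'
    using a v ad by (cases l') (auto simp: ok_def L_def linv_def)
  have "\<exists>!b. b \<in> arrs B \<and> lsrc B (b, s) = Inl v \<and>
      (if d = s then (if d then (a, b) \<notin> rels B else (b, a) \<notin> rels B) else b \<noteq> a)"
  proof (cases d)
    case True
    then have t: "tgt B a = Inl v" using v ad by simp
    show ?thesis
    proof (cases s)
      case True
      then show ?thesis using nonrel_out[OF a t] \<open>d\<close> by simp
    next
      case False
      have "\<exists>!b. (b \<in> arrs B \<and> tgt B b = Inl v) \<and> b \<noteq> a"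
        by (rule two_ex1) (use in_two a t in auto)
      then show ?thesis using False \<open>d\<close> by simp
    qed
  next
    case False
    then have t: "src B a = Inl v" using v ad by simp
    show ?thesis
    proof (cases s)
      case False
      then show ?thesis using nonrel_in[OF a t] \<open>\<not> d\<close> by simp
    next
      case True
      have "\<exists>!b. (b \<in> arrs B \<and> src B b = Inl v) \<and> b \<noteq> a"
        by (rule two_ex1) (use out_two a t in auto)
      then show ?thesis using True \<open>\<not> d\<close> by simp
    qed
  qed
  then obtain b where b: "b \<in> arrs B \<and> lsrc B (b, s) = Inl v \<and>
      (if d = s then (if d then (a, b) \<notin> rels B else (b, a) \<notin> rels B) else b \<noteq> a)"
    and u: "\<And>b'. b' \<in> arrs B \<and> lsrc B (b', s) = Inl v \<and>
      (if d = s then (if d then (a, b') \<notin> rels B else (b', a) \<notin> rels B) else b' \<noteq> a) \<Longrightarrow> b' = b"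
    by blast
  show ?thesis
  proof (rule ex1I[of _ "(b, s)"])
    show "ok l (b, s) \<and> snd (b, s) = s" using R[of "(b, s)"] b by blast
    show "l' = (b, s)" if "ok l l' \<and> snd l' = s" for l'
      using R[of l'] that u by blast
  qed
qed

lemma ok_unique: "ok l l' \<Longrightarrow> ok l l'' \<Longrightarrow> snd l' = snd l'' \<Longrightarrow> l' = l''"
proof -
  assume a: "ok l l'" "ok l l''" "snd l' = snd l''"
  obtain v where "ltgt B l = Inl v" using ok_isl[OF a(1)] by (cases "ltgt B l") auto
  moreover have "l \<in> L" using a(1) by (simp add: ok_def)
  ultimately show "l' = l''" using next_ex1[of l v "snd l'"] a by metis
qed

lemma ok_unique_left: "ok l' l \<Longrightarrow> ok l'' l \<Longrightarrow> snd l' = snd l'' \<Longrightarrow> l' = l''"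
  using ok_unique[of "linv l" "linv l'" "linv l''"] ok_linv by fastforce

text \<open>At a peak or deep exactly two letters of sign \<open>d\<close> leave the vertex: the
  next letter and the inverse of the previous one. This settles common factors of length zero, where
  a letter of the other word can match in either orientation.\<close>

lemma bend_letters:
  assumes ok: "ok l l'" and s: "snd l = (\<not> d)" "snd l' = d"
    and h: "h \<in> L" "lsrc B h = ltgt B l" "snd h = d"
  shows "h = l' \<or> h = linv l"
proof -
  obtain v where v: "ltgt B l = Inl v" using ok_isl[OF ok] by (cases "ltgt B l") auto
  obtain a where a: "l = (a, \<not> d)" using s by (cases l) auto
  obtain b where b: "l' = (b, d)" using s by (cases l') auto
  obtain c where c: "h = (c, d)" using h by (cases h) auto
  have ab: "a \<noteq> b" using ok a b by (auto simp: ok_def linv_def)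
  have m: "a \<in> arrs B" "b \<in> arrs B" "c \<in> arrs B" using ok h a b c by (auto simp: ok_def L_def)
  have "c = a \<or> c = b"
  proof (cases d)
    case True
    show ?thesis
      by (rule two_elem[of "\<lambda>a. a \<in> arrs B \<and> src B a = Inl v"])
        (use out_two[of v] m a b c True ok h(2) v ab in \<open>simp_all add: ok_def\<close>)
  next
    case False
    show ?thesis
      by (rule two_elem[of "\<lambda>a. a \<in> arrs B \<and> tgt B a = Inl v"])
        (use in_two[of v] m a b c False ok h(2) v ab in \<open>simp_all add: ok_def\<close>)
  qed
  then show ?thesis using a b c by (auto simp: linv_def)
qed

lemma chain_winv: assumes "chain u" shows "chain (winv u)"
  unfolding chain_def
proof (intro conjI allI impI)
  show "set (winv u) \<subseteq> L" using assms by (auto simp: chain_def winv_def)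
  fix k assume k: "Suc k < length (winv u)"
  then have "ok (u ! (length u - 1 - Suc k)) (u ! Suc (length u - 1 - Suc k))"
    using assms by (auto simp: chain_def)
  moreover have "Suc (length u - 1 - Suc k) = length u - 1 - k" using k by simp
  ultimately show "ok (winv u ! k) (winv u ! Suc k)"
    using k ok_linv by (simp add: winv_nth)
qed

lemma chain_ori: "chain u \<Longrightarrow> chain (ori b u)"
  by (simp add: ori_def chain_winv)

lemma wk_winv: assumes "walk_word w" shows "walk_word (winv w)"
  using assms chain_winv by (auto simp: walk_word_def winv_def hd_rev last_rev hd_map last_map)

lemma wk_ori: "walk_word w \<Longrightarrow> walk_word (ori b w)"
  by (simp add: ori_def wk_winv)

lemma wk_chain: "walk_word w \<Longrightarrow> chain w"
  by (simp add: walk_word_def)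

lemma chain_ok: "chain u \<Longrightarrow> 1 \<le> i \<Longrightarrow> i < length u \<Longrightarrow> ok (u ! (i - 1)) (u ! i)"
  by (auto simp: chain_def dest: spec[of _ "i - 1"])

lemma chain_L: "chain u \<Longrightarrow> i < length u \<Longrightarrow> u ! i \<in> L"
  by (auto simp: chain_def)

lemma pv_lsrc: "chain u \<Longrightarrow> 1 \<le> i \<Longrightarrow> i < length u \<Longrightarrow> pv B u i = lsrc B (u ! i)"
  using chain_ok[of u i] by (simp add: pv_def ok_def)

lemma pv_isl: "chain u \<Longrightarrow> 1 \<le> i \<Longrightarrow> i < length u \<Longrightarrow> isl (pv B u i)"
  using chain_ok[of u i] ok_isl by (simp add: pv_def)

lemma pv_winv: assumes "chain u" "1 \<le> i" "i < length u"
  shows "pv B (winv u) i = pv B u (length u - i)"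
proof -
  have "pv B (winv u) i = lsrc B (u ! (length u - 1 - (i - 1)))"
    using assms by (simp add: pv_def winv_nth)
  also have "length u - 1 - (i - 1) = length u - i" using assms by simp
  finally show ?thesis using pv_lsrc[OF assms(1), of "length u - i"] assms by simp
qed

text \<open>Blossom vertices occur only at the ends of a walk, so a single letter shows whether the
  walk ends with it. Hence walks that share a letter also end together there.\<close>

lemma wk_last: assumes "walk_word w" "k < length w" shows "isl (ltgt B (w ! k)) \<longleftrightarrow> Suc k < length w"
proof
  assume "isl (ltgt B (w ! k))"
  then have "w ! k \<noteq> last w" using assms by (auto simp: walk_word_def)
  then show "Suc k < length w" using assms by (metis Suc_lessI diff_Suc_1 last_conv_nth list.size(3) not_less_zero)
next
  assume "Suc k < length w"
  then show "isl (ltgt B (w ! k))" using pv_isl[OF wk_chain[OF assms(1)], of "Suc k"] by (simp add: pv_def)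
qed

lemma wk_first: assumes "walk_word w" "k < length w" shows "isl (lsrc B (w ! k)) \<longleftrightarrow> 0 < k"
proof -
  have "isl (ltgt B (winv w ! (length w - 1 - k))) \<longleftrightarrow> Suc (length w - 1 - k) < length w"
    using wk_last[OF wk_winv[OF assms(1)], of "length w - 1 - k"] assms(2) by simp
  moreover have "winv w ! (length w - 1 - k) = linv (w ! k)"
    using assms(2) by (simp add: winv_nth)
  ultimately show ?thesis using assms(2) by auto
qed

text \<open>Look at the middle: odd length would give a letter equal to its inverse, even length an
  immediate backtrack.\<close>

lemma winv_neq: assumes c: "chain w" and ne: "w \<noteq> []" shows "winv w \<noteq> w"
proof
  assume eq: "winv w = w"
  let ?n = "length w"
  have n: "?n > 0" using ne by simp
  have h: "w ! k = linv (w ! (?n - 1 - k))" if "k < ?n" for k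
    using winv_nth[OF that] eq by simp
  consider (odd) m where "?n = 2 * m + 1" | (even) m where "?n = 2 * m + 2"
  proof -
    have "\<exists>m. ?n = 2 * m + 1 \<or> ?n = 2 * m + 2" using n by presburger
    then show ?thesis using that by blast
  qed
  then show False
  proof cases
    case odd
    then show False using h[of m] by simp
  next
    case even
    then have "w ! Suc m = linv (w ! m)" using h[of "Suc m"] by simp
    moreover have "ok (w ! m) (w ! Suc m)" using c even by (simp add: chain_def)
    ultimately show False by (simp add: ok_def)
  qed
qed

end

section \<open>Common factors and g-vectors\<close>

text \<open>The pairs in \<open>E\<close> are steps from \<open>(i, j)\<close> to
  \<open>(i + 1, j + 1)\<close>, which link \<open>V\<close> into diagonal chains; \<open>R\<close>
  lists the chains by starting point and number of steps. The sum telescopes along each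
  chain.\<close>

lemma run_sum:
  fixes f :: "nat \<Rightarrow> real" and E V :: "(nat \<times> nat) set"
  defines "R \<equiv> {(i, j, k). (i, j) \<in> V \<and> (\<forall>l<k. (i + l, j + l) \<in> E) \<and> (i + k, j + k) \<notin> E \<and>
       (i, j) \<notin> (\<lambda>(i, j). (Suc i, Suc j)) ` E}"
  assumes fin: "finite V" and EV: "E \<subseteq> V" and shift: "\<And>i j. (i, j) \<in> E \<Longrightarrow> (Suc i, Suc j) \<in> V"
  shows "(\<Sum>(i, j)\<in>V. f j - f (j - 1)) = (\<Sum>(i, j, k)\<in>R. f (j + k) - f (j - 1))" and "finite R"
proof -
  let ?s = "\<lambda>(i::nat, j::nat). (Suc i, Suc j)"
  have finE: "finite E" using EV fin finite_subset by blast
  have sEV: "?s ` E \<subseteq> V" using shift by auto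
  have inj_s: "inj_on ?s E" by (auto simp: inj_on_def)
  have b1: "bij_betw (\<lambda>(i, j, k). (i, j)) R (V - ?s ` E)"
    unfolding bij_betw_def
  proof
    show "inj_on (\<lambda>(i, j, k). (i, j)) R"
    proof (rule inj_onI)
      fix a b assume a: "a \<in> R" "b \<in> R" and eq: "(\<lambda>(i, j, k). (i, j)) a = (\<lambda>(i, j, k). (i, j)) b"
      obtain i j k k' where ab: "a = (i, j, k)" "b = (i, j, k')" using eq by (cases a, cases b) auto
      have "\<not> k < k'" "\<not> k' < k" using a unfolding ab R_def by auto
      then show "a = b" using ab by simp
    qed
    show "(\<lambda>(i, j, k). (i, j)) ` R = V - ?s ` E"
    proof (rule set_eqI, rule iffI)
      fix p assume "p \<in> (\<lambda>(i, j, k). (i, j)) ` R"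
      then show "p \<in> V - ?s ` E" unfolding R_def by auto
    next
      fix p assume p: "p \<in> V - ?s ` E"
      obtain i j where ij: "p = (i, j)" by (cases p)
      have "inj (\<lambda>k. (i + k, j + k))" by (auto simp: inj_def)
      then have "finite {k. (i + k, j + k) \<in> E}"
        using finite_vimageI[OF finE] by (simp add: vimage_def)
      then obtain k where k: "(i + k, j + k) \<notin> E" using infinite_UNIV_nat
        by (metis (mono_tags, lifting) UNIV_eq_I mem_Collect_eq)
      let ?k = "LEAST k. (i + k, j + k) \<notin> E"
      have "(i + ?k, j + ?k) \<notin> E" using LeastI[of "\<lambda>k. (i + k, j + k) \<notin> E", OF k] .
      moreover have "\<forall>l<?k. (i + l, j + l) \<in> E" using not_less_Least by blast
      ultimately have "(i, j, ?k) \<in> R" using p ij by (auto simp: R_def)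
      then show "p \<in> (\<lambda>(i, j, k). (i, j)) ` R" using ij by force
    qed
  qed
  have b2: "bij_betw (\<lambda>(i, j, k). (i + k, j + k)) R (V - E)"
    unfolding bij_betw_def
  proof
    \<comment> \<open>Chains with the same end coincide: the longer one would enter the start of the
      shorter one by a step in \<open>E\<close>.\<close>
    have lt: False if "(i, j, k) \<in> R" "(i', j', k') \<in> R" "i + k = i' + k'" "j + k = j' + k'" "k < k'" for i j k i' j' k'
    proof -
      have "\<forall>l<k'. (i' + l, j' + l) \<in> E" using that(2) unfolding R_def by auto
      moreover have "k' - k - 1 < k'" using that(5) by simp
      ultimately have "(i' + (k' - k - 1), j' + (k' - k - 1)) \<in> E" by blast
      moreover have "(i, j) = ?s (i' + (k' - k - 1), j' + (k' - k - 1))" using that by auto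
      ultimately show False using that(1) unfolding R_def by blast
    qed
    show "inj_on (\<lambda>(i, j, k). (i + k, j + k)) R"
    proof (rule inj_onI)
      fix a b assume a: "a \<in> R" "b \<in> R" and eq: "(\<lambda>(i, j, k). (i + k, j + k)) a = (\<lambda>(i, j, k). (i + k, j + k)) b"
      obtain i j k i' j' k' where ab: "a = (i, j, k)" "b = (i', j', k')" by (cases a, cases b) auto
      have "\<not> k < k'" "\<not> k' < k" using a eq lt[of i j k i' j' k'] lt[of i' j' k' i j k] unfolding ab by auto
      then show "a = b" using ab eq by simp
    qed
    have ex: "(i, j) \<in> V \<Longrightarrow> \<exists>i0 j0 k. (i0, j0) \<in> V \<and> (\<forall>l<k. (i0 + l, j0 + l) \<in> E) \<and> i = i0 + k \<and> j = j0 + k \<and>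
        (i0, j0) \<notin> ?s ` E" for i j
    proof (induction i arbitrary: j rule: less_induct)
      case (less i)
      show ?case
      proof (cases "(i, j) \<in> ?s ` E")
        case False
        then show ?thesis using less.prems by (intro exI[of _ i] exI[of _ j] exI[of _ 0]) auto
      next
        case True
        then obtain i' j' where ij: "i = Suc i'" "j = Suc j'" "(i', j') \<in> E" by auto
        then obtain i0 j0 k where k: "(i0, j0) \<in> V" "\<forall>l<k. (i0 + l, j0 + l) \<in> E" "i' = i0 + k" "j' = j0 + k"
          "(i0, j0) \<notin> ?s ` E" using less.IH[of i' j'] EV by blast
        have "\<forall>l<Suc k. (i0 + l, j0 + l) \<in> E" using k ij less_Suc_eq by auto
        then show ?thesis using k ij by (intro exI[of _ i0] exI[of _ j0] exI[of _ "Suc k"]) auto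
      qed
    qed
    show "(\<lambda>(i, j, k). (i + k, j + k)) ` R = V - E"
    proof (rule set_eqI, rule iffI)
      fix p assume "p \<in> (\<lambda>(i, j, k). (i + k, j + k)) ` R"
      then obtain i j k where r: "(i, j, k) \<in> R" "p = (i + k, j + k)" by auto
      have "(i + k, j + k) \<in> V"
      proof (cases k)
        case 0
        then show ?thesis using r by (simp add: R_def)
      next
        case (Suc k')
        then have "(i + k', j + k') \<in> E" using r by (simp add: R_def)
        then show ?thesis using shift Suc by auto
      qed
      then show "p \<in> V - E" using r unfolding R_def by auto
    next
      fix p assume p: "p \<in> V - E"
      obtain i j where ij: "p = (i, j)" by (cases p)
      obtain i0 j0 k where "(i0, j0) \<in> V" "\<forall>l<k. (i0 + l, j0 + l) \<in> E" "i = i0 + k" "j = j0 + k"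
        "(i0, j0) \<notin> ?s ` E" using ex p ij by blast
      then have "(i0, j0, k) \<in> R" "p = (i0 + k, j0 + k)" using p ij unfolding R_def by auto
      then show "p \<in> (\<lambda>(i, j, k). (i + k, j + k)) ` R" by force
    qed
  qed
  show "finite R" using bij_betw_finite[OF b1] fin by simp
  \<comment> \<open>Removing the sources of steps from \<open>V\<close> leaves the ends of chains,
    removing the targets leaves their starts. The contributions of \<open>E\<close> cancel.\<close>
  have A: "(\<Sum>(i, j)\<in>V. f j) = (\<Sum>(i, j)\<in>E. f j) + (\<Sum>(i, j)\<in>V - E. f j)"
    using sum.subset_diff[OF EV fin, of "\<lambda>(i, j). f j"] by simp
  have C: "(\<Sum>(i, j)\<in>V. f (j - 1)) = (\<Sum>(i, j)\<in>?s ` E. f (j - 1)) + (\<Sum>(i, j)\<in>V - ?s ` E. f (j - 1))"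
    using sum.subset_diff[OF sEV fin, of "\<lambda>(i, j). f (j - 1)"] by simp
  have D: "(\<Sum>(i, j)\<in>?s ` E. f (j - 1)) = (\<Sum>(i, j)\<in>E. f j)"
    by (subst sum.reindex[OF inj_s]) (auto intro!: sum.cong)
  have E1: "(\<Sum>(i, j)\<in>V - E. f j) = (\<Sum>(i, j, k)\<in>R. f (j + k))"
    using sum.reindex_bij_betw[OF b2, of "\<lambda>(i, j). f j"] by (auto simp: case_prod_unfold)
  have E2: "(\<Sum>(i, j)\<in>V - ?s ` E. f (j - 1)) = (\<Sum>(i, j, k)\<in>R. f (j - 1))"
    using sum.reindex_bij_betw[OF b1, of "\<lambda>(i, j). f (j - 1)"] by (auto simp: case_prod_unfold)
  have "(\<Sum>(i, j)\<in>V. f j - f (j - 1)) = (\<Sum>(i, j)\<in>V. f j) - (\<Sum>(i, j)\<in>V. f (j - 1))"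
    by (simp add: case_prod_unfold sum_subtractf)
  also have "\<dots> = (\<Sum>(i, j, k)\<in>R. f (j + k)) - (\<Sum>(i, j, k)\<in>R. f (j - 1))"
    using A C D E1 E2 by simp
  also have "\<dots> = (\<Sum>(i, j, k)\<in>R. f (j + k) - f (j - 1))"
    by (simp add: case_prod_unfold sum_subtractf)
  finally show "(\<Sum>(i, j)\<in>V. f j - f (j - 1)) = (\<Sum>(i, j, k)\<in>R. f (j + k) - f (j - 1))" .
qed

lemma sum_of_bool_diff:
  assumes "finite R"
  shows "(\<Sum>r\<in>R. of_bool (P r) - of_bool (Q r) :: real) =
     real (card {r\<in>R. P r \<and> \<not> Q r}) - real (card {r\<in>R. Q r \<and> \<not> P r})"
proof -
  have "(\<Sum>r\<in>R. of_bool (P r) - of_bool (Q r) :: real) =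
      (\<Sum>r\<in>R. of_bool (P r \<and> \<not> Q r)) - (\<Sum>r\<in>R. of_bool (Q r \<and> \<not> P r))"
    unfolding sum_subtractf[symmetric] by (rule sum.cong) auto
  then show ?thesis using assms by (simp add: sum_of_bool_eq Int_def)
qed

context blossom_quiver begin

text \<open>A vertex passed without change of sign contributes zero, a peak one and a deep minus
  one, so this is the coordinate of the g-vector at \<open>V\<close>.\<close>

definition gw :: "('c \<times> bool) list \<Rightarrow> 'v + 'x \<Rightarrow> real" where
  "gw w V = (\<Sum>j=1..<length w. if pv B w j = V
      then of_bool (snd (w ! j)) - of_bool (snd (w ! (j - 1))) else 0)"

text \<open>A run is a maximal common factor (b, i, j, k) of u, restricted to S, and of w (b) or its inverse
  (not b), starting at the vertices i and j and having k letters. Factors of length zero have no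
  orientation, so they are recorded with b = True only. Instead of maximality one asks for the signs
  of the adjacent letters, which is equivalent by gentleness.\<close>

definition runs :: "bool \<Rightarrow> nat set \<Rightarrow> ('c \<times> bool) list \<Rightarrow> ('c \<times> bool) list \<Rightarrow> (bool \<times> nat \<times> nat \<times> nat) set" where
  "runs d S u w = {(b, i, j, k). {i..i + k} \<subseteq> S \<and> 1 \<le> j \<and> j + k < length w \<and> (k = 0 \<longrightarrow> b) \<and>
     pv B u i = pv B (ori b w) j \<and> (\<forall>l<k. u ! (i + l) = ori b w ! (j + l)) \<and>
     snd (ori b w ! (j - 1)) = (\<not> d) \<and> snd (ori b w ! (j + k)) = d \<and>
     (Suc (i + k) \<in> S \<longrightarrow> snd (u ! (i + k)) = (\<not> d)) \<and> (i - 1 \<in> S \<longrightarrow> snd (u ! (i - 1)) = d)}"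

text \<open>The contribution of vertex j of w to its g-vector is the difference of the signs of its two
  letters, which telescopes along common factors.\<close>

lemma run_lemma:
  assumes u: "chain u" and w: "walk_word w" and S: "S \<subseteq> {1..<length u}"
  shows "(\<Sum>i\<in>S. gw w (pv B u i)) = real (card (runs True S u w)) - real (card (runs False S u w))"
    and "finite (runs d S u w)"
proof -
  let ?n = "length w"
  let ?s = "\<lambda>(i::nat, j::nat). (Suc i, Suc j)"
  \<comment> \<open>Common letters in orientation \<open>b\<close> are the steps, \<open>P\<close>
    collects the coinciding vertices on such a step, and \<open>Z\<close> the isolated ones. The
    latter go into \<open>V True\<close> only, in accordance with the convention for
    \<open>k = 0\<close>.\<close>
  define E where "E = (\<lambda>b. {(i, j). i \<in> S \<and> Suc i \<in> S \<and> 1 \<le> j \<and> Suc j < ?n \<and> u ! i = ori b w ! j})"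
  define P where "P = (\<lambda>b. E b \<union> ?s ` E b)"
  define A where "A = {(i, j). i \<in> S \<and> 1 \<le> j \<and> j < ?n \<and> pv B u i = pv B w j}"
  define Z where "Z = {(i, j). (i, j) \<in> A \<and> (i, j) \<notin> P True \<and> (i, ?n - j) \<notin> P False}"
  define V where "V = (\<lambda>b. if b then P True \<union> Z else P False)"
  define R where "R = (\<lambda>b. {(i, j, k). (i, j) \<in> V b \<and> (\<forall>l<k. (i + l, j + l) \<in> E b) \<and> (i + k, j + k) \<notin> E b \<and>
       (i, j) \<notin> ?s ` E b})"
  define f where "f = (\<lambda>b j. of_bool (snd (ori b w ! j)) :: real)"
  have cw: "chain w" and co: "chain (ori b w)" for b using w by (auto simp: wk_chain chain_ori)
  have finS: "finite S" using S finite_subset by blast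
  have S1: "1 \<le> i" "i < length u" if "i \<in> S" for i using that S by auto
  have okS: "ok (u ! (i - 1)) (u ! i)" if "i \<in> S" for i using chain_ok[OF u] S1[OF that] by blast
  have okw: "ok (ori b w ! (j - 1)) (ori b w ! j)" if "1 \<le> j" "j < ?n" for j b
    using chain_ok[OF co, of j] that by simp
  have Pfact: "i \<in> S \<and> 1 \<le> j \<and> j < ?n \<and> pv B u i = pv B (ori b w) j \<and>
      (u ! i = ori b w ! j \<or> u ! (i - 1) = ori b w ! (j - 1))" if p: "(i, j) \<in> P b" for i j b
  proof -
    consider "(i, j) \<in> E b" | i' j' where "i = Suc i'" "j = Suc j'" "(i', j') \<in> E b"
      using p unfolding P_def by auto
    then show ?thesis
    proof cases
      case 1
      then have h: "i \<in> S" "1 \<le> j" "Suc j < ?n" "u ! i = ori b w ! j" by (auto simp: E_def)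
      have "pv B u i = pv B (ori b w) j"
        using pv_lsrc[OF u] pv_lsrc[OF co] S1 h by simp
      then show ?thesis using h by auto
    next
      case 2
      then show ?thesis by (auto simp: E_def pv_def)
    qed
  qed
  have wi: "winv w ! (?n - j) = linv (w ! (j - 1))" "winv w ! (?n - j - 1) = linv (w ! j)"
    if "1 \<le> j" "j < ?n" for j
  proof -
    have "?n - 1 - (?n - j) = j - 1" "?n - 1 - (?n - j - 1) = j" using that by auto
    then show "winv w ! (?n - j) = linv (w ! (j - 1))" "winv w ! (?n - j - 1) = linv (w ! j)"
      using that by (simp_all add: winv_nth)
  qed
  \<comment> \<open>A pair of vertices on common factors of both orientations would make
    \<open>u\<close> or \<open>w\<close> backtrack.\<close>
  have disj: "(i, ?n - j) \<notin> P False" if p: "(i, j) \<in> P True" for i j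
  proof
    assume q: "(i, ?n - j) \<in> P False"
    have j: "i \<in> S" "1 \<le> j" "j < ?n" and c1: "u ! i = w ! j \<or> u ! (i - 1) = w ! (j - 1)"
      using Pfact[OF p] by auto
    have c2: "u ! i = linv (w ! (j - 1)) \<or> u ! (i - 1) = linv (w ! j)"
      using Pfact[OF q] wi j by auto
    have "u ! i \<noteq> linv (u ! (i - 1))" "w ! j \<noteq> linv (w ! (j - 1))"
      using okS[OF j(1)] okw[of j True] j by (auto simp: ok_def)
    then show False using c1 c2 by (metis linv_linv)
  qed
  have PA: "P True \<subseteq> A" using Pfact by (auto simp: A_def)
  have PA': "(i, ?n - j) \<in> A" if "(i, j) \<in> P False" for i j
  proof -
    have h: "i \<in> S" "1 \<le> j" "j < ?n" "pv B u i = pv B (winv w) j" using Pfact[OF that] by auto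
    then show ?thesis using pv_winv[OF cw h(2,3)] by (auto simp: A_def)
  qed
  have finA: "finite A" by (rule finite_subset[of _ "S \<times> {..<?n}"]) (use finS in \<open>auto simp: A_def\<close>)
  have finP: "finite (P b)" for b
    by (rule finite_subset[of _ "S \<times> {..<?n}"]) (use finS Pfact in auto)
  have finV: "finite (V b)" for b
    using finP finA by (auto simp: V_def Z_def intro: finite_subset[of _ A])
  have EV: "E b \<subseteq> V b" for b by (auto simp: V_def P_def)
  have sV: "(Suc i, Suc j) \<in> V b" if "(i, j) \<in> E b" for i j b
    using that by (auto simp: V_def P_def)
  have rs: "(\<Sum>(i, j)\<in>V b. f b j - f b (j - 1)) = (\<Sum>(i, j, k)\<in>R b. f b (j + k) - f b (j - 1))"
    and finR: "finite (R b)" for b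
    unfolding R_def using run_sum[OF finV EV sV] by auto
  let ?phi = "\<lambda>(i::nat, j). (i, ?n - j)"
  have Vj: "i \<in> S \<and> 1 \<le> j \<and> j < ?n \<and> pv B u i = pv B (ori b w) j" if "(i, j) \<in> V b" for i j b
    using that Pfact[of i j b] by (auto simp: V_def Z_def A_def split: if_splits)
  have Adec: "A = V True \<union> ?phi ` P False"
  proof
    show "A \<subseteq> V True \<union> ?phi ` P False"
    proof
      fix p assume p: "p \<in> A"
      obtain i j where ij: "p = (i, j)" by (cases p)
      show "p \<in> V True \<union> ?phi ` P False"
      proof (cases "(i, ?n - j) \<in> P False")
        case True
        then have "?phi (i, ?n - j) \<in> ?phi ` P False" by (rule imageI)
        moreover have "?phi (i, ?n - j) = p" using p ij by (auto simp: A_def)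
        ultimately show ?thesis by simp
      next
        case False
        then show ?thesis using p ij by (auto simp: V_def Z_def)
      qed
    qed
    show "V True \<union> ?phi ` P False \<subseteq> A" using PA PA' by (auto simp: V_def Z_def)
  qed
  have Adisj: "V True \<inter> ?phi ` P False = {}"
  proof -
    have False if "(i, j) \<in> P False" "(i, ?n - j) \<in> V True" for i j
    proof -
      have "1 \<le> j" "j < ?n" using Pfact[OF that(1)] by auto
      then have "?n - (?n - j) = j" by simp
      then show False using that disj[of i "?n - j"] by (auto simp: V_def Z_def)
    qed
    then show ?thesis by auto
  qed
  have inj: "inj_on ?phi (P False)"
  proof (rule inj_onI)
    fix p q assume pq: "p \<in> P False" "q \<in> P False" "?phi p = ?phi q"
    obtain i j i' j' where "p = (i, j)" "q = (i', j')" by (cases p, cases q)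
    then show "p = q" using pq Pfact[of i j False] Pfact[of i' j' False] by auto
  qed
  define D where "D = (\<lambda>j. of_bool (snd (w ! j)) - of_bool (snd (w ! (j - 1))) :: real)"
  have "(\<Sum>i\<in>S. gw w (pv B u i)) = (\<Sum>i\<in>S. \<Sum>j=1..<?n. if pv B u i = pv B w j then D j else 0)"
    unfolding gw_def D_def by (intro sum.cong) auto
  also have "\<dots> = (\<Sum>(i, j)\<in>S \<times> {1..<?n}. if pv B u i = pv B w j then D j else 0)"
    by (simp add: sum.cartesian_product)
  also have "\<dots> = (\<Sum>(i, j)\<in>A. D j)"
  proof -
    have "A \<subseteq> S \<times> {1..<?n}" by (auto simp: A_def)
    then show ?thesis
      by (intro sum.mono_neutral_cong_right) (use finS in \<open>auto simp: A_def\<close>)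
  qed
  also have "\<dots> = (\<Sum>(i, j)\<in>V True. D j) + (\<Sum>(i, j)\<in>?phi ` P False. D j)"
    unfolding Adec using Adisj finV[of True] finP by (subst sum.union_disjoint) auto
  also have "(\<Sum>(i, j)\<in>?phi ` P False. D j) = (\<Sum>(i, j)\<in>V False. f False j - f False (j - 1))"
  proof -
    \<comment> \<open>Inversion exchanges the two letters at the vertex and negates both signs, so
      the difference of signs is unchanged.\<close>
    have e: "D (?n - j) = f False j - f False (j - 1)" if "(i, j) \<in> P False" for i j
    proof -
      have j: "1 \<le> j" "j < ?n" using Pfact[OF that] by auto
      then have "?n - (?n - j) = j" "?n - (?n - j) - 1 = j - 1" by auto
      then show ?thesis using wi[of "?n - j"] j by (simp add: D_def f_def of_bool_def)
    qed
    show ?thesis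
      by (subst sum.reindex[OF inj]) (use e in \<open>auto simp: V_def intro!: sum.cong\<close>)
  qed
  also have "(\<Sum>(i, j)\<in>V True. D j) = (\<Sum>(i, j)\<in>V True. f True j - f True (j - 1))"
    by (simp add: D_def f_def)
  finally have main: "(\<Sum>i\<in>S. gw w (pv B u i)) =
      (\<Sum>(i, j, k)\<in>R True. f True (j + k) - f True (j - 1)) + (\<Sum>(i, j, k)\<in>R False. f False (j + k) - f False (j - 1))"
    using rs by simp
  define T where "T = (\<lambda>d b. {(i, j, k). (i, j, k) \<in> R b \<and> snd (ori b w ! (j - 1)) = (\<not> d) \<and> snd (ori b w ! (j + k)) = d})"
  have cnt: "(\<Sum>(i, j, k)\<in>R b. f b (j + k) - f b (j - 1)) = real (card (T True b)) - real (card (T False b))" for b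
    using sum_of_bool_diff[OF finR, of "\<lambda>(i, j, k). snd (ori b w ! (j + k))" "\<lambda>(i, j, k). snd (ori b w ! (j - 1))" b]
    unfolding T_def f_def by (simp add: case_prod_unfold conj_ac)
  have finT: "finite (T d b)" for d b
    by (rule finite_subset[OF _ finR[of b]]) (auto simp: T_def)
  have Rj: "j + k < ?n \<and> {i..i + k} \<subseteq> S" if "(i, j, k) \<in> R b" for i j k b
  proof (cases k)
    case 0
    then show ?thesis using that Vj[of i j b] by (auto simp: R_def)
  next
    case (Suc k')
    have e: "(i + l, j + l) \<in> E b" if "l < k" for l using \<open>(i, j, k) \<in> R b\<close> that by (auto simp: R_def)
    have "(i + k', j + k') \<in> E b" using e Suc by simp
    then have "j + k < ?n" "i + k \<in> S" using Suc by (auto simp: E_def)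
    moreover have "m \<in> S" if "m \<in> {i..<i + k}" for m
      using e[of "m - i"] that by (auto simp: E_def)
    ultimately show ?thesis by (metis atLeastAtMost_iff atLeastLessThan_iff nless_le subsetI)
  qed
  have Tr: "(i, j, k) \<in> T d b \<longleftrightarrow> (b, i, j, k) \<in> runs d S u w" for i j k b d
  proof
    assume t: "(i, j, k) \<in> T d b"
    then have r: "(i, j, k) \<in> R b" and substring_type: "snd (ori b w ! (j - 1)) = (\<not> d)" "snd (ori b w ! (j + k)) = d"
      by (auto simp: T_def)
    have v: "(i, j) \<in> V b" and e: "\<And>l. l < k \<Longrightarrow> (i + l, j + l) \<in> E b" and ne: "(i + k, j + k) \<notin> E b" "(i, j) \<notin> ?s ` E b"
      using r by (auto simp: R_def)
    note vj = Vj[OF v]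
    note rj = Rj[OF r]
    have zero: "(i, j) \<in> Z \<and> b" if "k = 0"
    proof -
      have "(i, j) \<notin> E b" "(i, j) \<notin> ?s ` E b" using ne that by auto
      then have "(i, j) \<notin> P b" by (simp add: P_def)
      then show ?thesis using v by (cases b) (auto simp: V_def)
    qed
    have iS: "i \<in> S" "i + k \<in> S" using rj by auto
    have isl': "Suc j' < ?n" if "j' < ?n" "isl (ltgt B (ori b w ! j'))" for j'
      using wk_last[OF wk_ori[OF w], of j' b] that by simp
    have isl0: "0 < j'" if "j' < ?n" "isl (lsrc B (ori b w ! j'))" for j'
      using wk_first[OF wk_ori[OF w], of j' b] that by simp
    \<comment> \<open>If both next letters had sign \<open>d\<close>, uniqueness of the continuation
      would lengthen the chain; for \<open>k = 0\<close>, \<open>bend_letters\<close> lengthens it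
      in one of the two orientations.\<close>
    have right: "snd (u ! (i + k)) = (\<not> d)" if sk: "Suc (i + k) \<in> S"
    proof (rule ccontr)
      assume "\<not> ?thesis"
      then have sd: "snd (u ! (i + k)) = d" by simp
      show False
      proof (cases k)
        case 0
        have z: "(i, j) \<notin> P True" "(i, ?n - j) \<notin> P False" "b" using zero 0 by (auto simp: Z_def)
        have uL: "u ! i \<in> L" using chain_L[OF u S1(2)[OF iS(1)]] .
        have "u ! i = w ! j \<or> u ! i = linv (w ! (j - 1))"
          by (rule bend_letters[of "w ! (j - 1)" "w ! j" d])
            (use okw[of j True] vj substring_type sd 0 z(3) uL pv_lsrc[OF u S1[OF iS(1)]] in \<open>auto simp: pv_def\<close>)
        then show False
        proof
          assume h: "u ! i = w ! j"
          have "isl (ltgt B (u ! i))" using pv_isl[OF u S1[OF sk]] 0 by (simp add: pv_def)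
          then have "Suc j < ?n" using isl'[of j] h vj z(3) by simp
          then have "(i, j) \<in> E True" using h vj iS sk 0 by (auto simp: E_def)
          then show False using z by (simp add: P_def)
        next
          assume h: "u ! i = linv (w ! (j - 1))"
          then have h': "u ! i = winv w ! (?n - j)" using wi vj by simp
          have "isl (ltgt B (u ! i))" using pv_isl[OF u S1[OF sk]] 0 by (simp add: pv_def)
          then have "0 < j - 1" using isl0[of "j - 1"] h vj z(3) by auto
          then have "(i, ?n - j) \<in> E False" using h' vj iS sk 0 by (auto simp: E_def)
          then show False using z by (simp add: P_def)
        qed
      next
        case (Suc k')
        have eq: "u ! (i + k') = ori b w ! (j + k')" using e[of k'] Suc by (simp add: E_def)
        have "ok (u ! (i + k')) (u ! (i + k))" using okS[OF iS(2)] Suc by simp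
        moreover have "ok (u ! (i + k')) (ori b w ! (j + k))" using okw[of "j + k" b] vj rj Suc eq by simp
        ultimately have h: "u ! (i + k) = ori b w ! (j + k)" using ok_unique sd substring_type by blast
        have "isl (ltgt B (u ! (i + k)))" using pv_isl[OF u S1[OF sk]] by (simp add: pv_def)
        then have "Suc (j + k) < ?n" using isl'[of "j + k"] h rj by simp
        then have "(i + k, j + k) \<in> E b" using h vj iS sk by (auto simp: E_def)
        then show False using ne by simp
      qed
    qed
    have left: "snd (u ! (i - 1)) = d" if sk: "i - 1 \<in> S"
    proof (rule ccontr)
      assume "\<not> ?thesis"
      then have sd: "snd (u ! (i - 1)) = (\<not> d)" by simp
      have i1: "1 \<le> i - 1" using S1[OF sk] by simp
      have ils: "isl (lsrc B (u ! (i - 1)))" using pv_isl[OF u S1[OF sk]] pv_lsrc[OF u S1[OF sk]] by simp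
      show False
      proof (cases k)
        case 0
        have z: "(i, j) \<notin> P True" "(i, ?n - j) \<notin> P False" "b" using zero 0 by (auto simp: Z_def)
        have uL: "u ! (i - 1) \<in> L" using chain_L[OF u S1(2)[OF sk]] .
        have "linv (u ! (i - 1)) = w ! j \<or> linv (u ! (i - 1)) = linv (w ! (j - 1))"
          by (rule bend_letters[of "w ! (j - 1)" "w ! j" d])
            (use okw[of j True] vj substring_type sd 0 z(3) uL in \<open>auto simp: pv_def\<close>)
        then show False
        proof
          assume h: "linv (u ! (i - 1)) = w ! j"
          have l: "linv (w ! j) = u ! (i - 1)" using h[symmetric] by simp
          have "isl (ltgt B (w ! j))" using ils h[symmetric] by simp
          then have sj: "Suc j < ?n" using isl'[of j] vj z(3) by simp
          have "u ! (i - 1) = winv w ! (?n - j - 1)" using wi vj l by simp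
          then have "(i - 1, ?n - j - 1) \<in> E False" using sj vj iS sk i1 by (auto simp: E_def)
          then have "?s (i - 1, ?n - j - 1) \<in> P False" unfolding P_def by blast
          moreover have "?s (i - 1, ?n - j - 1) = (i, ?n - j)" using sj i1 by auto
          ultimately show False using z by simp
        next
          assume h: "linv (u ! (i - 1)) = linv (w ! (j - 1))"
          then have h': "u ! (i - 1) = w ! (j - 1)" by simp
          then have "0 < j - 1" using isl0[of "j - 1"] ils vj z(3) by auto
          then have "(i - 1, j - 1) \<in> E True" using h' vj iS sk i1 by (auto simp: E_def)
          then have "?s (i - 1, j - 1) \<in> P True" unfolding P_def by blast
          moreover have "?s (i - 1, j - 1) = (i, j)" using vj i1 by auto
          ultimately show False using z by simp
        qed
      next
        case (Suc k')
        have eq: "u ! i = ori b w ! j" using e[of 0] Suc by (simp add: E_def)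
        have "ok (u ! (i - 1)) (u ! i)" using okS[OF iS(1)] .
        moreover have "ok (ori b w ! (j - 1)) (u ! i)" using okw[of j b] vj eq by simp
        ultimately have h: "u ! (i - 1) = ori b w ! (j - 1)" using ok_unique_left sd substring_type by blast
        then have "0 < j - 1" using isl0[of "j - 1"] ils vj by auto
        then have "(i - 1, j - 1) \<in> E b" using h vj iS sk i1 by (auto simp: E_def)
        then have "?s (i - 1, j - 1) \<in> ?s ` E b" by (rule imageI)
        moreover have "?s (i - 1, j - 1) = (i, j)" using vj i1 by auto
        ultimately show False using ne by simp
      qed
    qed
    show "(b, i, j, k) \<in> runs d S u w"
      using rj vj zero e substring_type right left by (auto simp: runs_def E_def)
  next
    assume "(b, i, j, k) \<in> runs d S u w"
    then have h: "{i..i + k} \<subseteq> S" "1 \<le> j" "j + k < ?n" "k = 0 \<longrightarrow> b" "pv B u i = pv B (ori b w) j"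
      "\<And>l. l < k \<Longrightarrow> u ! (i + l) = ori b w ! (j + l)"
      and substring_type: "snd (ori b w ! (j - 1)) = (\<not> d)" "snd (ori b w ! (j + k)) = d"
      and right: "Suc (i + k) \<in> S \<longrightarrow> snd (u ! (i + k)) = (\<not> d)" and left: "i - 1 \<in> S \<longrightarrow> snd (u ! (i - 1)) = d"
      by (auto simp: runs_def)
    have iS: "i + l \<in> S" if "l \<le> k" for l using h(1) that by auto
    have e: "(i + l, j + l) \<in> E b" if "l < k" for l
      using h(2,3) h(6)[OF that] iS[of l] iS[of "Suc l"] that by (auto simp: E_def)
    \<comment> \<open>Opposite signs at the boundary exclude a further common letter.\<close>
    have ne1: "(i + k, j + k) \<notin> E b" using right substring_type by (auto simp: E_def)
    have ne2: "(i, j) \<notin> ?s ` E b" using left substring_type by (auto simp: E_def)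
    have "(i, j) \<in> V b"
    proof (cases "k = 0")
      case False
      then show ?thesis using e[of 0] EV by auto
    next
      case True
      then have b: "b" using h by simp
      have "(i, ?n - j) \<notin> E False"
        using right substring_type wi[of j] h(2,3) b True by (auto simp: E_def)
      moreover have "(i, ?n - j) \<notin> ?s ` E False"
      proof
        assume "(i, ?n - j) \<in> ?s ` E False"
        then obtain i' j' where "i = Suc i'" "?n - j = Suc j'" "(i', j') \<in> E False" by auto
        then have "i - 1 \<in> S" "u ! (i - 1) = winv w ! (?n - j - 1)" by (auto simp: E_def simp del: diff_diff_left)
        then show False using left substring_type wi[of j] h(2,3) b True by auto
      qed
      moreover have "(i, j) \<notin> P True" using ne1 ne2 True b by (auto simp: P_def)
      ultimately show ?thesis using h iS[of 0] b by (auto simp: V_def Z_def A_def P_def)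
    qed
    then show "(i, j, k) \<in> T d b" using e ne1 ne2 substring_type by (auto simp: T_def R_def)
  qed
  have runs_eq: "runs d S u w = Pair True ` T d True \<union> Pair False ` T d False" for d
  proof (rule set_eqI)
    fix r :: "bool \<times> nat \<times> nat \<times> nat"
    obtain b i j k where "r = (b, i, j, k)" by (cases r)
    then show "r \<in> runs d S u w \<longleftrightarrow> r \<in> Pair True ` T d True \<union> Pair False ` T d False"
      using Tr[of i j k d b] by (cases b) auto
  qed
  show "finite (runs d S u w)" unfolding runs_eq using finT by simp
  have card_runs: "card (runs d S u w) = card (T d True) + card (T d False)" for d
  proof -
    have "card (runs d S u w) = card (Pair True ` T d True) + card (Pair False ` T d False)"
      unfolding runs_eq by (rule card_Un_disjoint) (use finT in auto)
    then show ?thesis by (simp add: card_image inj_on_def)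
  qed
  show "(\<Sum>i\<in>S. gw w (pv B u i)) = real (card (runs True S u w)) - real (card (runs False S u w))"
    unfolding main cnt card_runs by simp
qed

end

section \<open>Coherent walks\<close>

definition sg :: "bool \<Rightarrow> real" where "sg d = (if d then 1 else -1)"

lemma sg_Not [simp]: "sg (\<not> d) = - sg d" by (simp add: sg_def)

definition xv :: "real^'v \<Rightarrow> 'v + 'x \<Rightarrow> real" where
  "xv x V = (case V of Inl v \<Rightarrow> x $ v | Inr _ \<Rightarrow> 0)"

text \<open>Isolates a maximal interval, that is, a substring. The case \<open>a = 0\<close> is
  separate because subtraction is truncated.\<close>

lemma nat_component:
  fixes l :: nat
  assumes "finite A" "l \<in> A"
  obtains a b where "a \<le> l" "l \<le> b" "{a..b} \<subseteq> A" "Suc b \<notin> A" "a = 0 \<or> a - 1 \<notin> A"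
proof -
  let ?Bs = "{b. l \<le> b \<and> {l..b} \<subseteq> A}" and ?As = "{a. a \<le> l \<and> {a..l} \<subseteq> A}"
  have "?Bs \<subseteq> A" by auto
  then have fB: "finite ?Bs" using assms(1) finite_subset by blast
  have fA: "finite ?As" by (rule finite_subset[of _ "{..l}"]) auto
  have "l \<in> ?Bs" "l \<in> ?As" using assms by auto
  then have b: "Max ?Bs \<in> ?Bs" and a: "Min ?As \<in> ?As" using Max_in[OF fB] Min_in[OF fA] by blast+
  have "Suc (Max ?Bs) \<notin> A"
  proof
    assume "Suc (Max ?Bs) \<in> A"
    then have "Suc (Max ?Bs) \<in> ?Bs" using b by (auto simp: atLeastAtMostSuc_conv)
    then show False using Max_ge[OF fB] by fastforce
  qed
  moreover have "Min ?As = 0 \<or> Min ?As - 1 \<notin> A"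
  proof (rule ccontr)
    assume h: "\<not> ?thesis"
    have "{Min ?As - 1..l} = insert (Min ?As - 1) {Min ?As..l}" using a h by auto
    then have "Min ?As - 1 \<in> ?As" using a h by auto
    then show False using Min_le[OF fA] h by fastforce
  qed
  moreover have "{Min ?As..Max ?Bs} \<subseteq> A"
  proof
    fix i assume "i \<in> {Min ?As..Max ?Bs}"
    then have "i \<in> {Min ?As..l} \<or> i \<in> {l..Max ?Bs}" by auto
    then show "i \<in> A" using a b by blast
  qed
  ultimately show thesis using that a b by blast
qed

context blossom_quiver begin

definition gv :: "('c \<times> bool) list \<Rightarrow> real^'v" where
  "gv w = (\<chi> v. gw w (Inl v))"

definition mv :: "('c \<times> bool) list \<Rightarrow> nat set \<Rightarrow> real^'v" where
  "mv u S = (\<chi> v. real (card {i \<in> S. pv B u i = Inl v}))"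

text \<open>The vertices i, ..., i + k form a top (d = True) or bottom (d = False) substring of u.\<close>

definition substring_type :: "bool \<Rightarrow> ('c \<times> bool) list \<Rightarrow> nat \<Rightarrow> nat \<Rightarrow> bool" where
  "substring_type d u i k \<longleftrightarrow> 1 \<le> i \<and> i + k < length u \<and> snd (u ! (i - 1)) = (\<not> d) \<and> snd (u ! (i + k)) = d"

text \<open>A kiss is recorded with the orientation in which \<open>w\<close> has to be read. As for
  runs, length zero is recorded with \<open>b = True\<close> only, so that each kiss is counted
  once.\<close>

definition kiss_occs :: "bool \<Rightarrow> ('c \<times> bool) list \<Rightarrow> ('c \<times> bool) list \<Rightarrow> (bool \<times> nat \<times> nat \<times> nat) set" where
  "kiss_occs d w u = {(b, i, j, k). substring_type d (ori b w) j k \<and> substring_type (\<not> d) u i k \<and> (k = 0 \<longrightarrow> b) \<and>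
     pv B u i = pv B (ori b w) j \<and> (\<forall>l<k. u ! (i + l) = ori b w ! (j + l))}"

definition nokiss :: "('c \<times> bool) list \<Rightarrow> ('c \<times> bool) list \<Rightarrow> bool" where
  "nokiss w u \<longleftrightarrow> (\<forall>d. kiss_occs d w u = {})"

lemma inner_mv: assumes "finite S" shows "inner x (mv u S) = (\<Sum>i\<in>S. xv x (pv B u i))"
proof -
  have c: "real (card {i \<in> S. pv B u i = Inl v}) = (\<Sum>i\<in>S. of_bool (pv B u i = Inl v))" for v
    using assms by (simp add: sum_of_bool_eq Int_def)
  have "inner x (mv u S) = (\<Sum>v\<in>UNIV. \<Sum>i\<in>S. x $ v * of_bool (pv B u i = Inl v))"
    by (simp add: inner_vec_def mv_def c sum_distrib_left)
  also have "\<dots> = (\<Sum>i\<in>S. \<Sum>v\<in>UNIV. x $ v * of_bool (pv B u i = Inl v))"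
    by (rule sum.swap)
  also have "\<dots> = (\<Sum>i\<in>S. xv x (pv B u i))"
  proof (rule sum.cong)
    fix i
    show "(\<Sum>v\<in>UNIV. x $ v * of_bool (pv B u i = Inl v)) = xv x (pv B u i)"
    proof (cases "pv B u i")
      case (Inl v0)
      have "(\<Sum>v\<in>UNIV. x $ v * of_bool (Inl v0 = (Inl v :: 'v + 'x))) = (\<Sum>v\<in>UNIV. if v = v0 then x $ v else 0)"
        by (rule sum.cong) auto
      then show ?thesis using Inl by (simp add: xv_def)
    qed (simp add: xv_def)
  qed simp
  finally show ?thesis .
qed

lemma mv_empty [simp]: "mv u {} = 0"
  by (simp add: mv_def vec_eq_iff)

lemma mv_union: "finite S \<Longrightarrow> finite T \<Longrightarrow> S \<inter> T = {} \<Longrightarrow> inner x (mv u (S \<union> T)) = inner x (mv u S) + inner x (mv u T)"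
  by (simp add: inner_mv sum.union_disjoint)

lemma xv_gv: "isl V \<Longrightarrow> xv (gv w) V = gw w V"
  by (cases V) (auto simp: xv_def gv_def)

lemma run_inner:
  assumes u: "chain u" and w: "walk_word w" and S: "S \<subseteq> {1..<length u}"
  shows "sg d * inner (gv w) (mv u S) = real (card (runs d S u w)) - real (card (runs (\<not> d) S u w))"
proof -
  have fin: "finite S" using S finite_subset by blast
  have "inner (gv w) (mv u S) = (\<Sum>i\<in>S. gw w (pv B u i))"
    unfolding inner_mv[OF fin]
  proof (rule sum.cong)
    fix i assume "i \<in> S"
    then show "xv (gv w) (pv B u i) = gw w (pv B u i)"
      using pv_isl[OF u] S by (intro xv_gv) auto
  qed simp
  then show ?thesis using run_lemma(1)[OF assms] by (cases d) (auto simp: sg_def)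
qed

lemma finite_kset: "finite (kiss_occs d w u)"
  by (rule finite_subset[of _ "UNIV \<times> {..<length u} \<times> {..<length w} \<times> {..<length u}"])
    (auto simp: kiss_occs_def substring_type_def)

text \<open>The boundary letters of a closed set of type e all have the orientation of the boundary of a top
  (e = True) or bottom (e = False) substring. In a set closed of type \<open>\<not> d\<close> every run of type d is
  therefore a kiss.\<close>

definition closed_set :: "bool \<Rightarrow> ('c \<times> bool) list \<Rightarrow> nat set \<Rightarrow> bool" where
  "closed_set e u S \<longleftrightarrow> S \<subseteq> {1..<length u} \<and> (\<forall>i\<in>S. Suc i \<notin> S \<longrightarrow> snd (u ! i) = e) \<and>
     (\<forall>i\<in>S. i - 1 \<notin> S \<longrightarrow> snd (u ! (i - 1)) = (\<not> e))"

lemma ty_clo: "substring_type d u i k \<Longrightarrow> closed_set d u {i..i + k}"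
proof -
  assume t: "substring_type d u i k"
  have "j = i + k" if "j \<in> {i..i + k}" "Suc j \<notin> {i..i + k}" for j using that by auto
  moreover have "j = i" if "j \<in> {i..i + k}" "j - 1 \<notin> {i..i + k}" for j using that t by (auto simp: substring_type_def)
  moreover have "{i..i + k} \<subseteq> {1..<length u}" using t by (auto simp: substring_type_def)
  ultimately show ?thesis using t unfolding closed_set_def substring_type_def by blast
qed

lemma runs_kset: assumes "closed_set (\<not> d) u S" shows "runs d S u w \<subseteq> kiss_occs d w u"
proof
  fix r assume r: "r \<in> runs d S u w"
  obtain b i j k where e: "r = (b, i, j, k)" by (cases r)
  have h: "{i..i + k} \<subseteq> S" "Suc (i + k) \<in> S \<longrightarrow> snd (u ! (i + k)) = (\<not> d)" "i - 1 \<in> S \<longrightarrow> snd (u ! (i - 1)) = d"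
    using r e by (auto simp: runs_def)
  have iS: "i \<in> S" "i + k \<in> S" using h(1) by auto
  have "snd (u ! (i + k)) = (\<not> d)" "snd (u ! (i - 1)) = d" "1 \<le> i" "i + k < length u"
    using iS h(2,3) assms by (auto simp: closed_set_def)
  then have "substring_type (\<not> d) u i k" by (simp add: substring_type_def)
  then show "r \<in> kiss_occs d w u" using r e by (auto simp: runs_def kiss_occs_def substring_type_def)
qed

text \<open>Runs of type \<open>\<not> d\<close> only lower the value, and runs of type
  \<open>d\<close> are kisses. Summed over all walks and both types this becomes the bound by
  \<open>kappa\<close>.\<close>

lemma clo_le:
  assumes "chain u" "walk_word w" "closed_set (\<not> d) u S"
  shows "sg d * inner (gv w) (mv u S) \<le> real (card (kiss_occs d w u))"
proof -
  have "card (runs d S u w) \<le> card (kiss_occs d w u)"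
    using card_mono[OF finite_kset runs_kset[OF assms(3)]] .
  moreover have "S \<subseteq> {1..<length u}" using assms by (simp add: closed_set_def)
  ultimately show ?thesis using run_inner[OF assms(1,2), of S d] by simp
qed

lemma ty_sub: "substring_type d u i k \<Longrightarrow> {i..i + k} \<subseteq> {1..<length u}"
  by (auto simp: substring_type_def)

text \<open>A substring of type \<open>d\<close> is closed of type \<open>d\<close>, so a run of the
  opposite type in it would be a kiss. Without kisses the difference of two counts is a single
  count.\<close>

lemma ty_inner_nonneg:
  assumes u: "chain u" and w: "walk_word w" and t: "substring_type d u i k" and nk: "nokiss w u"
  shows "sg d * inner (gv w) (mv u {i..i + k}) = real (card (runs d {i..i + k} u w))"
proof -
  have "closed_set (\<not> (\<not> d)) u {i..i + k}" using ty_clo[OF t] by simp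
  then have "runs (\<not> d) {i..i + k} u w = {}" using runs_kset nk unfolding nokiss_def by blast
  then show ?thesis using run_inner[OF u w ty_sub[OF t], of d] by simp
qed

lemma ty_self: "substring_type d u i k \<Longrightarrow> (True, i, i, k) \<in> runs d {i..i + k} u u"
  by (auto simp: substring_type_def runs_def)

definition strict :: "real^'v \<Rightarrow> ('c \<times> bool) list \<Rightarrow> bool" where
  "strict x w \<longleftrightarrow> (\<forall>d i k. substring_type d w i k \<longrightarrow> 0 < sg d * inner x (mv w {i..i + k}))"

definition coherent :: "real^'v \<Rightarrow> ('c \<times> bool) list \<Rightarrow> bool" where
  "coherent x w \<longleftrightarrow> (\<forall>i k. (substring_type True w i k \<longrightarrow> 0 \<le> inner x (mv w {i..i + k})) \<and>
     (substring_type False w i k \<longrightarrow> inner x (mv w {i..i + k}) < 0))"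

lemma strict_coherent: "strict x w \<Longrightarrow> coherent x w"
  unfolding coherent_def
proof (intro allI conjI impI)
  fix i k assume s: "strict x w"
  show "0 \<le> inner x (mv w {i..i + k})" if "substring_type True w i k"
  proof -
    have "0 < sg True * inner x (mv w {i..i + k})" using s that unfolding strict_def by blast
    then show ?thesis by (simp add: sg_def)
  qed
  show "inner x (mv w {i..i + k}) < 0" if "substring_type False w i k"
  proof -
    have "0 < sg False * inner x (mv w {i..i + k})" using s that unfolding strict_def by blast
    then show ?thesis by (simp add: sg_def)
  qed
qed

text \<open>Every walk of \<open>F\<close> contributes a number of runs, and \<open>u\<close> itself
  at least the run formed by the whole substring. Hence the walks with positive coefficient are
  strict for the sum.\<close>

lemma sum_inner_ge:
  assumes fin: "finite F" and w: "\<And>w. w \<in> F \<Longrightarrow> walk_word w" and nk: "\<And>w u. w \<in> F \<Longrightarrow> u \<in> F \<Longrightarrow> nokiss w u"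
    and a: "\<And>w. w \<in> F \<Longrightarrow> 0 \<le> a w" and u: "u \<in> F" and t: "substring_type d u i k"
  shows "a u \<le> sg d * inner (\<Sum>w\<in>F. a w *\<^sub>R gv w) (mv u {i..i + k})"
proof -
  have cu: "chain u" using w u wk_chain by blast
  have e: "sg d * inner (\<Sum>w\<in>F. a w *\<^sub>R gv w) (mv u {i..i + k}) = (\<Sum>w\<in>F. a w * real (card (runs d {i..i + k} u w)))"
    unfolding inner_sum_left sum_distrib_left
    by (rule sum.cong) (use ty_inner_nonneg[OF cu _ t] w nk u in \<open>auto simp: algebra_simps\<close>)
  have "card (runs d {i..i + k} u u) \<noteq> 0"
    using run_lemma(2)[OF cu w[OF u] ty_sub[OF t], of d] ty_self[OF t] by auto
  then have "a u * 1 \<le> a u * real (card (runs d {i..i + k} u u))"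
    using a[OF u] by (intro mult_left_mono) auto
  also have "\<dots> \<le> (\<Sum>w\<in>F. a w * real (card (runs d {i..i + k} u w)))"
    by (rule member_le_sum) (use fin u a in auto)
  finally show ?thesis using e by simp
qed

lemma common_inner:
  assumes pv: "pv B u i = pv B w j" and eq: "\<forall>l<k. u ! (i + l) = w ! (j + l)" and "1 \<le> i" "1 \<le> j"
  shows "inner x (mv u {i..i + k}) = inner x (mv w {j..j + k})"
proof -
  have p: "pv B u (i + l) = pv B w (j + l)" if "l \<le> k" for l
  proof (cases l)
    case (Suc l')
    then show ?thesis using eq that by (simp add: pv_def)
  qed (use pv in simp)
  have "(\<Sum>m\<in>{i..i + k}. xv x (pv B u m)) = (\<Sum>l\<le>k. xv x (pv B u (i + l)))"
    by (rule sum.reindex_bij_witness[of _ "\<lambda>l. i + l" "\<lambda>m. m - i"]) auto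
  also have "\<dots> = (\<Sum>l\<le>k. xv x (pv B w (j + l)))" using p by (intro sum.cong) auto
  also have "\<dots> = (\<Sum>m\<in>{j..j + k}. xv x (pv B w m))"
    by (rule sum.reindex_bij_witness[of _ "\<lambda>m. m - j" "\<lambda>l. j + l"]) auto
  finally show ?thesis by (simp add: inner_mv)
qed

lemma ty_winv: assumes "chain w" "substring_type d (winv w) i k"
  shows "substring_type d w (length w - i - k) k"
    and "inner x (mv (winv w) {i..i + k}) = inner x (mv w {length w - i - k..length w - i - k + k})"
proof -
  let ?n = "length w"
  have h: "1 \<le> i" "i + k < ?n" "snd (winv w ! (i - 1)) = (\<not> d)" "snd (winv w ! (i + k)) = d"
    using assms by (auto simp: substring_type_def)
  have "?n - 1 - (i - 1) = ?n - i - k + k" "?n - 1 - (i + k) = ?n - i - k - 1" using h by auto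
  then show "substring_type d w (?n - i - k) k"
    using h by (auto simp: substring_type_def winv_nth)
  have "(\<Sum>m\<in>{i..i + k}. xv x (pv B (winv w) m)) = (\<Sum>m\<in>{?n - i - k..?n - i - k + k}. xv x (pv B w m))"
    by (rule sum.reindex_bij_witness[of _ "\<lambda>m. ?n - m" "\<lambda>m. ?n - m"])
      (use h pv_winv[OF assms(1)] in auto)
  then show "inner x (mv (winv w) {i..i + k}) = inner x (mv w {?n - i - k..?n - i - k + k})"
    by (simp add: inner_mv)
qed

lemma coherent_ori: assumes "chain w" "coherent x w" shows "coherent x (ori b w)"
proof (cases b)
  case False
  show ?thesis unfolding coherent_def
    using ty_winv[OF assms(1)] assms(2) False by (auto simp: coherent_def)
qed (use assms in simp)

lemma strict_ori: assumes "chain w" "strict x w" shows "strict x (ori b w)"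
proof (cases b)
  case False
  show ?thesis unfolding strict_def
    using ty_winv[OF assms(1)] assms(2) False by (auto simp: strict_def)
qed (use assms in simp)

lemma kset_inner:
  assumes "(b, i, j, k) \<in> kiss_occs d w u"
  shows "inner x (mv u {i..i + k}) = inner x (mv (ori b w) {j..j + k})"
  by (rule common_inner) (use assms in \<open>auto simp: kiss_occs_def substring_type_def\<close>)

text \<open>The sum over the common string would have to be nonnegative for one walk and negative
  for the other.\<close>

lemma coherent_nokiss:
  assumes "chain w" "coherent x w" "coherent x u"
  shows "nokiss w u"
  unfolding nokiss_def
proof (intro allI equals0I)
  fix d r assume r: "r \<in> kiss_occs d w u"
  obtain b i j k where e: "r = (b, i, j, k)" by (cases r)
  have "substring_type d (ori b w) j k" "substring_type (\<not> d) u i k" using r e by (auto simp: kiss_occs_def)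
  moreover have "inner x (mv u {i..i + k}) = inner x (mv (ori b w) {j..j + k})"
    using kset_inner r e by blast
  ultimately show False using coherent_ori[OF assms(1,2), of b] assms(3)
    unfolding coherent_def by (cases d) (simp_all, (metis not_le)+)
qed

text \<open>Adding to S the missing part of a kiss, or removing from S a run of the wrong type, keeps S closed
  and would increase the functional.\<close>

lemma clo_max:
  assumes u: "chain u" and w: "walk_word w" and st: "strict x w"
    and closed_set: "closed_set (\<not> d) u S" and mx: "\<And>S'. closed_set (\<not> d) u S' \<Longrightarrow> sg d * inner x (mv u S') \<le> sg d * inner x (mv u S)"
  shows "sg d * inner (gv w) (mv u S) = real (card (kiss_occs d w u))"
proof -
  have S: "S \<subseteq> {1..<length u}" using closed_set by (simp add: closed_set_def)
  have fS: "finite S" using S finite_subset by blast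
  have c1: "snd (u ! i) = (\<not> d)" if "i \<in> S" "Suc i \<notin> S" for i using closed_set that by (auto simp: closed_set_def)
  have c2: "snd (u ! (i - 1)) = d" if "i \<in> S" "i - 1 \<notin> S" for i using closed_set that by (auto simp: closed_set_def)
  have "runs (\<not> d) S u w = {}"
  proof (rule equals0I)
    fix r assume r: "r \<in> runs (\<not> d) S u w"
    obtain b i j k where e: "r = (b, i, j, k)" by (cases r)
    let ?I = "{i..i + k}"
    have h: "?I \<subseteq> S" "Suc (i + k) \<in> S \<longrightarrow> snd (u ! (i + k)) = d" "i - 1 \<in> S \<longrightarrow> snd (u ! (i - 1)) = (\<not> d)"
      "1 \<le> j" "j + k < length w" "pv B u i = pv B (ori b w) j" "\<forall>l<k. u ! (i + l) = ori b w ! (j + l)"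
      "snd (ori b w ! (j - 1)) = d" "snd (ori b w ! (j + k)) = (\<not> d)"
      using r e by (auto simp: runs_def)
    have "i \<in> S" using h(1) by auto
    then have i1: "1 \<le> i" using S by auto
    have "substring_type (\<not> d) (ori b w) j k" using h by (simp add: substring_type_def)
    then have "0 < sg (\<not> d) * inner x (mv (ori b w) {j..j + k})"
      using strict_ori[OF wk_chain[OF w] st] unfolding strict_def by blast
    then have neg: "sg d * inner x (mv u ?I) < 0"
      using common_inner[OF h(6,7) i1 h(4), of x] by (simp add: mult_minus_left)
    have "closed_set (\<not> d) u (S - ?I)"
      unfolding closed_set_def
    proof (intro conjI ballI impI)
      show "S - ?I \<subseteq> {1..<length u}" using S by auto
      fix m assume m: "m \<in> S - ?I"
      { assume "Suc m \<notin> S - ?I"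
        then have "Suc m \<notin> S \<or> Suc m = i" using m by auto
        then show "snd (u ! m) = (\<not> d)" using c1[of m] h(3) m by auto }
      { assume "m - 1 \<notin> S - ?I"
        then have "m - 1 \<notin> S \<or> m = Suc (i + k)" using m by auto
        then show "snd (u ! (m - 1)) = (\<not> \<not> d)" using c2[of m] h(2) m by auto }
    qed
    from mx[OF this] have "sg d * inner x (mv u (S - ?I)) \<le> sg d * inner x (mv u S)" .
    moreover have "inner x (mv u S) = inner x (mv u (S - ?I)) + inner x (mv u ?I)"
    proof -
      have "S = (S - ?I) \<union> ?I" using h(1) by blast
      then show ?thesis using mv_union[of "S - ?I" ?I x u] fS by (metis Diff_disjoint Int_commute finite_Diff finite_atLeastAtMost)
    qed
    ultimately show False using neg by (simp add: distrib_left)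
  qed
  moreover have "runs d S u w = kiss_occs d w u"
  proof
    show "runs d S u w \<subseteq> kiss_occs d w u" by (rule runs_kset[OF closed_set])
    show "kiss_occs d w u \<subseteq> runs d S u w"
    proof
      fix r assume r: "r \<in> kiss_occs d w u"
      obtain b i j k where e: "r = (b, i, j, k)" by (cases r)
      let ?I = "{i..i + k}"
      have tw: "substring_type d (ori b w) j k" and tu: "substring_type (\<not> d) u i k" and pve: "pv B u i = pv B (ori b w) j"
        and le: "\<And>l. l < k \<Longrightarrow> u ! (i + l) = ori b w ! (j + l)"
        using r e by (auto simp: kiss_occs_def)
      have "?I \<subseteq> S"
      proof (rule ccontr)
        assume "\<not> ?I \<subseteq> S"
        then obtain l where l: "l \<in> ?I - S" by blast
        obtain a c where ac: "a \<le> l" "l \<le> c" "{a..c} \<subseteq> ?I - S" "Suc c \<notin> ?I - S" "a = 0 \<or> a - 1 \<notin> ?I - S"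
          using nat_component[OF _ l] by auto
        let ?J = "{a..c}"
        have "a \<in> {a..c}" "c \<in> {a..c}" using ac(1,2) by auto
        then have "a \<in> ?I - S" "c \<in> ?I - S" using ac(3) by blast+
        then have aI: "i \<le> a" "c \<le> i + k" "a \<le> c" "a \<notin> S" "c \<notin> S" using ac(1,2) by auto
        have a1: "1 \<le> a" using aI tu by (auto simp: substring_type_def)
        have right: "(c = i + k \<and> snd (u ! c) = (\<not> d)) \<or> (c < i + k \<and> Suc c \<in> S \<and> snd (u ! c) = d)"
        proof (cases "c = i + k")
          case True
          then show ?thesis using tu by (simp add: substring_type_def)
        next
          case False
          then have "c < i + k" "Suc c \<in> S" using aI ac by auto
          then show ?thesis using c2[of "Suc c"] aI by simp
        qed
        have left: "(a = i \<and> snd (u ! (a - 1)) = d) \<or> (i < a \<and> a - 1 \<in> S \<and> snd (u ! (a - 1)) = (\<not> d))"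
        proof (cases "a = i")
          case True
          then show ?thesis using tu by (simp add: substring_type_def)
        next
          case False
          then have "i < a" "a - 1 \<in> S" using aI ac by auto
          then show ?thesis using c1[of "a - 1"] aI by simp
        qed
        let ?ja = "j + (a - i)" and ?kc = "c - a"
        \<comment> \<open>The interval \<open>{a..c}\<close> is a component of the part of the kiss
          outside \<open>S\<close>. Each of its ends is an end of the kiss or borders
          \<open>S\<close>; in both cases the adjacent letter of \<open>ori b w\<close> has the sign
          required for type \<open>d\<close>.\<close>
        have tj: "substring_type d (ori b w) ?ja ?kc"
          unfolding substring_type_def
        proof (intro conjI)
          have jc: "?ja + ?kc = j + (c - i)" using aI by simp
          show "1 \<le> ?ja" "?ja + ?kc < length (ori b w)" using tw aI by (auto simp: substring_type_def)
          show "snd (ori b w ! (?ja - 1)) = (\<not> d)"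
          proof (cases "a = i")
            case True
            then show ?thesis using tw by (simp add: substring_type_def)
          next
            case False
            then have "u ! (a - 1) = ori b w ! (?ja - 1)" using le[of "a - 1 - i"] aI by auto
            then show ?thesis using left False by auto
          qed
          show "snd (ori b w ! (?ja + ?kc)) = d"
          proof (cases "c = i + k")
            case True
            then show ?thesis using tw aI by (auto simp: substring_type_def)
          next
            case False
            then have "u ! c = ori b w ! (?ja + ?kc)" using le[of "c - i"] aI jc by auto
            then show ?thesis using right False by auto
          qed
        qed
        then have "0 < sg d * inner x (mv (ori b w) {?ja..?ja + ?kc})"
          using strict_ori[OF wk_chain[OF w] st] unfolding strict_def by blast
        also have "inner x (mv (ori b w) {?ja..?ja + ?kc}) = inner x (mv u {a..a + ?kc})"
        proof (rule common_inner[symmetric])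
          show "pv B u a = pv B (ori b w) ?ja"
          proof (cases "a = i")
            case False
            then have "u ! (a - 1) = ori b w ! (?ja - 1)" using le[of "a - 1 - i"] aI by auto
            then show ?thesis by (simp add: pv_def)
          qed (use pve in simp)
          show "\<forall>m<?kc. u ! (a + m) = ori b w ! (?ja + m)"
          proof (intro allI impI)
            fix m assume "m < ?kc"
            then show "u ! (a + m) = ori b w ! (?ja + m)" using le[of "a + m - i"] aI by (auto simp: add.assoc)
          qed
          show "1 \<le> a" by (rule a1)
          show "1 \<le> ?ja" using tw by (simp add: substring_type_def)
        qed
        finally have pos: "0 < sg d * inner x (mv u ?J)" using aI by simp
        have "closed_set (\<not> d) u (S \<union> ?J)"
          unfolding closed_set_def
        proof (intro conjI ballI impI)
          show "S \<union> ?J \<subseteq> {1..<length u}" using S aI a1 tu by (auto simp: substring_type_def)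
          fix m assume m: "m \<in> S \<union> ?J"
          { assume n: "Suc m \<notin> S \<union> ?J"
            show "snd (u ! m) = (\<not> d)"
            proof (cases "m \<in> S")
              case True
              then show ?thesis using c1 n by auto
            next
              case False
              then have "m = c" using m n by auto
              then show ?thesis using right n by auto
            qed }
          { assume n: "m - 1 \<notin> S \<union> ?J"
            show "snd (u ! (m - 1)) = (\<not> \<not> d)"
            proof (cases "m \<in> S")
              case True
              then show ?thesis using c2 n by auto
            next
              case False
              then have "m = a" using m n by auto
              then show ?thesis using left n by auto
            qed }
        qed
        from mx[OF this] have "sg d * inner x (mv u (S \<union> ?J)) \<le> sg d * inner x (mv u S)" .
        moreover have "S \<inter> ?J = {}" using ac(3) by auto
        then have "inner x (mv u (S \<union> ?J)) = inner x (mv u S) + inner x (mv u ?J)"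
          using mv_union[of S ?J x u] fS by simp
        ultimately show False using pos by (simp add: distrib_left)
      qed
      then show "r \<in> runs d S u w" using r e by (auto simp: kiss_occs_def runs_def substring_type_def)
    qed
  qed
  ultimately show ?thesis using run_inner[OF u w S, of d] by simp
qed

text \<open>A component of \<open>S\<close> would be a substring of type \<open>\<not> d\<close> of
  the strict word \<open>u\<close>, so removing it would raise the value. Thus the walks of a facet
  contribute nothing to the vertex of that facet.\<close>

lemma clo_max_empty:
  assumes st: "strict x u"
    and closed_set: "closed_set (\<not> d) u S" and mx: "\<And>S'. closed_set (\<not> d) u S' \<Longrightarrow> sg d * inner x (mv u S') \<le> sg d * inner x (mv u S)"
  shows "S = {}"
proof (rule ccontr)
  assume "S \<noteq> {}"
  then obtain l where l: "l \<in> S" by auto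
  have S: "S \<subseteq> {1..<length u}" using closed_set by (simp add: closed_set_def)
  have fS: "finite S" using S finite_subset by blast
  obtain a c where ac: "a \<le> l" "l \<le> c" "{a..c} \<subseteq> S" "Suc c \<notin> S" "a = 0 \<or> a - 1 \<notin> S"
    using nat_component[OF fS l] by auto
  have "a \<in> {a..c}" "c \<in> {a..c}" using ac(1,2) by auto
  then have aS: "a \<in> S" "c \<in> S" "a \<le> c" using ac(1-3) by auto
  then have a1: "1 \<le> a" "a - 1 \<notin> S" "c < length u" using S ac by auto
  have "substring_type (\<not> d) u a (c - a)"
    using closed_set aS ac a1 by (auto simp: substring_type_def closed_set_def)
  then have "0 < sg (\<not> d) * inner x (mv u {a..a + (c - a)})" using st unfolding strict_def by blast
  then have neg: "sg d * inner x (mv u {a..c}) < 0" using aS by simp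
  have "closed_set (\<not> d) u (S - {a..c})"
    unfolding closed_set_def
  proof (intro conjI ballI impI)
    show "S - {a..c} \<subseteq> {1..<length u}" using S by auto
    fix m assume m: "m \<in> S - {a..c}"
    { assume "Suc m \<notin> S - {a..c}"
      then have "Suc m \<notin> S \<or> Suc m = a" using m by auto
      then show "snd (u ! m) = (\<not> d)" using closed_set m a1 by (auto simp: closed_set_def) }
    { assume "m - 1 \<notin> S - {a..c}"
      then have "m - 1 \<notin> S \<or> m = Suc c" using m by auto
      then show "snd (u ! (m - 1)) = (\<not> \<not> d)" using closed_set m ac by (auto simp: closed_set_def) }
  qed
  from mx[OF this] have "sg d * inner x (mv u (S - {a..c})) \<le> sg d * inner x (mv u S)" .
  moreover have "inner x (mv u S) = inner x (mv u (S - {a..c})) + inner x (mv u {a..c})"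
  proof -
    have "S = (S - {a..c}) \<union> {a..c}" using ac(3) by blast
    then show ?thesis using mv_union[of "S - {a..c}" "{a..c}" x u] fS by (metis Diff_disjoint Int_commute finite_Diff finite_atLeastAtMost)
  qed
  ultimately show False using neg by (simp add: distrib_left)
qed

lemma clo_max_exists:
  obtains S where "closed_set e u S" "\<And>S'. closed_set e u S' \<Longrightarrow> r * inner x (mv u S') \<le> r * inner x (mv u S)"
proof -
  have fin: "finite {S. closed_set e u S}"
    by (rule finite_subset[of _ "Pow {1..<length u}"]) (auto simp: closed_set_def)
  have "closed_set e u {}" by (simp add: closed_set_def)
  then have ne: "{S. closed_set e u S} \<noteq> {}" by blast
  obtain S where "S \<in> {S. closed_set e u S}" "\<forall>S'\<in>{S. closed_set e u S}. r * inner x (mv u S') \<le> r * inner x (mv u S)"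
    using obtains_MAX[OF fin ne, of "\<lambda>S. r * inner x (mv u S)"] by (metis (no_types, lifting) Max_ge finite_imageI fin imageI)
  then show thesis using that by blast
qed

section \<open>Marks\<close>

text \<open>Letter \<open>q\<close> stands after vertex \<open>q\<close>, so this is the height at
  which letter \<open>q\<close> is read. Differences are sums over the vertices between two
  letters.\<close>

definition T :: "real^'v \<Rightarrow> ('c \<times> bool) list \<Rightarrow> nat \<Rightarrow> real" where
  "T x w q = (\<Sum>i=1..q. xv x (pv B w i))"

lemma T_diff: "q \<le> r \<Longrightarrow> T x w r - T x w q = (\<Sum>i=Suc q..r. xv x (pv B w i))"
proof -
  assume "q \<le> r"
  then have "{1..r} = {1..q} \<union> {Suc q..r}" by auto
  then have "T x w r = T x w q + (\<Sum>i=Suc q..r. xv x (pv B w i))"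
    unfolding T_def by (simp add: sum.union_disjoint)
  then show ?thesis by simp
qed

lemma inner_T: "1 \<le> i \<Longrightarrow> inner x (mv w {i..i + k}) = T x w (i + k) - T x w (i - 1)"
  using T_diff[of "i - 1" "i + k" x w] by (simp add: inner_mv)

lemma inner_T': "q < r \<Longrightarrow> inner x (mv w {Suc q..r}) = T x w r - T x w q"
  using T_diff[of q r x w] by (simp add: inner_mv)

lemma coherent_T:
  "coherent x w \<longleftrightarrow> (\<forall>q r. q < r \<longrightarrow> r < length w \<longrightarrow>
     (\<not> snd (w ! q) \<and> snd (w ! r) \<longrightarrow> T x w q \<le> T x w r) \<and> (snd (w ! q) \<and> \<not> snd (w ! r) \<longrightarrow> T x w r < T x w q))"
  (is "_ \<longleftrightarrow> ?R")
proof
  assume c: "coherent x w"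
  show ?R
  proof (intro allI impI)
    fix q r assume qr: "q < r" "r < length w"
    have e: "Suc q + (r - Suc q) = r" using qr by simp
    have t: "substring_type d w (Suc q) (r - Suc q) \<longleftrightarrow> snd (w ! q) = (\<not> d) \<and> snd (w ! r) = d" for d
      using qr e by (auto simp: substring_type_def)
    have "inner x (mv w {Suc q..Suc q + (r - Suc q)}) = T x w r - T x w q"
      using inner_T[of "Suc q" x w "r - Suc q"] e by simp
    moreover have "(substring_type True w (Suc q) (r - Suc q) \<longrightarrow> 0 \<le> inner x (mv w {Suc q..Suc q + (r - Suc q)})) \<and>
      (substring_type False w (Suc q) (r - Suc q) \<longrightarrow> inner x (mv w {Suc q..Suc q + (r - Suc q)}) < 0)"
      using c unfolding coherent_def by blast
    ultimately show "(\<not> snd (w ! q) \<and> snd (w ! r) \<longrightarrow> T x w q \<le> T x w r) \<and> (snd (w ! q) \<and> \<not> snd (w ! r) \<longrightarrow> T x w r < T x w q)"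
      using t by simp
  qed
next
  assume r: ?R
  show "coherent x w" unfolding coherent_def
  proof (intro allI conjI impI)
    fix i k
    { assume t: "substring_type True w i k"
      then have "T x w (i - 1) \<le> T x w (i + k)" using r by (auto simp: substring_type_def)
      then show "0 \<le> inner x (mv w {i..i + k})" using t inner_T[of i x w k] by (simp add: substring_type_def) }
    { assume t: "substring_type False w i k"
      then have "T x w (i + k) < T x w (i - 1)" using r by (auto simp: substring_type_def)
      then show "inner x (mv w {i..i + k}) < 0" using t inner_T[of i x w k] by (simp add: substring_type_def) }
  qed
qed

text \<open>The letter p lies on the greedy walk of x through it. The weak and the strict inequality break ties
  consistently; the condition does not depend on the orientation of the word.\<close>

definition marked :: "real^'v \<Rightarrow> ('c \<times> bool) list \<Rightarrow> nat \<Rightarrow> bool" where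
  "marked x u p \<longleftrightarrow> p < length u \<and> (\<forall>q. p < q \<longrightarrow> q < length u \<longrightarrow> (snd (u ! q) \<longleftrightarrow> T x u p \<le> T x u q)) \<and>
     (\<forall>q<p. snd (u ! q) \<longleftrightarrow> T x u p < T x u q)"

text \<open>All letters are compared with the height of the mark, and these comparisons
  compose.\<close>

lemma mk_coherent: assumes "marked x u p" shows "coherent x u"
proof -
  have p: "p < length u" and a: "\<And>q. p < q \<Longrightarrow> q < length u \<Longrightarrow> (snd (u ! q) \<longleftrightarrow> T x u p \<le> T x u q)"
    and b: "\<And>q. q < p \<Longrightarrow> (snd (u ! q) \<longleftrightarrow> T x u p < T x u q)" using assms by (auto simp: marked_def)
  show ?thesis unfolding coherent_T
  proof (intro allI impI)
    fix q r assume qr: "q < r" "r < length u"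
    consider "q < p" "r < p" | "q < p" "r = p" | "q < p" "p < r" | "q = p" "p < r" | "p < q" "p < r"
      using qr by linarith
    then show "(\<not> snd (u ! q) \<and> snd (u ! r) \<longrightarrow> T x u q \<le> T x u r) \<and> (snd (u ! q) \<and> \<not> snd (u ! r) \<longrightarrow> T x u r < T x u q)"
      by cases (use a[of q] a[of r] b[of q] b[of r] qr in auto)
  qed
qed

text \<open>Of two marks each decides the sign of the other, by complementary inequalities; so their
  signs are opposite.\<close>

lemma mk_unique: assumes "marked x u p" "marked x u p'" "snd (u ! p) = snd (u ! p')" shows "p = p'"
proof (rule ccontr)
  have *: False if "marked x u p" "marked x u p'" "snd (u ! p) = snd (u ! p')" "p < p'" for p p'
  proof -
    have "p' < length u" using that by (simp add: marked_def)
    then have "snd (u ! p') \<longleftrightarrow> T x u p \<le> T x u p'" "snd (u ! p) \<longleftrightarrow> T x u p' < T x u p"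
      using that by (auto simp: marked_def)
    then show False using that by auto
  qed
  assume "p \<noteq> p'"
  then show False using *[of p p'] *[of p' p] assms by (metis linorder_neqE_nat)
qed

text \<open>The mark is the first minimum of the partial sums over the forward letters, respectively the last
  maximum over the backward letters.\<close>

lemma mk_exists:
  assumes c: "coherent x u" and q: "q < length u" "snd (u ! q) = s"
  shows "\<exists>p. marked x u p \<and> snd (u ! p) = s"
proof -
  have co: "\<And>q r. q < r \<Longrightarrow> r < length u \<Longrightarrow> \<not> snd (u ! q) \<Longrightarrow> snd (u ! r) \<Longrightarrow> T x u q \<le> T x u r"
    "\<And>q r. q < r \<Longrightarrow> r < length u \<Longrightarrow> snd (u ! q) \<Longrightarrow> \<not> snd (u ! r) \<Longrightarrow> T x u r < T x u q"
    using c unfolding coherent_T by blast+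
  let ?A = "{r. r < length u \<and> snd (u ! r) = s}"
  have fA: "finite ?A" by simp
  have ne: "?A \<noteq> {}" using q by blast
  show ?thesis
  proof (cases s)
    case True
    define m where "m = Min (T x u ` ?A)"
    have m: "m \<le> T x u r" if "r \<in> ?A" for r unfolding m_def using fA that by simp
    have "m \<in> T x u ` ?A" unfolding m_def using fA ne by (intro Min_in) auto
    then have ex: "\<exists>r. r \<in> ?A \<and> T x u r = m" by auto
    define p where "p = (LEAST r. r \<in> ?A \<and> T x u r = m)"
    have p: "p \<in> ?A" "T x u p = m" using LeastI_ex[OF ex] by (auto simp: p_def)
    have lp: "T x u r \<noteq> m" if "r \<in> ?A" "r < p" for r
      using not_less_Least[of r "\<lambda>r. r \<in> ?A \<and> T x u r = m"] that unfolding p_def by blast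
    have "marked x u p" unfolding marked_def
    proof (intro conjI allI impI)
      show "p < length u" using p by simp
      show "snd (u ! q) \<longleftrightarrow> T x u p \<le> T x u q" if "p < q" "q < length u" for q
        using that co(2)[of p q] p m[of q] True by fastforce
      show "snd (u ! q) \<longleftrightarrow> T x u p < T x u q" if "q < p" for q
        using that co(1)[of q p] p m[of q] lp[of q] True by fastforce
    qed
    then show ?thesis using p by blast
  next
    case False
    define m where "m = Max (T x u ` ?A)"
    have m: "T x u r \<le> m" if "r \<in> ?A" for r unfolding m_def using fA that by simp
    have "m \<in> T x u ` ?A" unfolding m_def using fA ne by (intro Max_in) auto
    then have ne': "{r \<in> ?A. T x u r = m} \<noteq> {}" by auto
    have f': "finite {r \<in> ?A. T x u r = m}" by simp
    define p where "p = Max {r \<in> ?A. T x u r = m}"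
    have p: "p \<in> ?A" "T x u p = m" using Max_in[OF f' ne'] by (auto simp: p_def)
    have lp: "T x u r \<noteq> m" if "r \<in> ?A" "p < r" for r
      using Max_ge[OF f', of r] that unfolding p_def by (metis (mono_tags, lifting) leD mem_Collect_eq)
    have "marked x u p" unfolding marked_def
    proof (intro conjI allI impI)
      show "p < length u" using p by simp
      show "snd (u ! q) \<longleftrightarrow> T x u p \<le> T x u q" if "p < q" "q < length u" for q
        using that co(1)[of p q] p m[of q] lp[of q] False by fastforce
      show "snd (u ! q) \<longleftrightarrow> T x u p < T x u q" if "q < p" for q
        using that co(2)[of q p] p m[of q] False by fastforce
    qed
    then show ?thesis using p by blast
  qed
qed

lemma T_winv: assumes "chain u" "q < length u"
  shows "T x (winv u) q = T x u (length u - 1) - T x u (length u - 1 - q)"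
proof -
  let ?n = "length u"
  have "T x u (?n - 1) - T x u (?n - 1 - q) = (\<Sum>i=Suc (?n - 1 - q)..?n - 1. xv x (pv B u i))"
    by (rule T_diff) simp
  also have "\<dots> = (\<Sum>i=1..q. xv x (pv B (winv u) i))"
    by (rule sum.reindex_bij_witness[of _ "\<lambda>m. ?n - m" "\<lambda>m. ?n - m"])
      (use assms pv_winv[OF assms(1)] in auto)
  finally show ?thesis by (simp add: T_def)
qed

text \<open>Heights are reflected and signs negated, which turns the strict condition on the left
  into the weak one on the right and conversely.\<close>

lemma mk_winv: assumes "chain u" "marked x u p" shows "marked x (winv u) (length u - 1 - p)"
proof -
  let ?n = "length u"
  have p: "p < ?n" and a: "\<And>q. p < q \<Longrightarrow> q < ?n \<Longrightarrow> (snd (u ! q) \<longleftrightarrow> T x u p \<le> T x u q)"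
    and b: "\<And>q. q < p \<Longrightarrow> (snd (u ! q) \<longleftrightarrow> T x u p < T x u q)" using assms(2) by (auto simp: marked_def)
  have pp: "?n - 1 - (?n - 1 - p) = p" using p by simp
  have Tp: "T x (winv u) (?n - 1 - p) = T x u (?n - 1) - T x u p" using T_winv[OF assms(1), of "?n - 1 - p"] p pp by simp
  show ?thesis unfolding marked_def
  proof (intro conjI allI impI)
    show "?n - 1 - p < length (winv u)" using p by simp
    show "snd (winv u ! q) \<longleftrightarrow> T x (winv u) (?n - 1 - p) \<le> T x (winv u) q" if "?n - 1 - p < q" "q < length (winv u)" for q
      using that b[of "?n - 1 - q"] Tp T_winv[OF assms(1), of q] p by (auto simp: winv_nth)
    show "snd (winv u ! q) \<longleftrightarrow> T x (winv u) (?n - 1 - p) < T x (winv u) q" if "q < ?n - 1 - p" for q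
      using that a[of "?n - 1 - q"] Tp T_winv[OF assms(1), of q] p by (auto simp: winv_nth)
  qed
qed

section \<open>Separation of two words through a common letter\<close>

definition rsep :: "('c \<times> bool) list \<Rightarrow> nat \<Rightarrow> ('c \<times> bool) list \<Rightarrow> nat \<Rightarrow> nat \<Rightarrow> bool" where
  "rsep w p w' p' r \<longleftrightarrow> 1 \<le> r \<and> p + r < length w \<and> p' + r < length w' \<and>
     (\<forall>l<r. w ! (p + l) = w' ! (p' + l)) \<and> w ! (p + r) \<noteq> w' ! (p' + r)"

definition lsep :: "('c \<times> bool) list \<Rightarrow> nat \<Rightarrow> ('c \<times> bool) list \<Rightarrow> nat \<Rightarrow> nat \<Rightarrow> bool" where
  "lsep w p w' p' r \<longleftrightarrow> 1 \<le> r \<and> r \<le> p \<and> r \<le> p' \<and> (\<forall>l<r. w ! (p - l) = w' ! (p' - l)) \<and> w ! (p - r) \<noteq> w' ! (p' - r)"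

text \<open>Without separation the words agree letter by letter, and they end together because an
  end is visible in the last common letter.\<close>

lemma agree:
  assumes w: "walk_word w" and w': "walk_word w'" and p: "p < length w" "p' < length w'" and eq: "w ! p = w' ! p'"
    and nr: "\<And>r. \<not> rsep w p w' p' r" and nl: "\<And>r. \<not> lsep w p w' p' r"
  shows "w = w' \<and> p = p'"
proof -
  have R: "\<forall>l\<le>r. (p + l < length w \<longleftrightarrow> p' + l < length w') \<and> (p + l < length w \<longrightarrow> w ! (p + l) = w' ! (p' + l))" for r
  proof (induction r)
    case 0
    then show ?case using p eq by simp
  next
    case (Suc r)
    have a: "p + Suc r < length w \<longleftrightarrow> p' + Suc r < length w'"
    proof (cases "p + r < length w")
      case True
      then have "p' + r < length w'" "w ! (p + r) = w' ! (p' + r)" using Suc.IH by auto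
      then show ?thesis using wk_last[OF w True] wk_last[OF w', of "p' + r"] by simp
    next
      case False
      then have "\<not> p' + r < length w'" using Suc.IH by auto
      then show ?thesis using False by simp
    qed
    have "w ! (p + Suc r) = w' ! (p' + Suc r)" if "p + Suc r < length w"
    proof (rule ccontr)
      assume ne: "w ! (p + Suc r) \<noteq> w' ! (p' + Suc r)"
      have "\<forall>l<Suc r. w ! (p + l) = w' ! (p' + l)" using Suc.IH that by auto
      then have "rsep w p w' p' (Suc r)" using ne a that by (auto simp: rsep_def)
      then show False using nr by blast
    qed
    then show ?case using a Suc.IH le_SucE by metis
  qed
  have Lf: "\<forall>l\<le>r. (l \<le> p \<longleftrightarrow> l \<le> p') \<and> (l \<le> p \<longrightarrow> w ! (p - l) = w' ! (p' - l))" for r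
  proof (induction r)
    case 0
    then show ?case using eq by simp
  next
    case (Suc r)
    have a: "Suc r \<le> p \<longleftrightarrow> Suc r \<le> p'"
    proof (cases "r \<le> p")
      case True
      then have "r \<le> p'" "w ! (p - r) = w' ! (p' - r)" using Suc.IH by auto
      moreover have "p - r < length w" "p' - r < length w'" using p by auto
      ultimately have "0 < p - r \<longleftrightarrow> 0 < p' - r" using wk_first[OF w, of "p - r"] wk_first[OF w', of "p' - r"] by simp
      then show ?thesis by auto
    next
      case False
      then have "\<not> r \<le> p'" using Suc.IH by auto
      then show ?thesis using False by simp
    qed
    have "w ! (p - Suc r) = w' ! (p' - Suc r)" if "Suc r \<le> p"
    proof (rule ccontr)
      assume ne: "w ! (p - Suc r) \<noteq> w' ! (p' - Suc r)"
      have "\<forall>l<Suc r. w ! (p - l) = w' ! (p' - l)" using Suc.IH that by auto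
      then have "lsep w p w' p' (Suc r)" using ne a that by (auto simp: lsep_def)
      then show False using nl by blast
    qed
    then show ?case using a Suc.IH le_SucE by metis
  qed
  have pp: "p = p'" using Lf[of p] Lf[of p'] by (meson le_antisym order_refl)
  have len: "length w = length w'"
  proof (rule antisym; rule ccontr)
    assume "\<not> length w \<le> length w'"
    then show False using R[of "length w' - p"] p pp by auto
  next
    assume "\<not> length w' \<le> length w"
    then show False using R[of "length w - p"] p pp by auto
  qed
  have "w ! k = w' ! k" if "k < length w" for k
  proof (cases "k \<le> p")
    case True
    then have "w ! (p - (p - k)) = w' ! (p' - (p - k))" using Lf[of "p - k"] by auto
    then show ?thesis using True pp by simp
  next
    case False
    then have "w ! (p + (k - p)) = w' ! (p' + (k - p))" using R[of "k - p"] that by auto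
    then show ?thesis using False pp by simp
  qed
  then show ?thesis using len pp by (simp add: list_eq_iff_nth_eq)
qed

text \<open>Both words have the same sum along the common part and opposite signs after it. The mark
  ties the sign of \<open>w\<close> to this sum, and coherence of \<open>w'\<close> then excludes
  that \<open>w\<close> keeps the sign of the mark. This is how a distinguished walk separates from
  the others.\<close>

lemma mk_rsep:
  assumes w: "chain w" and w': "chain w'" and m: "marked x w p" and c: "coherent x w'" and s: "rsep w p w' p' r"
  shows "snd (w ! (p + r)) = (\<not> snd (w ! p))" "snd (w' ! (p' + r)) = snd (w ! p)"
proof -
  have h: "1 \<le> r" "p + r < length w" "p' + r < length w'" "\<And>l. l < r \<Longrightarrow> w ! (p + l) = w' ! (p' + l)"
    "w ! (p + r) \<noteq> w' ! (p' + r)" using s by (auto simp: rsep_def)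
  have e0: "w ! p = w' ! p'" using h(4)[of 0] h(1) by simp
  have "w ! (p + r - 1) = w' ! (p' + r - 1)" using h(4)[of "r - 1"] h(1) by simp
  then have d: "snd (w ! (p + r)) \<noteq> snd (w' ! (p' + r))"
    using ok_unique chain_ok[OF w, of "p + r"] chain_ok[OF w', of "p' + r"] h by fastforce
  have "(\<Sum>i=Suc p..p + r. xv x (pv B w i)) = (\<Sum>i=Suc p'..p' + r. xv x (pv B w' i))"
  proof -
    have pvq: "pv B w (p + l) = pv B w' (p' + l)" if "1 \<le> l" "l \<le> r" for l
      using h(4)[of "l - 1"] that by (simp add: pv_def)
    have "pv B w i = pv B w' (p' + (i - p))" if "Suc p \<le> i" "i \<le> p + r" for i
      using pvq[of "i - p"] that by simp
    then show ?thesis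
      by (intro sum.reindex_bij_witness[of _ "\<lambda>i. p + (i - p')" "\<lambda>i. p' + (i - p)"]) auto
  qed
  then have e: "T x w (p + r) - T x w p = T x w' (p' + r) - T x w' p'"
    using T_diff[of p "p + r" x w] T_diff[of p' "p' + r" x w'] by simp
  have m1: "snd (w ! (p + r)) \<longleftrightarrow> T x w p \<le> T x w (p + r)" using m h by (auto simp: marked_def)
  have c1: "(\<not> snd (w' ! p') \<and> snd (w' ! (p' + r)) \<longrightarrow> T x w' p' \<le> T x w' (p' + r)) \<and>
      (snd (w' ! p') \<and> \<not> snd (w' ! (p' + r)) \<longrightarrow> T x w' (p' + r) < T x w' p')"
    using c h unfolding coherent_T by simp
  show "snd (w ! (p + r)) = (\<not> snd (w ! p))" using m1 c1 d e e0 by auto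
  then show "snd (w' ! (p' + r)) = snd (w ! p)" using d by auto
qed

lemma mk_lsep:
  assumes w: "chain w" and w': "chain w'" and m: "marked x w p" and c: "coherent x w'" and s: "lsep w p w' p' r"
    and p': "p' < length w'"
  shows "snd (w ! (p - r)) = (\<not> snd (w ! p))" "snd (w' ! (p' - r)) = snd (w ! p)"
proof -
  have h: "1 \<le> r" "r \<le> p" "r \<le> p'" "\<And>l. l < r \<Longrightarrow> w ! (p - l) = w' ! (p' - l)"
    "w ! (p - r) \<noteq> w' ! (p' - r)" and p: "p < length w" using s m by (auto simp: lsep_def marked_def)
  have e0: "w ! p = w' ! p'" using h(4)[of 0] h(1) by simp
  have s1: "p - (r - 1) = Suc (p - r)" "p' - (r - 1) = Suc (p' - r)" using h by auto
  have "w ! Suc (p - r) = w' ! Suc (p' - r)" using h(4)[of "r - 1"] h(1) s1 by simp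
  moreover have "ok (w ! (p - r)) (w ! Suc (p - r))" using chain_ok[OF w, of "Suc (p - r)"] h p by simp
  moreover have "ok (w' ! (p' - r)) (w' ! Suc (p' - r))" using chain_ok[OF w', of "Suc (p' - r)"] h p' by simp
  ultimately have d: "snd (w ! (p - r)) \<noteq> snd (w' ! (p' - r))"
    using ok_unique_left h(5) by metis
  have "(\<Sum>i=Suc (p - r)..p. xv x (pv B w i)) = (\<Sum>i=Suc (p' - r)..p'. xv x (pv B w' i))"
  proof -
    have pvq: "pv B w (p - l) = pv B w' (p' - l)" if "l < r" for l
      using h(4)[OF that] pv_lsrc[OF w, of "p - l"] pv_lsrc[OF w', of "p' - l"] that h p p' by simp
    have "pv B w i = pv B w' (p' - (p - i))" if "Suc (p - r) \<le> i" "i \<le> p" for i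
      using pvq[of "p - i"] that h by simp
    then show ?thesis
      by (intro sum.reindex_bij_witness[of _ "\<lambda>i. p - (p' - i)" "\<lambda>i. p' - (p - i)"]) (use h in auto)
  qed
  then have e: "T x w p - T x w (p - r) = T x w' p' - T x w' (p' - r)"
    using T_diff[of "p - r" p x w] T_diff[of "p' - r" p' x w'] by simp
  have m1: "snd (w ! (p - r)) \<longleftrightarrow> T x w p < T x w (p - r)" using m h by (auto simp: marked_def)
  have lt: "p' - r < p'" using h by simp
  have c1: "(\<not> snd (w' ! (p' - r)) \<and> snd (w' ! p') \<longrightarrow> T x w' (p' - r) \<le> T x w' p') \<and>
      (snd (w' ! (p' - r)) \<and> \<not> snd (w' ! p') \<longrightarrow> T x w' p' < T x w' (p' - r))"
    using c lt p' unfolding coherent_T by blast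
  show "snd (w ! (p - r)) = (\<not> snd (w ! p))" using m1 c1 d e e0 by auto
  then show "snd (w' ! (p' - r)) = snd (w ! p)" using d by auto
qed

text \<open>A run that stops short of either end of the distinguished string contradicts the sum condition at
  the mark on the opposite side; a run equal to it extends forever because the two marks force opposite
  signs at any separation.\<close>

lemma dual_runs:
  assumes u: "walk_word u" and w: "walk_word w" and cw: "coherent x w" and m1: "marked x u k1" and m2: "marked x u k2"
    and k: "k1 < k2" and s1: "snd (u ! k1) = (\<not> d)" and s2: "snd (u ! k2) = d" and ne: "w \<noteq> winv u"
    and r: "(b, i, j, k) \<in> runs d {Suc k1..k2} u w"
  shows "w = u \<and> (b, i, j, k) = (True, Suc k1, Suc k1, k2 - Suc k1)"
proof -
  let ?S = "{Suc k1..k2}" and ?n = "length w"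
  define z where "z = ori b w"
  have cu: "chain u" and chw: "chain w" and chz: "chain z" using u w by (auto simp: wk_chain chain_ori z_def)
  have co: "coherent x u" using mk_coherent[OF m1] .
  have cz: "coherent x z" unfolding z_def using coherent_ori[OF chw cw] .
  have h: "{i..i + k} \<subseteq> ?S" "1 \<le> j" "j + k < ?n" "k = 0 \<longrightarrow> b"
    "pv B u i = pv B z j" "\<And>l. l < k \<Longrightarrow> u ! (i + l) = z ! (j + l)"
    "snd (z ! (j - 1)) = (\<not> d)" "snd (z ! (j + k)) = d"
    "Suc (i + k) \<in> ?S \<longrightarrow> snd (u ! (i + k)) = (\<not> d)" "i - 1 \<in> ?S \<longrightarrow> snd (u ! (i - 1)) = d"
    using r by (auto simp: runs_def z_def)
  have "i \<in> {i..i + k}" "i + k \<in> {i..i + k}" by auto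
  then have "i \<in> ?S" "i + k \<in> ?S" using h(1) by blast+
  then have iS: "Suc k1 \<le> i" "i + k \<le> k2" by auto
  have k2l: "k2 < length u" using m2 by (simp add: marked_def)
  have tz: "substring_type d z j k" using h by (simp add: substring_type_def z_def)
  have eqI: "inner x (mv u {i..i + k}) = inner x (mv z {j..j + k})"
    by (rule common_inner) (use h iS in auto)
  have I: "inner x (mv u {i..i + k}) = T x u (i + k) - T x u (i - 1)" using inner_T iS by simp
  have sgn: "(d \<longrightarrow> T x u (i - 1) \<le> T x u (i + k)) \<and> (\<not> d \<longrightarrow> T x u (i + k) < T x u (i - 1))"
    using cz tz eqI I unfolding coherent_def by (cases d) fastforce+
  have i1: "i - 1 = k1 \<or> (i - 1 \<in> ?S \<and> snd (u ! (i - 1)) = d)" using iS h(10) by force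
  have i2: "i + k = k2 \<or> (i + k < k2 \<and> snd (u ! (i + k)) = (\<not> d))" using iS h(9) by force
  have "i - 1 = k1 \<and> i + k = k2"
  proof (rule ccontr)
    assume "\<not> ?thesis"
    then consider "i - 1 = k1" "i + k < k2" "snd (u ! (i + k)) = (\<not> d)"
      | "i + k = k2" "snd (u ! (i - 1)) = d" "i - 1 \<in> ?S"
      | "i + k < k2" "snd (u ! (i + k)) = (\<not> d)" "i - 1 \<in> ?S" "snd (u ! (i - 1)) = d"
      using i1 i2 by blast
    then show False
    proof cases
      case 1
      then have "k1 < i + k" "i + k < length u" using iS k2l by auto
      then have "snd (u ! (i + k)) \<longleftrightarrow> T x u k1 \<le> T x u (i + k)" using m1 by (auto simp: marked_def)
      then show False using 1 sgn by auto
    next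
      case 2
      then have "i - 1 < k2" using iS by auto
      then have "snd (u ! (i - 1)) \<longleftrightarrow> T x u k2 < T x u (i - 1)" using m2 by (auto simp: marked_def)
      then show False using 2 sgn by auto
    next
      case 3
      then have lt: "i - 1 < i + k" "i + k < length u" using k2l by auto
      have "(\<not> snd (u ! (i - 1)) \<and> snd (u ! (i + k)) \<longrightarrow> T x u (i - 1) \<le> T x u (i + k)) \<and>
          (snd (u ! (i - 1)) \<and> \<not> snd (u ! (i + k)) \<longrightarrow> T x u (i + k) < T x u (i - 1))"
        using co lt unfolding coherent_T by blast
      then show False using 3 sgn by (cases d) auto
    qed
  qed
  then have ik: "i = Suc k1" "i + k = k2" using iS by auto
  have oku: "ok (u ! k1) (u ! Suc k1)" "ok (u ! (k2 - 1)) (u ! k2)"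
    using chain_ok[OF cu, of "Suc k1"] chain_ok[OF cu, of k2] k k2l by auto
  have okz: "ok (z ! (j - 1)) (z ! j)" "ok (z ! (j + k - 1)) (z ! (j + k))"
    using chain_ok[OF chz, of j] chain_ok[OF chz, of "j + k"] h(2,3) by (auto simp: z_def)
  \<comment> \<open>The match is lengthened by one letter on each side. For \<open>k = 0\<close> the
    orientation was a convention, so the longer match may read \<open>w\<close> the other way, with
    the vertex at \<open>?n - j\<close>.\<close>
  have "\<exists>b' j'. ((b' = b \<and> j' = j) \<or> (k = 0 \<and> b' = (\<not> b) \<and> j' = ?n - j)) \<and> 1 \<le> j' \<and> j' + k < ?n \<and>
      (\<forall>l\<le>k + 1. u ! (k1 + l) = ori b' w ! (j' - 1 + l))"
  proof (cases "k = 0")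
    case False
    have a: "u ! k1 = z ! (j - 1)"
    proof (rule ok_unique_left)
      show "ok (u ! k1) (u ! Suc k1)" by (rule oku)
      show "ok (z ! (j - 1)) (u ! Suc k1)" using okz(1) h(6)[of 0] False ik by simp
      show "snd (u ! k1) = snd (z ! (j - 1))" using s1 h by simp
    qed
    have c: "u ! k2 = z ! (j + k)"
    proof (rule ok_unique)
      show "ok (u ! (k2 - 1)) (u ! k2)" by (rule oku)
      have "k2 - 1 = i + (k - 1)" "j + k - 1 = j + (k - 1)" using False ik by auto
      then have "u ! (k2 - 1) = z ! (j + k - 1)" using h(6)[of "k - 1"] False by simp
      then show "ok (u ! (k2 - 1)) (z ! (j + k))" using okz(2) by simp
      show "snd (u ! k2) = snd (z ! (j + k))" using s2 h by simp
    qed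
    have "u ! (k1 + l) = z ! (j - 1 + l)" if lk: "l \<le> k + 1" for l
    proof -
      consider "l = 0" | "l = k + 1" | "0 < l" "l < k + 1" using lk by linarith
      then show ?thesis
      proof cases
        case 3
        then show ?thesis using h(6)[of "l - 1"] ik h(2) by simp
      qed (use a c ik h(2) in auto)
    qed
    then show ?thesis using h(2,3) z_def by blast
  next
    case True
    have b: b using True h(4) by blast
    have kk: "k2 = Suc k1" using ik True by simp
    have okuu: "ok (u ! k1) (u ! k2)" using oku kk by simp
    have pvu: "lsrc B (u ! k2) = ltgt B (z ! (j - 1))" "ltgt B (u ! k1) = ltgt B (z ! (j - 1))"
      using h(5) ik pv_lsrc[OF cu, of k2] k2l kk True by (auto simp: pv_def)
    have "u ! k2 = z ! j \<or> u ! k2 = linv (z ! (j - 1))"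
      by (rule bend_letters[OF okz(1), of d]) (use h True s2 pvu okuu in \<open>auto simp: ok_def\<close>)
    moreover have "linv (u ! k1) = z ! j \<or> linv (u ! k1) = linv (z ! (j - 1))"
      by (rule bend_letters[OF okz(1), of d]) (use h True s1 pvu okuu in \<open>auto simp: ok_def\<close>)
    moreover have "u ! k2 \<noteq> linv (u ! k1)" using okuu by (auto simp: ok_def)
    ultimately consider "u ! k2 = z ! j" "u ! k1 = z ! (j - 1)" | "u ! k2 = linv (z ! (j - 1))" "u ! k1 = linv (z ! j)"
      by (metis linv_linv)
    then show ?thesis
    proof cases
      case 1
      have "u ! (k1 + l) = z ! (j - 1 + l)" if "l \<le> k + 1" for l
      proof -
        have "l = 0 \<or> l = 1" using that True by auto
        then show ?thesis using 1 kk h(2) by auto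
      qed
      then show ?thesis using h(2,3) z_def by blast
    next
      case 2
      have zw: "z = w" using b z_def by simp
      have e: "winv w ! (?n - j) = linv (w ! (j - 1))" "winv w ! (?n - j - 1) = linv (w ! j)"
        using h(2,3) by (auto simp: winv_nth Suc_diff_Suc)
      have "u ! (k1 + l) = ori (\<not> b) w ! (?n - j - 1 + l)" if "l \<le> k + 1" for l
      proof -
        have "l = 0 \<or> l = 1" using that True by auto
        then show ?thesis using 2 kk h(2,3) e b zw True by auto
      qed
      moreover have "1 \<le> ?n - j" "?n - j + k < ?n" using h(2,3) True by auto
      ultimately show ?thesis using True by blast
    qed
  qed
  then obtain b' j' where bj: "(b' = b \<and> j' = j) \<or> (k = 0 \<and> b' = (\<not> b) \<and> j' = ?n - j)" "1 \<le> j'" "j' + k < ?n"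
    and eq: "\<And>l. l \<le> k + 1 \<Longrightarrow> u ! (k1 + l) = ori b' w ! (j' - 1 + l)" by blast
  define z' where "z' = ori b' w"
  have wz: "walk_word z'" "chain z'" "coherent x z'" "length z' = ?n"
    using w chw cw by (auto simp: z'_def wk_ori chain_ori coherent_ori)
  note eq = eq[folded z'_def]
  have k12: "k2 = k1 + (k + 1)" using ik by simp
  have "u = z' \<and> k2 = j' + k"
  proof (rule agree[OF u wz(1) k2l])
    show "j' + k < length z'" using bj wz by simp
    show e2: "u ! k2 = z' ! (j' + k)" using eq[of "k + 1"] k12 bj(2) by simp
    show "\<not> rsep u k2 z' (j' + k) r" for r
    proof
      assume a: "rsep u k2 z' (j' + k) r"
      have "rsep u k1 z' (j' - 1) (r + (k + 1))" unfolding rsep_def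
      proof (intro conjI allI impI)
        show "1 \<le> r + (k + 1)" by simp
        show "k1 + (r + (k + 1)) < length u" "j' - 1 + (r + (k + 1)) < length z'"
          using a k12 bj(2) by (auto simp: rsep_def)
        show "u ! (k1 + (r + (k + 1))) \<noteq> z' ! (j' - 1 + (r + (k + 1)))"
          using a k12 bj(2) by (auto simp: rsep_def algebra_simps)
        fix l assume l: "l < r + (k + 1)"
        show "u ! (k1 + l) = z' ! (j' - 1 + l)"
        proof (cases "l \<le> k + 1")
          case True
          then show ?thesis by (rule eq)
        next
          case False
          then have "l - (k + 1) < r" using l by simp
          then have "u ! (k2 + (l - (k + 1))) = z' ! (j' + k + (l - (k + 1)))" using a unfolding rsep_def by blast
          then show ?thesis using False k12 bj(2) by simp
        qed
      qed
      then have "snd (u ! (k1 + (r + (k + 1)))) = (\<not> snd (u ! k1))"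
        using mk_rsep(1)[OF cu wz(2) m1 wz(3)] by blast
      moreover have "snd (u ! (k2 + r)) = (\<not> snd (u ! k2))"
        using mk_rsep(1)[OF cu wz(2) m2 wz(3) a] .
      ultimately show False using s1 s2 k12 by (simp add: add.commute add.left_commute)
    qed
    show "\<not> lsep u k2 z' (j' + k) r" for r
    proof
      assume a: "lsep u k2 z' (j' + k) r"
      \<comment> \<open>The words agree from \<open>k1\<close> to \<open>k2\<close>, so the
        separation lies to the left of \<open>k1\<close> and is also seen from there.\<close>
      have rk: "k + 1 < r"
      proof (rule ccontr)
        assume "\<not> k + 1 < r"
        then have "u ! (k1 + (k + 1 - r)) = z' ! (j' - 1 + (k + 1 - r))" by (intro eq) simp
        moreover have "k1 + (k + 1 - r) = k2 - r" "j' - 1 + (k + 1 - r) = j' + k - r"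
          using \<open>\<not> k + 1 < r\<close> k12 bj(2) by auto
        ultimately show False using a by (simp add: lsep_def)
      qed
      have sub: "k1 - (r - (k + 1)) = k2 - r" "j' - 1 - (r - (k + 1)) = j' + k - r"
        using rk k12 bj(2) by auto
      have "lsep u k1 z' (j' - 1) (r - (k + 1))" unfolding lsep_def
      proof (intro conjI allI impI)
        show "1 \<le> r - (k + 1)" using rk by simp
        show "r - (k + 1) \<le> k1" "r - (k + 1) \<le> j' - 1" using a k12 bj(2) by (auto simp: lsep_def)
        show "u ! (k1 - (r - (k + 1))) \<noteq> z' ! (j' - 1 - (r - (k + 1)))"
          unfolding sub using a by (simp add: lsep_def)
        fix l assume l: "l < r - (k + 1)"
        have "l + (k + 1) < r" using l by simp
        then have "u ! (k2 - (l + (k + 1))) = z' ! (j' + k - (l + (k + 1)))" using a unfolding lsep_def by blast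
        moreover have "k2 - (l + (k + 1)) = k1 - l" "j' + k - (l + (k + 1)) = j' - 1 - l"
          using k12 bj(2) by auto
        ultimately show "u ! (k1 - l) = z' ! (j' - 1 - l)" by simp
      qed
      then have "snd (u ! (k1 - (r - (k + 1)))) = (\<not> snd (u ! k1))"
        using mk_lsep(1)[OF cu wz(2) m1 wz(3)] bj(3) wz(4) by simp
      moreover have "snd (u ! (k2 - r)) = (\<not> snd (u ! k2))"
        using mk_lsep(1)[OF cu wz(2) m2 wz(3) a] bj(3) wz(4) by simp
      ultimately show False using s1 s2 sub by simp
    qed
  qed
  then have uz: "u = z'" and kj: "k2 = j' + k" by auto
  have b': "b'" using ne uz by (cases b') (auto simp: z'_def)
  then have "w = u" using uz by (simp add: z'_def)
  moreover have "b \<and> j' = j" using bj(1) b' h(4) by auto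
  ultimately show ?thesis using ik kj by auto
qed

text \<open>Without kisses only runs of type \<open>d\<close> are counted, and by
  \<open>dual_runs\<close> the only possible one is the whole distinguished string of
  \<open>u\<close> matched with itself.\<close>

lemma dual_inner:
  assumes u: "walk_word u" and w: "walk_word w" and cw: "coherent x w" and m1: "marked x u k1" and m2: "marked x u k2"
    and k: "k1 < k2" and s1: "snd (u ! k1) = (\<not> d)" and s2: "snd (u ! k2) = d" and ne: "w \<noteq> winv u"
  shows "sg d * inner (gv w) (mv u {Suc k1..k2}) = (if w = u then 1 else 0)"
proof -
  let ?S = "{Suc k1..k2}"
  have e: "Suc k1 + (k2 - Suc k1) = k2" using k by simp
  have k2l: "k2 < length u" using m2 by (simp add: marked_def)
  have t: "substring_type d u (Suc k1) (k2 - Suc k1)" using k k2l s1 s2 e by (simp add: substring_type_def)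
  have nk: "nokiss w u" by (rule coherent_nokiss[OF wk_chain[OF w] cw mk_coherent[OF m1]])
  have "sg d * inner (gv w) (mv u ?S) = real (card (runs d ?S u w))"
    using ty_inner_nonneg[OF wk_chain[OF u] w t nk] e by simp
  also have "runs d ?S u w = (if w = u then {(True, Suc k1, Suc k1, k2 - Suc k1)} else {})"
  proof -
    let ?r = "(True, Suc k1, Suc k1, k2 - Suc k1)"
    have a: "r = ?r \<and> w = u" if "r \<in> runs d ?S u w" for r
      using dual_runs[OF u w cw m1 m2 k s1 s2 ne] that by (cases r) blast
    have b: "?r \<in> runs d ?S u u" using ty_self[OF t] e by simp
    show ?thesis
    proof (cases "w = u")
      case True
      then have "runs d ?S u w = {?r}" using a b by blast
      then show ?thesis using True by simp
    next
      case False
      then have "runs d ?S u w = {}" using a by blast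
      then show ?thesis using False by simp
    qed
  qed
  finally show ?thesis by simp
qed

end

section \<open>Greedy walks\<close>

lemma sum_lessThan_split:
  fixes f :: "nat \<Rightarrow> real"
  shows "(\<Sum>k<a + b. f k) = (\<Sum>k<a. f k) + (\<Sum>k<b. f (a + k))"
  by (induction b) simp_all

context blossom_quiver begin

text \<open>Unspecified at a blossom vertex. Greedy sequences run on formally, but are used only up
  to the first blossom vertex, if there is one.\<close>

definition nxt :: "'c \<times> bool \<Rightarrow> bool \<Rightarrow> 'c \<times> bool" where
  "nxt l s = (THE l'. ok l l' \<and> snd l' = s)"

lemma nxt: assumes "l \<in> L" "isl (ltgt B l)" shows "ok l (nxt l s)" "snd (nxt l s) = s"
proof -
  obtain v where "ltgt B l = Inl v" using assms(2) by (cases "ltgt B l") auto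
  from theI'[OF next_ex1[OF assms(1) this, of s]]
  show "ok l (nxt l s)" "snd (nxt l s) = s" by (auto simp: nxt_def)
qed

text \<open>The running sum of x over the visited vertices decides whether the next letter is read forward.\<close>

definition gstep :: "real^'v \<Rightarrow> ('c \<times> bool) \<times> real \<Rightarrow> ('c \<times> bool) \<times> real" where
  "gstep x s = (let t = snd s + xv x (ltgt B (fst s)) in (nxt (fst s) (0 \<le> t), t))"

definition gst :: "real^'v \<Rightarrow> 'c \<times> bool \<Rightarrow> nat \<Rightarrow> ('c \<times> bool) \<times> real" where
  "gst x l n = (gstep x ^^ n) (l, 0)"

definition stops :: "real^'v \<Rightarrow> 'c \<times> bool \<Rightarrow> bool" where
  "stops x l \<longleftrightarrow> (\<exists>n. \<not> isl (ltgt B (fst (gst x l n))))"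

lemma gst_0 [simp]: "gst x l 0 = (l, 0)" by (simp add: gst_def)

lemma gst_Suc: "gst x l (Suc n) = gstep x (gst x l n)" by (simp add: gst_def)

lemma gst_props:
  assumes "l \<in> L" "\<And>m. m < n \<Longrightarrow> isl (ltgt B (fst (gst x l m)))"
  shows "fst (gst x l n) \<in> L"
    "m < n \<Longrightarrow> ok (fst (gst x l m)) (fst (gst x l (Suc m)))"
    "1 \<le> m \<Longrightarrow> m \<le> n \<Longrightarrow> snd (fst (gst x l m)) \<longleftrightarrow> 0 \<le> snd (gst x l m)"
proof -
  have inL: "k \<le> n \<Longrightarrow> fst (gst x l k) \<in> L" for k
  proof (induction k)
    case (Suc k)
    then show ?case using nxt(1)[of "fst (gst x l k)"] assms(2)[of k]
      by (auto simp: gst_Suc gstep_def Let_def ok_def)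
  qed (use assms in simp)
  show "fst (gst x l n) \<in> L" using inL by simp
  show "m < n \<Longrightarrow> ok (fst (gst x l m)) (fst (gst x l (Suc m)))" for m
    using nxt(1)[OF inL[of m] assms(2)[of m]] by (simp add: gst_Suc gstep_def Let_def)
  show "1 \<le> m \<Longrightarrow> m \<le> n \<Longrightarrow> snd (fst (gst x l m)) \<longleftrightarrow> 0 \<le> snd (gst x l m)" for m
    using nxt(2)[OF inL[of "m - 1"] assms(2)[of "m - 1"]]
    by (cases m) (simp_all add: gst_Suc gstep_def Let_def)
qed

lemma gst_sum: "snd (gst x l (m + q)) = snd (gst x l m) + (\<Sum>i<q. xv x (ltgt B (fst (gst x l (m + i)))))"
  by (induction q) (simp_all add: gst_Suc gstep_def Let_def)

lemma greedy_word:
  assumes l: "l \<in> L" and s: "stops x l"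
  obtains r where "chain r" "r \<noteq> []" "r ! 0 = l" "\<not> isl (ltgt B (last r))"
    "\<And>q. 0 < q \<Longrightarrow> q < length r \<Longrightarrow> (snd (r ! q) \<longleftrightarrow> 0 \<le> T x r q)"
proof -
  define n where "n = (LEAST n. \<not> isl (ltgt B (fst (gst x l n))))"
  have n: "\<not> isl (ltgt B (fst (gst x l n)))" using s unfolding stops_def n_def by (rule LeastI_ex)
  have m: "isl (ltgt B (fst (gst x l m)))" if "m < n" for m
    using not_less_Least[OF that[unfolded n_def]] by blast
  define r where "r = map (\<lambda>k. fst (gst x l k)) [0..<Suc n]"
  have len: "length r = Suc n" by (simp add: r_def)
  have nth: "r ! k = fst (gst x l k)" if "k \<le> n" for k
    using that unfolding r_def by (simp add: nth_append del: upt_Suc)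
  have T: "T x r q = snd (gst x l q)" if "q \<le> n" for q
  proof -
    have "T x r q = (\<Sum>i<q. xv x (ltgt B (fst (gst x l (0 + i)))))"
      unfolding T_def
      by (rule sum.reindex_bij_witness[of _ "\<lambda>i. Suc i" "\<lambda>i. i - 1"]) (use that nth in \<open>auto simp: pv_def\<close>)
    then show ?thesis using gst_sum[of x l 0 q] by simp
  qed
  show thesis
  proof (rule that[of r])
    show "chain r" unfolding chain_def
    proof (intro conjI allI impI)
      show "set r \<subseteq> L"
      proof
        fix y assume "y \<in> set r"
        then obtain k where "k < Suc n" "y = r ! k" using len by (metis in_set_conv_nth)
        then show "y \<in> L" using nth[of k] gst_props(1)[OF l, of k x] m by simp
      qed
      show "ok (r ! k) (r ! Suc k)" if "Suc k < length r" for k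
        using nth[of k] nth[of "Suc k"] gst_props(2)[of l n x k] l m that len by simp
    qed
    show "r \<noteq> []" using len by auto
    show "r ! 0 = l" using nth[of 0] by simp
    have "last r = r ! n" using len by (simp add: last_conv_nth[of r] \<open>r \<noteq> []\<close>)
    then show "\<not> isl (ltgt B (last r))" using nth[of n] n by simp
    show "snd (r ! q) \<longleftrightarrow> 0 \<le> T x r q" if "0 < q" "q < length r" for q
      using nth[of q] T[of q] gst_props(3)[of l n x q] l m that len by simp
  qed
qed

text \<open>The greedy rule is run from both readings of the arrow and the two words are glued.
  Inverting the left half negates its signs, so the weak rule for the running sum becomes the strict
  condition to the left of the mark.\<close>

lemma greedy_walk:
  assumes a: "a \<in> arrs B" and s1: "stops x (a, True)" and s2: "stops x (a, False)"
  obtains w p where "walk_word w" "marked x w p" "w ! p = (a, True)"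
proof -
  have L1: "(a, True) \<in> L" and L2: "(a, False) \<in> L" using a by (auto simp: L_def)
  obtain r where r: "chain r" "r \<noteq> []" "r ! 0 = (a, True)" "\<not> isl (ltgt B (last r))"
    "\<And>q. 0 < q \<Longrightarrow> q < length r \<Longrightarrow> (snd (r ! q) \<longleftrightarrow> 0 \<le> T x r q)" using greedy_word[OF L1 s1] by blast
  obtain s where s: "chain s" "s \<noteq> []" "s ! 0 = (a, False)" "\<not> isl (ltgt B (last s))"
    "\<And>q. 0 < q \<Longrightarrow> q < length s \<Longrightarrow> (snd (s ! q) \<longleftrightarrow> 0 \<le> T x s q)" using greedy_word[OF L2 s2] by blast
  define p where "p = length s - 1"
  define w where "w = winv s @ tl r"
  have lens: "length s = Suc p" using s(2) by (simp add: p_def)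
  have lw: "length w = p + length r" using lens r(2) by (cases r) (auto simp: w_def)
  have lr: "0 < length r" using r(2) by simp
  have wl: "w ! k = linv (s ! (p - k))" if "k \<le> p" for k
    using that lens by (simp add: w_def nth_append winv_nth)
  have wr: "w ! (p + k) = r ! k" if "k < length r" for k
  proof (cases k)
    case 0
    then show ?thesis using wl[of p] s(3) r(3) by (simp add: linv_def)
  next
    case (Suc k')
    then show ?thesis using that lens r(2) by (cases r) (auto simp: w_def nth_append)
  qed
  have ch: "chain w" unfolding chain_def
  proof (intro conjI allI impI)
    have "set r \<subseteq> L" "set s \<subseteq> L" using r(1) s(1) by (auto simp: chain_def)
    moreover have "set (tl r) \<subseteq> set r" by (cases r) auto
    ultimately show "set w \<subseteq> L" by (auto simp: w_def winv_def)
    fix k assume k: "Suc k < length w"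
    show "ok (w ! k) (w ! Suc k)"
    proof (cases "k < p")
      case True
      then have "ok (s ! (p - Suc k)) (s ! Suc (p - Suc k))" using s(1) lens by (auto simp: chain_def)
      moreover have "Suc (p - Suc k) = p - k" using True by simp
      ultimately show ?thesis using ok_linv wl[of k] wl[of "Suc k"] True by simp
    next
      case False
      then have "w ! k = r ! (k - p)" "w ! Suc k = r ! Suc (k - p)"
        using wr[of "k - p"] wr[of "Suc (k - p)"] k lw by auto
      moreover have "ok (r ! (k - p)) (r ! Suc (k - p))" using r(1) k lw False by (auto simp: chain_def)
      ultimately show ?thesis by simp
    qed
  qed
  have w0: "w \<noteq> []" using lw lr by auto
  have wkw: "walk_word w" unfolding walk_word_def
  proof (intro conjI)
    show "chain w" by (rule ch)
    show "w \<noteq> []" by (rule w0)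
    have "hd w = linv (last s)" using wl[of 0] w0 s(2) by (simp add: hd_conv_nth last_conv_nth p_def)
    then show "\<not> isl (lsrc B (hd w))" using s(4) by simp
    have "length w - 1 = p + (length r - 1)" using lw lr by linarith
    then have "last w = last r" using wr[of "length r - 1"] lr w0 r(2) by (metis last_conv_nth diff_less zero_less_one)
    then show "\<not> isl (ltgt B (last w))" using r(4) by simp
  qed
  have Tr: "T x w (p + k) - T x w p = T x r k" if "k < length r" for k
  proof -
    have "T x w (p + k) - T x w p = (\<Sum>i=Suc p..p + k. xv x (pv B w i))" by (rule T_diff) simp
    also have "\<dots> = T x r k" unfolding T_def
    proof (rule sum.reindex_bij_witness[of _ "\<lambda>i. p + i" "\<lambda>i. i - p"])
      fix i assume i: "i \<in> {Suc p..p + k}"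
      have "w ! (p + (i - p - 1)) = r ! (i - p - 1)" using wr[of "i - p - 1"] i that by auto
      moreover have "p + (i - p - 1) = i - 1" using i by auto
      ultimately show "xv x (pv B r (i - p)) = xv x (pv B w i)" by (simp add: pv_def)
    qed auto
    finally show ?thesis .
  qed
  have Ts: "T x w p - T x w (p - k) = T x s k" if "k \<le> p" for k
  proof -
    have "T x w p - T x w (p - k) = (\<Sum>i=Suc (p - k)..p. xv x (pv B w i))" by (rule T_diff) simp
    also have "\<dots> = T x s k" unfolding T_def
    proof (rule sum.reindex_bij_witness[of _ "\<lambda>i. Suc p - i" "\<lambda>i. Suc p - i"])
      fix i assume i: "i \<in> {Suc (p - k)..p}"
      have "1 \<le> i" "i < length w" using i lw lr unfolding atLeastAtMost_iff by linarith+
      then have "pv B w i = lsrc B (w ! i)" by (rule pv_lsrc[OF ch])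
      also have "w ! i = linv (s ! (p - i))" using wl i by simp
      finally have "pv B w i = pv B s (Suc p - i)" using i by (simp add: pv_def)
      then show "xv x (pv B s (Suc p - i)) = xv x (pv B w i)" by simp
    qed (use that in auto)
    finally show ?thesis .
  qed
  have "marked x w p" unfolding marked_def
  proof (intro conjI allI impI)
    show "p < length w" using lw lr by simp
    show "snd (w ! q) \<longleftrightarrow> T x w p \<le> T x w q" if "p < q" "q < length w" for q
    proof -
      have l: "q - p < length r" "0 < q - p" "p + (q - p) = q" using that lw by auto
      have "snd (w ! q) \<longleftrightarrow> 0 \<le> T x r (q - p)" using wr[OF l(1)] r(5)[OF l(2,1)] l(3) by simp
      moreover have "T x w q - T x w p = T x r (q - p)" using Tr[OF l(1)] l(3) by simp
      ultimately show ?thesis by linarith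
    qed
    show "snd (w ! q) \<longleftrightarrow> T x w p < T x w q" if "q < p" for q
    proof -
      have l: "p - q \<le> p" "0 < p - q" "p - q < length s" "p - (p - q) = q" using that lens by auto
      have "snd (w ! q) \<longleftrightarrow> \<not> 0 \<le> T x s (p - q)" using wl[of q] s(5)[OF l(2,3)] that by simp
      moreover have "T x w p - T x w q = T x s (p - q)" using Ts[OF l(1)] l(4) by simp
      ultimately show ?thesis by linarith
    qed
  qed
  moreover have "w ! p = (a, True)" using wr[of 0] lr r(3) by simp
  ultimately show thesis using that wkw by blast
qed

text \<open>Admissibility bounds the length of a stretch of equal signs; backward letters form a
  path when read in the opposite order.\<close>

lemma no_straight:
  obtains M where "\<And>f s. (\<And>k. Suc k < M \<Longrightarrow> ok (f k) (f (Suc k))) \<Longrightarrow> (\<And>k. k < M \<Longrightarrow> f k \<in> L) \<Longrightarrow> \<exists>k<M. snd (f k) \<noteq> s"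
proof -
  obtain M where M: "\<And>ps. is_path B ps \<Longrightarrow> length ps = M \<Longrightarrow> \<exists>k. Suc k < length ps \<and> (ps ! k, ps ! Suc k) \<in> rels B"
    using admissible unfolding admissible_def by blast
  show thesis
  proof (rule that[of M], rule ccontr)
    fix f :: "nat \<Rightarrow> 'c \<times> bool" and s
    assume ok: "\<And>k. Suc k < M \<Longrightarrow> ok (f k) (f (Suc k))" and fL: "\<And>k. k < M \<Longrightarrow> f k \<in> L"
      and "\<not> (\<exists>k<M. snd (f k) \<noteq> s)"
    then have s: "\<And>k. k < M \<Longrightarrow> snd (f k) = s" by blast
    show False
    proof (cases s)
      case True
      let ?ps = "map (\<lambda>k. fst (f k)) [0..<M]"
      have "is_path B ?ps" unfolding is_path_def
      proof (intro conjI allI impI)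
        show "set ?ps \<subseteq> arrs B" using fL by (auto simp: L_def)
        fix k assume k: "Suc k < length ?ps"
        then show "tgt B (?ps ! k) = src B (?ps ! Suc k)"
          using ok[of k] s[of k] s[of "Suc k"] True
          by (cases "f k", cases "f (Suc k)") (auto simp: ok_def)
      qed
      then obtain k where "Suc k < M" "(fst (f k), fst (f (Suc k))) \<in> rels B" using M[of ?ps] by auto
      then show False using ok[of k] s[of k] s[of "Suc k"] True by (auto simp: ok_def)
    next
      case False
      let ?ps = "map (\<lambda>k. fst (f (M - 1 - k))) [0..<M]"
      have e: "M - 1 - k = Suc (M - 1 - Suc k)" if "Suc k < M" for k using that by simp
      have "is_path B ?ps" unfolding is_path_def
      proof (intro conjI allI impI)
        show "set ?ps \<subseteq> arrs B" using fL by (auto simp: L_def)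
        fix k assume k: "Suc k < length ?ps"
        then have "ok (f (M - 1 - Suc k)) (f (M - 1 - k))" using ok[of "M - 1 - Suc k"] e[of k] by simp
        then show "tgt B (?ps ! k) = src B (?ps ! Suc k)"
          using s[of "M - 1 - k"] s[of "M - 1 - Suc k"] False k
          by (cases "f (M - 1 - k)", cases "f (M - 1 - Suc k)") (auto simp: ok_def)
      qed
      then obtain k where k: "Suc k < M" "(fst (f (M - 1 - k)), fst (f (M - 1 - Suc k))) \<in> rels B" using M[of ?ps] by auto
      then have "ok (f (M - 1 - Suc k)) (f (M - 1 - k))" using ok[of "M - 1 - Suc k"] e[of k] by simp
      then show False using s[of "M - 1 - k"] s[of "M - 1 - Suc k"] False k by (auto simp: ok_def)
    qed
  qed
qed

text \<open>The running sum stays nonnegative, so an infinite greedy word would read all its later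
  arrows forward. The open positive orthant is where the segment of the completeness argument
  starts.\<close>

lemma stops_positive:
  assumes l: "l \<in> L" and x: "\<And>v. 0 < x $ v"
  shows "stops x l"
proof (rule ccontr)
  assume "\<not> stops x l"
  then have inf: "isl (ltgt B (fst (gst x l n)))" for n by (simp add: stops_def)
  have xp: "0 < xv x V" if "isl V" for V :: "'v + 'x" using that x by (cases V) (auto simp: xv_def)
  have t: "0 \<le> snd (gst x l n)" for n
  proof (induction n)
    case (Suc n)
    then show ?case using xp[OF inf[of n]] by (simp add: gst_Suc gstep_def Let_def)
  qed simp
  obtain M where M: "\<And>f s. (\<And>k. Suc k < M \<Longrightarrow> ok (f k) (f (Suc k))) \<Longrightarrow> (\<And>k. k < M \<Longrightarrow> f k \<in> L) \<Longrightarrow> \<exists>k<M. snd (f k) \<noteq> s"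
    using no_straight by blast
  have "\<exists>k<M. snd (fst (gst x l (Suc k))) \<noteq> True"
    by (rule M) (use gst_props(1,2)[OF l inf] in auto)
  then obtain k where "\<not> snd (fst (gst x l (Suc k)))" by auto
  then show False using gst_props(3)[OF l inf, of "Suc k" "Suc k"] t by simp
qed

text \<open>An integral greedy walk that never stops is eventually periodic. A coherent walk has boundedly many
  runs in arbitrarily high powers of the period (all of them touch the ends), so it pairs to zero with
  the period.\<close>

lemma nonstop_vector:
  assumes l: "l \<in> L" and x: "\<And>v. x $ v \<in> \<int>" and ns: "\<not> stops x l"
  obtains m :: "real^'v" where "m \<noteq> 0" "inner x m = 0" "\<And>w. walk_word w \<Longrightarrow> coherent x w \<Longrightarrow> inner (gv w) m = 0"
proof -
  have inf: "isl (ltgt B (fst (gst x l n)))" for n using ns by (simp add: stops_def)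
  let ?f = "\<lambda>n. fst (gst x l n)" and ?t = "\<lambda>n. snd (gst x l n)"
  have fL: "?f n \<in> L" for n using gst_props(1)[OF l inf] .
  have fok: "ok (?f n) (?f (Suc n))" for n using gst_props(2)[OF l inf, of n "Suc n"] by simp
  have fs: "snd (?f n) \<longleftrightarrow> 0 \<le> ?t n" if "1 \<le> n" for n using gst_props(3)[OF l inf, of n n] that by simp
  obtain M where M: "\<And>f s. (\<And>k. Suc k < M \<Longrightarrow> ok (f k) (f (Suc k))) \<Longrightarrow> (\<And>k. k < M \<Longrightarrow> f k \<in> L) \<Longrightarrow> \<exists>k<M. snd (f k) \<noteq> s"
    using no_straight by blast
  define X where "X = (\<Sum>v\<in>UNIV. \<bar>x $ v\<bar>)"
  have X0: "0 \<le> X" unfolding X_def by (simp add: sum_nonneg)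
  have xX: "\<bar>xv x V\<bar> \<le> X" for V :: "'v + 'x"
    by (cases V) (auto simp: xv_def X0 X_def intro: member_le_sum)
  have tstep: "\<bar>?t (Suc n) - ?t n\<bar> \<le> X" for n using xX by (simp add: gst_Suc gstep_def Let_def)
  have tdist: "\<bar>?t (n + k) - ?t n\<bar> \<le> real k * X" for n k
  proof (induction k)
    case (Suc k)
    then show ?case using tstep[of "n + k"] by (simp add: algebra_simps)
  qed simp
  \<comment> \<open>The sign changes within \<open>M\<close> steps. There the sum crosses zero and
    is at most \<open>X\<close> in absolute value, and fewer than \<open>M\<close> steps of size at
    most \<open>X\<close> lie between.\<close>
  have bnd: "\<bar>?t n\<bar> \<le> real (Suc M) * X" if n: "1 \<le> n" for n
  proof -
    have "\<exists>k<M. snd (?f (n + k)) \<noteq> snd (?f n)"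
      by (rule M) (use fL fok in auto)
    then have ex: "\<exists>k. k < M \<and> snd (?f (n + k)) \<noteq> snd (?f n)" by blast
    define k where "k = (LEAST k. k < M \<and> snd (?f (n + k)) \<noteq> snd (?f n))"
    have k: "k < M" "snd (?f (n + k)) \<noteq> snd (?f n)" using LeastI_ex[OF ex] by (auto simp: k_def)
    have k0: "k \<noteq> 0" using k(2) by (metis add.right_neutral)
    then have "\<not> (k - 1 < M \<and> snd (?f (n + (k - 1))) \<noteq> snd (?f n))"
      unfolding k_def by (intro not_less_Least) simp
    then have e: "snd (?f (n + (k - 1))) = snd (?f n)" using k by auto
    have nk: "n + k = Suc (n + (k - 1))" using k0 by simp
    have "(0 \<le> ?t (n + k)) \<noteq> (0 \<le> ?t (n + (k - 1)))"
      using fs[of "n + k"] fs[of "n + (k - 1)"] e k(2) n by (metis trans_le_add1)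
    moreover have "\<bar>?t (n + k) - ?t (n + (k - 1))\<bar> \<le> X" using tstep[of "n + (k - 1)"] nk by metis
    ultimately have "\<bar>?t (n + k)\<bar> \<le> X" by linarith
    moreover have "real k * X \<le> real M * X" using k X0 by (intro mult_right_mono) auto
    ultimately show ?thesis using tdist[of n k] by (simp add: algebra_simps)
  qed
  have tint: "?t n \<in> \<int>" for n
  proof (induction n)
    case (Suc n)
    have "xv x V \<in> \<int>" for V :: "'v + 'x" using x by (cases V) (auto simp: xv_def)
    then show ?case using Suc by (simp add: gst_Suc gstep_def Let_def)
  qed simp
  \<comment> \<open>Integrality leaves finitely many states of letter and sum, and each state
    determines the next, so a repeated state yields a period.\<close>
  let ?K = "{t. t \<in> \<int> \<and> \<bar>t\<bar> \<le> real (Suc M) * X}"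
  have "finite ?K" by (rule finite_abs_int_segment)
  then have "finite (L \<times> ?K)" using finite_L by blast
  moreover have "(\<lambda>n. gst x l (Suc n)) ` UNIV \<subseteq> L \<times> ?K"
  proof (rule image_subsetI)
    fix n
    show "gst x l (Suc n) \<in> L \<times> ?K" using fL[of "Suc n"] tint[of "Suc n"] bnd[of "Suc n"] by (simp add: mem_Times_iff)
  qed
  ultimately have "finite ((\<lambda>n. gst x l (Suc n)) ` UNIV)" using finite_subset by blast
  then have "\<not> inj (\<lambda>n. gst x l (Suc n))" using finite_imageD infinite_UNIV_nat by blast
  then obtain i0 j0 where ij0: "gst x l (Suc i0) = gst x l (Suc j0)" "i0 < j0"
    unfolding inj_def by (metis linorder_neqE_nat)
  \<comment> \<open>The sign of letter zero is prescribed rather than decided by the running sum, so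
    the period starts at a positive index.\<close>
  define i where "i = Suc i0"
  define P where "P = j0 - i0"
  have P0: "0 < P" using ij0 by (simp add: P_def)
  have i1: "1 \<le> i" by (simp add: i_def)
  have iP: "gst x l (i + P) = gst x l i" using ij0 by (simp add: i_def P_def)
  have per1: "gst x l (i + m + P) = gst x l (i + m)" for m
  proof (induction m)
    case (Suc m)
    then show ?case by (simp add: gst_Suc)
  qed (use iP in simp)
  have per: "gst x l (i + m + N * P) = gst x l (i + m)" for m N
  proof (induction N)
    case (Suc N)
    have "i + m + Suc N * P = i + (m + N * P) + P" by simp
    then show ?case using per1[of "m + N * P"] Suc by (metis add.assoc)
  qed simp
  let ?v = "\<lambda>n. ltgt B (?f (i + n))"
  define m where "m = (\<chi> v. real (card {q \<in> {..<P}. ?v q = Inl v}))"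
  have inner_m: "inner y m = (\<Sum>q<P. xv y (?v q))" for y :: "real^'v"
  proof -
    have c: "real (card {q \<in> {..<P}. ?v q = Inl v}) = (\<Sum>q<P. of_bool (?v q = Inl v))" for v
      by (simp add: sum_of_bool_eq Int_def)
    have "inner y m = (\<Sum>v\<in>UNIV. y $ v * real (card {q \<in> {..<P}. ?v q = Inl v}))"
      by (simp add: inner_vec_def m_def)
    also have "\<dots> = (\<Sum>v\<in>UNIV. \<Sum>q<P. y $ v * of_bool (?v q = Inl v))"
      unfolding c sum_distrib_left by (rule refl)
    also have "\<dots> = (\<Sum>q<P. \<Sum>v\<in>UNIV. y $ v * of_bool (?v q = Inl v))" by (rule sum.swap)
    also have "\<dots> = (\<Sum>q<P. xv y (?v q))"
    proof (rule sum.cong)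
      fix q
      obtain v0 where v0: "?v q = Inl v0" using inf[of "i + q"] by (cases "?v q") auto
      have "(\<Sum>v\<in>UNIV. y $ v * of_bool (Inl v0 = (Inl v :: 'v + 'x))) = (\<Sum>v\<in>UNIV. if v = v0 then y $ v else 0)"
        by (rule sum.cong) auto
      then show "(\<Sum>v\<in>UNIV. y $ v * of_bool (?v q = Inl v)) = xv y (?v q)" using v0 by (simp add: xv_def)
    qed simp
    finally show ?thesis .
  qed
  show thesis
  proof (rule that[of m])
    show "inner x m = 0"
      using gst_sum[of x l i P] iP by (simp add: inner_m)
    show "m \<noteq> 0"
    proof
      assume m0: "m = 0"
      obtain v0 where v0: "?v 0 = Inl v0" using inf[of i] by (cases "ltgt B (?f i)") auto
      let ?A = "{q \<in> {..<P}. ?v q = Inl v0}"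
      have "0 \<in> ?A" using v0 P0 by simp
      moreover have "finite ?A" by simp
      ultimately have "card ?A \<noteq> 0" by (metis card_0_eq empty_iff)
      then have "m $ v0 \<noteq> 0" by (simp add: m_def)
      then show False using m0 by simp
    qed
    fix w assume w: "walk_word w" and cw: "coherent x w"
    \<comment> \<open>For each of the two types a run is determined by its orientation, the end of
      \<open>u\<close> it touches, and its start and length in \<open>w\<close>, which gives
      \<open>4 * (length w * length w)\<close>. The bound does not depend on the number
      \<open>N\<close> of periods.\<close>
    define C where "C = real (8 * (length w * length w))"
    have main: "real N * \<bar>inner (gv w) m\<bar> \<le> C" for N
    proof -
      define u where "u = map (\<lambda>k. ?f (i + k)) [0..<Suc (N * P)]"
      have len: "length u = Suc (N * P)" by (simp add: u_def)
      have nth: "u ! k = ?f (i + k)" if "k \<le> N * P" for k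
        using that unfolding u_def by (simp add: nth_append del: upt_Suc)
      have cu: "chain u" unfolding chain_def
      proof (intro conjI allI impI)
        show "set u \<subseteq> L" using fL by (auto simp: u_def)
        show "ok (u ! k) (u ! Suc k)" if "Suc k < length u" for k
          using nth[of k] nth[of "Suc k"] that len fok[of "i + k"] by simp
      qed
      have Tu: "T x u q = ?t (i + q) - ?t i" if "q \<le> N * P" for q
      proof -
        have "T x u q = (\<Sum>k<q. xv x (?v k))" unfolding T_def
          by (rule sum.reindex_bij_witness[of _ "\<lambda>k. Suc k" "\<lambda>k. k - 1"]) (use that nth in \<open>auto simp: pv_def\<close>)
        then show ?thesis using gst_sum[of x l i q] by simp
      qed
      have co: "coherent x u" unfolding coherent_T
      proof (intro allI impI)
        fix q r assume qr: "q < r" "r < length u"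
        have "snd (u ! q) \<longleftrightarrow> 0 \<le> ?t (i + q)" "snd (u ! r) \<longleftrightarrow> 0 \<le> ?t (i + r)"
          using fs[of "i + q"] fs[of "i + r"] nth[of q] nth[of r] i1 qr len by auto
        then show "(\<not> snd (u ! q) \<and> snd (u ! r) \<longrightarrow> T x u q \<le> T x u r) \<and> (snd (u ! q) \<and> \<not> snd (u ! r) \<longrightarrow> T x u r < T x u q)"
          using Tu[of q] Tu[of r] qr len by auto
      qed
      let ?S = "{1..<length u}"
      have sumN: "inner (gv w) (mv u ?S) = real N * inner (gv w) m"
      proof -
        have "inner (gv w) (mv u ?S) = (\<Sum>k<N * P. xv (gv w) (?v k))" unfolding inner_mv[OF finite_atLeastLessThan]
          by (rule sum.reindex_bij_witness[of _ "\<lambda>k. Suc k" "\<lambda>k. k - 1"]) (use nth len in \<open>auto simp: pv_def\<close>)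
        also have "\<dots> = real N * inner (gv w) m"
        proof (induction N)
          case (Suc N)
          have "(\<Sum>k<Suc N * P. xv (gv w) (?v k)) = (\<Sum>k<N * P. xv (gv w) (?v k)) + (\<Sum>k<P. xv (gv w) (?v (N * P + k)))"
            using sum_lessThan_split[of "\<lambda>k. xv (gv w) (?v k)" "N * P" P] by (simp add: add.commute)
          moreover have "(\<Sum>k<P. xv (gv w) (?v (N * P + k))) = inner (gv w) m"
            unfolding inner_m by (rule sum.cong) (use per[of _ N] in \<open>auto simp: ac_simps\<close>)
          ultimately show ?case using Suc by (simp add: algebra_simps)
        qed simp
        finally show ?thesis .
      qed
      have rb: "real (card (runs d ?S u w)) \<le> real (4 * (length w * length w))" for d
      proof -
        \<comment> \<open>A run touching neither end of \<open>u\<close> would be a kiss between two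
          coherent words.\<close>
        have ends: "i' = 1 \<or> i' + k' = N * P" if r: "(b, i', j', k') \<in> runs d ?S u w" for b i' j' k'
        proof (rule ccontr)
          assume n: "\<not> ?thesis"
          have h: "{i'..i' + k'} \<subseteq> ?S" "Suc (i' + k') \<in> ?S \<longrightarrow> snd (u ! (i' + k')) = (\<not> d)" "i' - 1 \<in> ?S \<longrightarrow> snd (u ! (i' - 1)) = d"
            using r by (auto simp: runs_def)
          have "i' \<in> {i'..i' + k'}" "i' + k' \<in> {i'..i' + k'}" by auto
          then have "i' \<in> ?S" "i' + k' \<in> ?S" using h(1) by blast+
          then have "Suc (i' + k') \<in> ?S" "i' - 1 \<in> ?S" using n len by auto
          then have "substring_type (\<not> d) u i' k'" using h \<open>i' \<in> ?S\<close> \<open>i' + k' \<in> ?S\<close> by (simp add: substring_type_def)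
          then have "(b, i', j', k') \<in> kiss_occs d w u" using r by (auto simp: runs_def kiss_occs_def substring_type_def)
          then show False using coherent_nokiss[OF wk_chain[OF w] cw co] unfolding nokiss_def by blast
        qed
        let ?g = "\<lambda>(b :: bool, i' :: nat, j' :: nat, k' :: nat). (b, i' = 1, j', k')"
        have "inj_on ?g (runs d ?S u w)"
        proof (rule inj_onI)
          fix r r' assume rr: "r \<in> runs d ?S u w" "r' \<in> runs d ?S u w" "?g r = ?g r'"
          obtain b1 i1 j1 k1 where e1: "r = (b1, i1, j1, k1)" by (cases r)
          obtain b2 i2 j2 k2 where e2: "r' = (b2, i2, j2, k2)" by (cases r')
          show "r = r'" using rr ends[of b1 i1 j1 k1] ends[of b2 i2 j2 k2] unfolding e1 e2 by auto
        qed
        moreover have "?g ` runs d ?S u w \<subseteq> UNIV \<times> UNIV \<times> {..<length w} \<times> {..<length w}"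
          by (auto simp: runs_def)
        ultimately have "card (runs d ?S u w) \<le> card ((UNIV :: bool set) \<times> (UNIV :: bool set) \<times> {..<length w} \<times> {..<length w})"
          by (intro card_inj_on_le) auto
        also have "\<dots> = 4 * (length w * length w)" by (simp add: card_cartesian_product)
        finally show ?thesis by linarith
      qed
      have "sg True * inner (gv w) (mv u ?S) = real (card (runs True ?S u w)) - real (card (runs (\<not> True) ?S u w))"
        by (rule run_inner[OF cu w]) simp
      then have "\<bar>inner (gv w) (mv u ?S)\<bar> \<le> C" using rb[of True] rb[of False] by (simp add: sg_def C_def)
      then show ?thesis using sumN by (simp add: abs_mult)
    qed
    show "inner (gv w) m = 0"
    proof (rule ccontr)
      assume "inner (gv w) m \<noteq> 0"
      then have "0 < \<bar>inner (gv w) m\<bar>" by simp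
      then obtain N where "C < real N * \<bar>inner (gv w) m\<bar>" using ex_less_of_nat_mult by blast
      then show False using main[of N] by simp
    qed
  qed
qed

section \<open>Walks as words\<close>

definition wstr :: "('c \<times> bool) list \<Rightarrow> ('v + 'x, 'c) str" where
  "wstr w = (lsrc B (hd w), w)"

definition word_of :: "('v + 'x, 'c) str set \<Rightarrow> ('c \<times> bool) list" where
  "word_of W = snd (rep W)"

lemma snd_wstr [simp]: "snd (wstr w) = w" by (simp add: wstr_def)

lemma wstr_inj [simp]: "wstr w = wstr w' \<longleftrightarrow> w = w'" by (auto simp: wstr_def)

lemma L_verts: "l \<in> L \<Longrightarrow> lsrc B l \<in> verts B"
  using end_verts[of "fst l"] by (cases l) (auto simp: L_def)

lemma is_string_iff:
  assumes "ls \<noteq> []"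
  shows "is_string B (v, ls) \<longleftrightarrow> chain ls \<and> v = lsrc B (hd ls)"
proof
  assume s: "is_string B (v, ls)"
  have a: "\<And>k. k < length ls \<Longrightarrow> ls ! k \<in> L \<and> lsrc B (ls ! k) = vtx B (v, ls) k"
    using s by (auto simp: is_string_def Let_def L_def)
  have "chain ls" unfolding chain_def
  proof (intro conjI allI impI)
    show "set ls \<subseteq> L" using a by (metis in_set_conv_nth subsetI)
    fix k assume k: "Suc k < length ls"
    have "lsrc B (ls ! Suc k) = ltgt B (ls ! k)" using a[OF k] by (simp add: vtx_def)
    moreover have "ls ! Suc k \<noteq> linv (ls ! k)" using s k by (auto simp: is_string_def Let_def)
    ultimately show "ok (ls ! k) (ls ! Suc k)"
      using s k a[of k] a[of "Suc k"] by (auto simp: is_string_def Let_def ok_def)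
  qed
  moreover have "v = lsrc B (hd ls)" using a[of 0] assms by (simp add: vtx_def hd_conv_nth)
  ultimately show "chain ls \<and> v = lsrc B (hd ls)" by blast
next
  assume c: "chain ls \<and> v = lsrc B (hd ls)"
  have cl: "ls ! k \<in> L" if "k < length ls" for k using c that chain_L by blast
  have ck: "ok (ls ! k) (ls ! Suc k)" if "Suc k < length ls" for k using c that by (auto simp: chain_def)
  have "v \<in> verts B" using c cl[of 0] L_verts assms by (simp add: hd_conv_nth)
  moreover have "fst (ls ! k) \<in> arrs B \<and> lsrc B (ls ! k) = vtx B (v, ls) k" if "k < length ls" for k
  proof (cases k)
    case 0
    then show ?thesis using cl[OF that] c assms by (simp add: vtx_def hd_conv_nth L_def)
  next
    case (Suc k')
    then show ?thesis using cl[OF that] ck[of k'] that by (simp add: vtx_def L_def ok_def)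
  qed
  moreover have "\<not> (fst (ls ! k) = fst (ls ! Suc k) \<and> snd (ls ! k) \<noteq> snd (ls ! Suc k)) \<and>
        \<not> (snd (ls ! k) \<and> snd (ls ! Suc k) \<and> (fst (ls ! k), fst (ls ! Suc k)) \<in> rels B) \<and>
        \<not> (\<not> snd (ls ! k) \<and> \<not> snd (ls ! Suc k) \<and> (fst (ls ! Suc k), fst (ls ! k)) \<in> rels B)" if "Suc k < length ls" for k
  proof -
    have "\<not> (fst (ls ! k) = fst (ls ! Suc k) \<and> snd (ls ! k) \<noteq> snd (ls ! Suc k))"
    proof
      assume "fst (ls ! k) = fst (ls ! Suc k) \<and> snd (ls ! k) \<noteq> snd (ls ! Suc k)"
      then have "ls ! Suc k = linv (ls ! k)" by (simp add: prod_eq_iff)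
      then show False using ck[OF that] by (simp add: ok_def)
    qed
    then show ?thesis using ck[OF that] by (simp add: ok_def)
  qed
  ultimately show "is_string B (v, ls)" unfolding is_string_def Let_def snd_conv fst_conv by blast
qed

lemma chain_Cons: "chain (l # ls) \<longleftrightarrow> l \<in> L \<and> chain ls \<and> (ls \<noteq> [] \<longrightarrow> ok l (hd ls))"
proof
  assume c: "chain (l # ls)"
  have "ok (ls ! k) (ls ! Suc k)" if "Suc k < length ls" for k
    using c that by (auto simp: chain_def dest: spec[of _ "Suc k"])
  moreover have "ok l (hd ls)" if "ls \<noteq> []" using c that by (auto simp: chain_def hd_conv_nth dest: spec[of _ 0])
  ultimately show "l \<in> L \<and> chain ls \<and> (ls \<noteq> [] \<longrightarrow> ok l (hd ls))" using c by (auto simp: chain_def)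
next
  assume a: "l \<in> L \<and> chain ls \<and> (ls \<noteq> [] \<longrightarrow> ok l (hd ls))"
  have "ok ((l # ls) ! k) ((l # ls) ! Suc k)" if "Suc k < length (l # ls)" for k
    using a that by (cases k) (auto simp: chain_def hd_conv_nth)
  then show "chain (l # ls)" using a by (auto simp: chain_def)
qed

lemma chain_winv_iff: "chain (winv u) \<longleftrightarrow> chain u"
  using chain_winv[of u] chain_winv[of "winv u"] by auto

lemma chain_snoc: "chain (ls @ [l]) \<longleftrightarrow> l \<in> L \<and> chain ls \<and> (ls \<noteq> [] \<longrightarrow> ok (last ls) l)"
proof -
  have e: "winv (ls @ [l]) = linv l # winv ls" by (simp add: winv_def)
  have h: "hd (winv ls) = linv (last ls)" if "ls \<noteq> []" using that by (simp add: winv_def hd_rev last_map)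
  have "ok (linv l) (linv (last ls)) \<longleftrightarrow> ok (last ls) l"
    using ok_linv[of "last ls" l] ok_linv[of "linv l" "linv (last ls)"] by auto
  then show ?thesis using chain_winv_iff[of "ls @ [l]"] chain_winv_iff[of ls] h unfolding e chain_Cons by auto
qed

text \<open>Types are nonempty, so there is an inner vertex, and arrows end there. This excludes
  strings of length zero from the maximal ones.\<close>

lemma L_nonempty: "\<exists>l. l \<in> L"
proof -
  have "{a \<in> arrs B. tgt B a = Inl undefined} \<noteq> {}" using in_two[of undefined] by (metis card.empty zero_neq_numeral)
  then obtain a where "a \<in> arrs B" by blast
  then show ?thesis by (intro exI[of _ "(a, True)"]) (simp add: L_def)
qed

text \<open>A string can always be prolonged at an inner vertex and never at a blossom
  vertex.\<close>

lemma maximal_string_iff: "maximal_string B \<sigma> \<longleftrightarrow> (\<exists>w. walk_word w \<and> \<sigma> = wstr w)"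
proof
  assume m: "maximal_string B \<sigma>"
  obtain v ls where \<sigma>: "\<sigma> = (v, ls)" by (cases \<sigma>)
  have s: "is_string B (v, ls)" and nl: "\<And>l. \<not> is_string B (lsrc B l, l # ls)" and nr: "\<And>l. \<not> is_string B (v, ls @ [l])"
    using m \<sigma> by (auto simp: maximal_string_def)
  have ne: "ls \<noteq> []"
  proof
    assume "ls = []"
    obtain l where "l \<in> L" using L_nonempty by blast
    then have "is_string B (lsrc B l, [l])" by (simp add: is_string_iff chain_Cons chain_def)
    then show False using nl \<open>ls = []\<close> by blast
  qed
  have c: "chain ls" "v = lsrc B (hd ls)" using s is_string_iff[OF ne] by auto
  have hL: "hd ls \<in> L" "last ls \<in> L" using c(1) ne by (auto simp: chain_def)
  have "\<not> isl (lsrc B (hd ls))"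
  proof
    assume "isl (lsrc B (hd ls))"
    then have "ok (linv (hd ls)) (nxt (linv (hd ls)) True)" using nxt(1)[of "linv (hd ls)" True] hL by simp
    then have o: "ok (linv (nxt (linv (hd ls)) True)) (hd ls)" using ok_linv by fastforce
    then have "is_string B (lsrc B (linv (nxt (linv (hd ls)) True)), linv (nxt (linv (hd ls)) True) # ls)"
      using c(1) by (simp add: is_string_iff chain_Cons ok_def)
    then show False using nl by blast
  qed
  moreover have "\<not> isl (ltgt B (last ls))"
  proof
    assume "isl (ltgt B (last ls))"
    then have "ok (last ls) (nxt (last ls) True)" using nxt(1)[OF hL(2)] by simp
    then have "is_string B (v, ls @ [nxt (last ls) True])"
      using c ne by (simp add: is_string_iff chain_snoc ok_def)
    then show False using nr by blast
  qed
  ultimately have "walk_word ls" using c ne by (simp add: walk_word_def)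
  then show "\<exists>w. walk_word w \<and> \<sigma> = wstr w" using \<sigma> c by (auto simp: wstr_def)
next
  assume "\<exists>w. walk_word w \<and> \<sigma> = wstr w"
  then obtain w where w: "walk_word w" "\<sigma> = wstr w" by blast
  have ne: "w \<noteq> []" and c: "chain w" using w by (auto simp: walk_word_def)
  have "is_string B (wstr w)" unfolding wstr_def using is_string_iff[OF ne] c by simp
  moreover have "\<not> is_string B (lsrc B l, l # w)" for l
  proof
    assume "is_string B (lsrc B l, l # w)"
    then have "ok l (hd w)" using ne by (simp add: is_string_iff chain_Cons)
    then show False using ok_isl[of l "hd w"] w by (auto simp: walk_word_def ok_def)
  qed
  moreover have "\<not> is_string B (lsrc B (hd w), w @ [l])" for l
  proof
    assume "is_string B (lsrc B (hd w), w @ [l])"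
    then have "ok (last w) l" using ne by (simp add: is_string_iff chain_snoc)
    then show False using ok_isl[of "last w" l] w by (auto simp: walk_word_def)
  qed
  ultimately show "maximal_string B \<sigma>" using w by (simp add: maximal_string_def wstr_def)
qed

lemma str_inv_wstr: assumes "w \<noteq> []" shows "str_inv B (wstr w) = wstr (winv w)"
proof -
  have "map (\<lambda>(a, d). (a, \<not> d)) w = map linv w" by (auto simp: linv_def)
  moreover have "hd (winv w) = linv (last w)" using assms by (simp add: winv_def hd_rev last_map)
  ultimately show ?thesis using assms by (simp add: str_inv_def wstr_def vtx_def winv_def last_conv_nth)
qed

lemma walks_iff: "W \<in> walks B \<longleftrightarrow> (\<exists>w. walk_word w \<and> W = {wstr w, wstr (winv w)})"
proof
  assume "W \<in> walks B"
  then obtain \<sigma> where s: "W = {\<sigma>, str_inv B \<sigma>}" "maximal_string B \<sigma>" unfolding walks_def by blast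
  then obtain w where w: "walk_word w" "\<sigma> = wstr w" using maximal_string_iff by blast
  then have "str_inv B \<sigma> = wstr (winv w)" using str_inv_wstr by (simp add: walk_word_def)
  then have "W = {wstr w, wstr (winv w)}" using s(1) w(2) by simp
  then show "\<exists>w. walk_word w \<and> W = {wstr w, wstr (winv w)}" by (intro exI[of _ w] conjI w(1))
next
  assume "\<exists>w. walk_word w \<and> W = {wstr w, wstr (winv w)}"
  then obtain w where w: "walk_word w" "W = {wstr w, wstr (winv w)}" by blast
  then have "W = {wstr w, str_inv B (wstr w)}" using str_inv_wstr by (simp add: walk_word_def)
  moreover have "maximal_string B (wstr w)" using maximal_string_iff w by blast
  ultimately show "W \<in> walks B" unfolding walks_def by (intro CollectI exI[of _ "wstr w"] conjI)
qed

lemma walk_rl: assumes "W \<in> walks B"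
  shows "walk_word (word_of W)" "rep W = wstr (word_of W)" "W = {wstr (word_of W), wstr (winv (word_of W))}"
proof -
  obtain w where w: "walk_word w" "W = {wstr w, wstr (winv w)}" using assms walks_iff by blast
  have mem: "\<sigma> \<in> W \<longleftrightarrow> \<sigma> = wstr w \<or> \<sigma> = wstr (winv w)" for \<sigma> using w(2) by simp
  have "rep W \<in> W" unfolding rep_def by (rule someI[of _ "wstr w"]) (simp add: mem)
  then have "rep W = wstr w \<or> rep W = wstr (winv w)" by (rule iffD1[OF mem])
  then show "walk_word (word_of W)" "rep W = wstr (word_of W)" "W = {wstr (word_of W), wstr (winv (word_of W))}"
  proof (atomize (full), elim disjE)
    assume 1: "rep W = wstr w"
    then have "word_of W = w" by (simp add: word_of_def)
    then show "walk_word (word_of W) \<and> rep W = wstr (word_of W) \<and> W = {wstr (word_of W), wstr (winv (word_of W))}"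
      using 1 w by simp
  next
    assume 2: "rep W = wstr (winv w)"
    then have "word_of W = winv w" by (simp add: word_of_def)
    then show "walk_word (word_of W) \<and> rep W = wstr (word_of W) \<and> W = {wstr (word_of W), wstr (winv (word_of W))}"
      using 2 w wk_winv[OF w(1)] by (simp add: insert_commute)
  qed
qed

lemma rl_inj: "W \<in> walks B \<Longrightarrow> W' \<in> walks B \<Longrightarrow> word_of W = word_of W' \<Longrightarrow> W = W'"
proof -
  assume W: "W \<in> walks B" and W': "W' \<in> walks B" and e: "word_of W = word_of W'"
  have "W = {wstr (word_of W), wstr (winv (word_of W))}" by (rule walk_rl(3)[OF W])
  also have "\<dots> = W'" unfolding e by (rule walk_rl(3)[OF W', symmetric])
  finally show "W = W'" .
qed

text \<open>Otherwise both walks would coincide and the chosen word would be its own inverse. This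
  supplies the hypothesis \<open>w \<noteq> winv u\<close> of \<open>dual_inner\<close>.\<close>

lemma rl_winv: assumes "W \<in> walks B" "W' \<in> walks B" shows "word_of W \<noteq> winv (word_of W')"
proof
  assume h: "word_of W = winv (word_of W')"
  have "W = {wstr (word_of W), wstr (winv (word_of W))}" by (rule walk_rl(3)[OF assms(1)])
  also have "\<dots> = {wstr (word_of W'), wstr (winv (word_of W'))}" unfolding h by auto
  also have "\<dots> = W'" by (rule walk_rl(3)[OF assms(2), symmetric])
  finally have "W = W'" .
  then have "winv (word_of W) = word_of W" using h by simp
  then show False using winv_neq[of "word_of W"] walk_rl(1)[OF assms(1)] by (auto simp: walk_word_def)
qed

lemma walk_of: assumes "walk_word w" obtains W b where "W \<in> walks B" "word_of W = ori b w"
proof -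
  let ?W = "{wstr w, wstr (winv w)}"
  have W: "?W \<in> walks B" using assms walks_iff by blast
  have "wstr (word_of ?W) \<in> ?W" using walk_rl(3)[OF W] by blast
  then have "word_of ?W = ori True w \<or> word_of ?W = ori False w" by auto
  then show thesis using that W by blast
qed

lemma vtx_wstr: "1 \<le> k \<Longrightarrow> vtx B (wstr w) k = pv B w k"
  by (simp add: vtx_def pv_def)

lemma top_bot_occ:
  assumes "chain w"
  shows "(if d then top_occ B (wstr w) (i, j) else bot_occ B (wstr w) (i, j)) \<longleftrightarrow> i \<le> j \<and> substring_type d w i (j - i)"
proof -
  have o: "occ B (wstr w) (i, j) \<longleftrightarrow> i \<le> j" if "0 < i" "j < length w"
    using that pv_isl[OF assms] vtx_wstr by (auto simp: occ_def)
  show ?thesis using o by (cases d) (auto simp: top_occ_def bot_occ_def substring_type_def)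
qed

text \<open>In \<open>gw\<close> the vertices without change of sign cancel, which leaves peaks and
  deeps.\<close>

lemma gvec_gv: assumes W: "W \<in> walks B" shows "gvec B W = gv (word_of W)"
proof -
  let ?w = "word_of W"
  have c: "chain ?w" using walk_rl[OF W] wk_chain by blast
  have "gvec B W $ v = gv ?w $ v" for v
  proof -
    let ?R = "{j \<in> {1..<length ?w}. pv B ?w j = Inl v}"
    have t: "{i. top_occ B (rep W) (i, i) \<and> vtx B (rep W) i = Inl v} = {j \<in> ?R. snd (?w ! j) \<and> \<not> snd (?w ! (j - 1))}"
      using top_bot_occ[OF c, of True] walk_rl(2)[OF W] vtx_wstr by (auto simp: substring_type_def)
    have b: "{i. bot_occ B (rep W) (i, i) \<and> vtx B (rep W) i = Inl v} = {j \<in> ?R. snd (?w ! (j - 1)) \<and> \<not> snd (?w ! j)}"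
      using top_bot_occ[OF c, of False] walk_rl(2)[OF W] vtx_wstr by (auto simp: substring_type_def)
    have "gv ?w $ v = (\<Sum>j=1..<length ?w. if pv B ?w j = Inl v then of_bool (snd (?w ! j)) - of_bool (snd (?w ! (j - 1))) else 0)"
      by (simp add: gv_def gw_def)
    also have "\<dots> = (\<Sum>j\<in>?R. of_bool (snd (?w ! j)) - of_bool (snd (?w ! (j - 1))))"
      by (subst sum.inter_filter) simp_all
    also have "\<dots> = gvec B W $ v"
      using sum_of_bool_diff[of ?R "\<lambda>j. snd (?w ! j)" "\<lambda>j. snd (?w ! (j - 1))"] by (simp add: gvec_def t b)
    finally show ?thesis by simp
  qed
  then show ?thesis by (simp add: vec_eq_iff)
qed

section \<open>Kisses of walks\<close>

definition sub :: "('c \<times> bool) list \<Rightarrow> nat \<Rightarrow> nat \<Rightarrow> ('c \<times> bool) list" where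
  "sub u i k = take k (drop i u)"

lemma sub_eq_iff: assumes "i + k \<le> length u" "j + k \<le> length w"
  shows "sub u i k = sub w j k \<longleftrightarrow> (\<forall>l<k. u ! (i + l) = w ! (j + l))"
  using assms by (auto simp: sub_def list_eq_iff_nth_eq)

lemma length_sub: "i + k \<le> length u \<Longrightarrow> length (sub u i k) = k"
  by (simp add: sub_def)

lemma sub_winv: assumes "i + k \<le> length w" shows "sub (winv w) i k = winv (sub w (length w - i - k) k)"
proof (rule nth_equalityI)
  show "length (sub (winv w) i k) = length (winv (sub w (length w - i - k) k))" using assms by (simp add: sub_def)
  fix l assume "l < length (sub (winv w) i k)"
  then have l: "l < k" using assms by (simp add: sub_def)
  have "length w - Suc (i + l) = length w - i - k + (k - Suc l)" using l assms by simp
  then show "sub (winv w) i k ! l = winv (sub w (length w - i - k) k) ! l"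
    using l assms by (simp add: sub_def winv_nth)
qed

lemma chain_sub: assumes "chain u" shows "chain (sub u i k)"
proof -
  have "set (sub u i k) \<subseteq> set u" unfolding sub_def by (meson order_trans set_drop_subset set_take_subset)
  moreover have "ok (sub u i k ! l) (sub u i k ! Suc l)" if "Suc l < length (sub u i k)" for l
    using assms that by (auto simp: sub_def chain_def)
  ultimately show ?thesis using assms by (auto simp: chain_def)
qed

lemma factor_wstr: "1 \<le> i \<Longrightarrow> factor B (wstr w) (i, i + k) = (pv B w i, sub w i k)"
  by (simp add: factor_def vtx_wstr sub_def)

lemma str_inv_factor:
  assumes w: "chain w" and "1 \<le> i" "i + k < length w"
  shows "str_inv B (pv B w i, sub w i k) = (pv B (winv w) (length w - i - k), sub (winv w) (length w - i - k) k)"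
proof -
  have e: "length w - (length w - i - k) - k = i" using assms by simp
  have s: "sub (winv w) (length w - i - k) k = winv (sub w i k)"
    using sub_winv[of "length w - i - k" k w] e assms by simp
  have p: "pv B (winv w) (length w - i - k) = pv B w (i + k)"
    using pv_winv[OF w, of "length w - i - k"] assms by simp
  have m: "map (\<lambda>(a, d). (a, \<not> d)) (sub w i k) = map linv (sub w i k)" by (auto simp: linv_def)
  have ls: "length (sub w i k) = k" using assms by (simp add: length_sub)
  have v: "vtx B (pv B w i, sub w i k) k = pv B w (i + k)"
    using assms by (cases k) (simp_all add: vtx_def sub_def pv_def)
  show ?thesis unfolding s p by (simp add: str_inv_def m v ls winv_def)
qed

definition kpairs :: "bool \<Rightarrow> ('c \<times> bool) list \<Rightarrow> ('c \<times> bool) list \<Rightarrow> ((nat \<times> nat) \<times> (nat \<times> nat)) set" where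
  "kpairs d w u = {((j, j'), (i, i')). j \<le> j' \<and> substring_type d w j (j' - j) \<and> i \<le> i' \<and> substring_type (\<not> d) u i (i' - i) \<and>
     same_str B (factor B (wstr w) (j, j')) (factor B (wstr u) (i, i'))}"

text \<open>Equality up to inversion becomes equality with a factor of \<open>w\<close> or of its
  inverse. No pair arises in both ways, since a nonempty word is not its own inverse.\<close>

lemma kset_kpairs:
  assumes w: "chain w" and u: "chain u"
  shows "bij_betw (\<lambda>(b, i, j, k). (if b then (j, j + k) else (length w - j - k, length w - j), (i, i + k)))
     (kiss_occs d w u) (kpairs d w u)" (is "bij_betw ?f _ _")
  unfolding bij_betw_def
proof
  let ?n = "length w"
  have kb: "1 \<le> j \<and> j + k < ?n \<and> 1 \<le> i \<and> i + k < length u \<and> sub u i k = sub (ori b w) j k" if "(b, i, j, k) \<in> kiss_occs d w u" for b i j k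
    using that sub_eq_iff[of i k u j "ori b w"] by (auto simp: kiss_occs_def substring_type_def)
  have clash: False if r: "(True, i, j, k) \<in> kiss_occs d w u" "(False, i, j', k) \<in> kiss_occs d w u" "j = ?n - j' - k" for i j j' k
  proof -
    have k: "k \<noteq> 0" using r(2) by (auto simp: kiss_occs_def)
    have "sub (winv w) j' k = winv (sub w j k)" using sub_winv[of j' k w] kb[OF r(2)] r(3) by simp
    then have "winv (sub w j k) = sub w j k" using kb[OF r(1)] kb[OF r(2)] by simp
    moreover have "length (sub w j k) = k" using kb[OF r(1)] by (simp add: length_sub)
    ultimately show False using winv_neq[OF chain_sub[OF w, of j k]] k by (metis list.size(3))
  qed
  show "inj_on ?f (kiss_occs d w u)"
  proof (rule inj_onI)
    fix r r' assume rr: "r \<in> kiss_occs d w u" "r' \<in> kiss_occs d w u" "?f r = ?f r'"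
    obtain b i j k where e: "r = (b, i, j, k)" by (cases r)
    obtain b' i' j' k' where e': "r' = (b', i', j', k')" by (cases r')
    note h = kb[OF rr(1)[unfolded e]] kb[OF rr(2)[unfolded e']]
    have ik: "i' = i" "k' = k" using rr(3) e e' by auto
    have "b = b'"
    proof (rule ccontr)
      assume ne: "b \<noteq> b'"
      show False
      proof (cases b)
        case True
        then have "j = length w - j' - k" using rr(3) ne unfolding e e' ik by simp
        moreover have "b = True" "b' = False" using True ne by auto
        ultimately show False using clash[of i j k j'] rr(1,2) unfolding e e' ik by simp
      next
        case False
        then have "j' = length w - j - k" using rr(3) ne unfolding e e' ik by simp
        moreover have "b = False" "b' = True" using False ne by auto
        ultimately show False using clash[of i j' k j] rr(1,2) unfolding e e' ik by simp
      qed
    qed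
    then show "r = r'" using rr(3) e e' ik h by (cases b') auto
  qed
  show "?f ` kiss_occs d w u = kpairs d w u"
  proof
    show "?f ` kiss_occs d w u \<subseteq> kpairs d w u"
    proof
      fix y assume "y \<in> ?f ` kiss_occs d w u"
      then obtain b i j k where r: "(b, i, j, k) \<in> kiss_occs d w u" "y = ?f (b, i, j, k)" by auto
      note h = kb[OF r(1)]
      have t: "substring_type d (ori b w) j k" "substring_type (\<not> d) u i k" "pv B u i = pv B (ori b w) j" using r by (auto simp: kiss_occs_def)
      show "y \<in> kpairs d w u"
      proof (cases b)
        case True
        then show ?thesis using r t h by (auto simp: kpairs_def same_str_def factor_wstr)
      next
        case False
        let ?j = "?n - j - k"
        have j: "1 \<le> ?j" "?j + k = ?n - j" "?n - ?j - k = j" using h by auto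
        have "str_inv B (pv B (winv w) j, sub (winv w) j k) = (pv B w ?j, sub w ?j k)"
          using str_inv_factor[OF chain_winv[OF w], of j k] h by simp
        then have "same_str B (factor B (wstr w) (?j, ?j + k)) (factor B (wstr u) (i, i + k))"
          using factor_wstr[OF j(1), of w k] factor_wstr[of i u k] h t False by (simp add: same_str_def)
        moreover have "substring_type d w ?j k" using ty_winv(1)[OF w] t False by simp
        ultimately show ?thesis using r t h False j(2) by (auto simp: kpairs_def)
      qed
    qed
    show "kpairs d w u \<subseteq> ?f ` kiss_occs d w u"
    proof
      fix y assume y: "y \<in> kpairs d w u"
      obtain j j2 i i2 where yy: "y = ((j, j2), (i, i2))" by (cases y) auto
      define k where "k = j2 - j"
      define k' where "k' = i2 - i"
      have e: "j2 = j + k" "i2 = i + k'" and tw: "substring_type d w j k" and tu: "substring_type (\<not> d) u i k'"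
        and s: "same_str B (factor B (wstr w) (j, j2)) (factor B (wstr u) (i, i2))"
        using y yy by (auto simp: kpairs_def k_def k'_def)
      have h: "1 \<le> j" "j + k < ?n" "1 \<le> i" "i + k' < length u" using tw tu by (auto simp: substring_type_def)
      have s': "(pv B w j, sub w j k) = (pv B u i, sub u i k') \<or> (pv B w j, sub w j k) = str_inv B (pv B u i, sub u i k')"
        using s factor_wstr[OF h(1), of w k] factor_wstr[OF h(3), of u k'] e by (simp add: same_str_def)
      have lw: "length (sub w j k) = k" "length (sub u i k') = k'" using h by (auto simp: length_sub)
      have kk: "k' = k" using s' lw by (auto simp: str_inv_def)
      show "y \<in> ?f ` kiss_occs d w u"
      proof (cases "(pv B w j, sub w j k) = (pv B u i, sub u i k)")
        case True
        then have "(True, i, j, k) \<in> kiss_occs d w u"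
          using tw tu kk h sub_eq_iff[of i k u j w] by (auto simp: kiss_occs_def)
        then have "?f (True, i, j, k) \<in> ?f ` kiss_occs d w u" by (rule imageI)
        then show ?thesis using yy e kk by simp
      next
        case False
        then have si: "(pv B w j, sub w j k) = str_inv B (pv B u i, sub u i k)" using s'[unfolded kk] by blast
        have k0: "k \<noteq> 0"
        proof
          assume "k = 0"
          then show False using si False by (simp add: str_inv_def sub_def vtx_def)
        qed
        let ?j = "?n - j - k"
        have j: "1 \<le> ?j" "?j + k < ?n" "?n - ?j - k = j" "?n - ?j = j + k" using h by auto
        have inv: "str_inv B (pv B w j, sub w j k) = (pv B (winv w) ?j, sub (winv w) ?j k)"
          using str_inv_factor[OF w] h by simp
        have inv2: "str_inv B (str_inv B (pv B u i, sub u i k)) = (pv B u i, sub u i k)"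
        proof -
          let ?i = "length u - i - k"
          have i: "1 \<le> ?i" "?i + k < length u" "length u - ?i - k = i" using h kk by auto
          have "str_inv B (pv B u i, sub u i k) = (pv B (winv u) ?i, sub (winv u) ?i k)"
            using str_inv_factor[OF u] h kk by simp
          then show ?thesis using str_inv_factor[OF chain_winv[OF u], of ?i k] i by simp
        qed
        have eq: "pv B u i = pv B (winv w) ?j" "sub u i k = sub (winv w) ?j k"
          using si inv inv2 by auto
        have tj: "substring_type d (winv w) ?j k" using ty_winv(1)[OF chain_winv[OF w], of d j k] tw by simp
        have "(False, i, ?j, k) \<in> kiss_occs d w u"
          using tj tu kk k0 eq sub_eq_iff[of i k u ?j "winv w"] h j by (auto simp: kiss_occs_def)
        then have "?f (False, i, ?j, k) \<in> ?f ` kiss_occs d w u" by (rule imageI)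
        then show ?thesis using yy e kk j by simp
      qed
    qed
  qed
qed

lemma same_str_sym:
  assumes "chain w" "chain u" "1 \<le> j" "j + k < length w" "1 \<le> i" "i + k' < length u"
  shows "same_str B (pv B w j, sub w j k) (pv B u i, sub u i k') \<longleftrightarrow> same_str B (pv B u i, sub u i k') (pv B w j, sub w j k)"
proof -
  have inv2: "str_inv B (str_inv B (pv B u i, sub u i k)) = (pv B u i, sub u i k)"
    if "chain u" "1 \<le> i" "i + k < length u" for u i k
  proof -
    let ?i = "length u - i - k"
    have i: "1 \<le> ?i" "?i + k < length u" "length u - ?i - k = i" using that by auto
    have "str_inv B (pv B u i, sub u i k) = (pv B (winv u) ?i, sub (winv u) ?i k)"
      using str_inv_factor[OF that] by simp
    then show ?thesis using str_inv_factor[OF chain_winv[OF that(1)], of ?i k] i by simp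
  qed
  show ?thesis using inv2[of w j k] inv2[of u i k'] assms by (auto simp: same_str_def)
qed

lemma kpairs_swap: assumes "chain w" "chain u" shows "bij_betw prod.swap (kpairs d w u) (kpairs (\<not> d) u w)"
proof -
  have "((i, i'), (j, j')) \<in> kpairs (\<not> d) u w" if "((j, j'), (i, i')) \<in> kpairs d w u" "chain w" "chain u" for j j' i i' d w u
  proof -
    have h: "j \<le> j'" "substring_type d w j (j' - j)" "i \<le> i'" "substring_type (\<not> d) u i (i' - i)"
      "same_str B (factor B (wstr w) (j, j')) (factor B (wstr u) (i, i'))" using that by (auto simp: kpairs_def)
    have e: "j' = j + (j' - j)" "i' = i + (i' - i)" using h by auto
    have "1 \<le> j" "1 \<le> i" using h by (auto simp: substring_type_def)
    then have f: "factor B (wstr w) (j, j') = (pv B w j, sub w j (j' - j))" "factor B (wstr u) (i, i') = (pv B u i, sub u i (i' - i))"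
      using factor_wstr[of j w "j' - j"] factor_wstr[of i u "i' - i"] e by auto
    show ?thesis using h same_str_sym[OF that(2,3), of j "j' - j" i "i' - i"] f by (auto simp: kpairs_def substring_type_def)
  qed
  note * = this
  have "y \<in> prod.swap ` kpairs d w u" if "y \<in> kpairs (\<not> d) u w" for y
  proof -
    have "prod.swap y \<in> kpairs d w u" using *[of _ _ _ _ "\<not> d" u w] that assms by (cases y) force
    then show ?thesis by (metis image_eqI swap_swap)
  qed
  moreover have "prod.swap ` kpairs d w u \<subseteq> kpairs (\<not> d) u w" using *[of _ _ _ _ d w u] assms by force
  ultimately show ?thesis by (auto simp: bij_betw_def)
qed

lemma kiss_set:
  assumes "W \<in> walks B" "W' \<in> walks B"
  shows "{(o1, o2). top_occ B (rep W) o1 \<and> bot_occ B (rep W') o2 \<and>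
       same_str B (factor B (rep W) o1) (factor B (rep W') o2)} = kpairs True (word_of W) (word_of W')"
proof -
  have c: "chain (word_of W)" "chain (word_of W')" using wk_chain[OF walk_rl(1)] assms by auto
  have t: "top_occ B (wstr (word_of W)) (i, j) \<longleftrightarrow> i \<le> j \<and> substring_type True (word_of W) i (j - i)" for i j
    using top_bot_occ[OF c(1), of True] by simp
  have b: "bot_occ B (wstr (word_of W')) (i, j) \<longleftrightarrow> i \<le> j \<and> substring_type False (word_of W') i (j - i)" for i j
    using top_bot_occ[OF c(2), of False] by simp
  show ?thesis unfolding walk_rl(2)[OF assms(1)] walk_rl(2)[OF assms(2)] kpairs_def
    by (rule set_eqI, clarify) (simp add: t b)
qed

text \<open>Both directions of kissing are written with the words in the same order, so that
  \<open>clo_le\<close> applies to each with the type \<open>d\<close> alone changed.\<close>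

lemma kiss_count_kset:
  assumes "W \<in> walks B" "W' \<in> walks B"
  shows "kiss_count B W W' = card (kiss_occs True (word_of W) (word_of W'))" "kiss_count B W' W = card (kiss_occs False (word_of W) (word_of W'))"
proof -
  have c: "chain (word_of W)" "chain (word_of W')" using wk_chain[OF walk_rl(1)] assms by auto
  show "kiss_count B W W' = card (kiss_occs True (word_of W) (word_of W'))"
    unfolding kiss_count_def kiss_set[OF assms] using bij_betw_same_card[OF kset_kpairs[OF c, of True]] by simp
  have "card (kiss_occs False (word_of W) (word_of W')) = card (kpairs False (word_of W) (word_of W'))"
    using bij_betw_same_card[OF kset_kpairs[OF c, of False]] .
  also have "\<dots> = card (kpairs True (word_of W') (word_of W))"
    using bij_betw_same_card[OF kpairs_swap[OF c, of False]] by simp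
  finally show "kiss_count B W' W = card (kiss_occs False (word_of W) (word_of W'))"
    unfolding kiss_count_def kiss_set[OF assms(2,1)] by simp
qed

lemma kisses_iff:
  assumes "W \<in> walks B" "W' \<in> walks B"
  shows "kisses B W W' \<longleftrightarrow> kiss_count B W W' \<noteq> 0"
proof -
  have c: "chain (word_of W)" "chain (word_of W')" using wk_chain[OF walk_rl(1)] assms by auto
  let ?P = "\<lambda>o1 o2. top_occ B (rep W) o1 \<and> bot_occ B (rep W') o2 \<and> same_str B (factor B (rep W) o1) (factor B (rep W') o2)"
  have K: "p \<in> kpairs True (word_of W) (word_of W') \<longleftrightarrow> ?P (fst p) (snd p)" for p
    unfolding kiss_set[OF assms, symmetric] by (simp add: case_prod_unfold)
  have "kisses B W W' \<longleftrightarrow> (\<exists>p. p \<in> kpairs True (word_of W) (word_of W'))"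
    unfolding kisses_def K by simp
  then have "kisses B W W' \<longleftrightarrow> kpairs True (word_of W) (word_of W') \<noteq> {}" by blast
  moreover have "finite (kpairs True (word_of W) (word_of W'))"
    using bij_betw_finite[OF kset_kpairs[OF c, of True]] finite_kset by blast
  ultimately show ?thesis unfolding kiss_count_def kiss_set[OF assms] by (simp add: card_eq_0_iff)
qed

lemma nokiss_iff:
  assumes "W \<in> walks B" "W' \<in> walks B"
  shows "nokiss (word_of W) (word_of W') \<longleftrightarrow> \<not> kisses B W W' \<and> \<not> kisses B W' W"
proof -
  have "nokiss (word_of W) (word_of W') \<longleftrightarrow> kiss_occs True (word_of W) (word_of W') = {} \<and> kiss_occs False (word_of W) (word_of W') = {}"
    unfolding nokiss_def by (simp add: all_bool_eq)
  then show ?thesis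
    unfolding kisses_iff[OF assms] kisses_iff[OF assms(2,1)] kiss_count_kset[OF assms]
    by (simp add: finite_kset)
qed

end

section \<open>Distinguished arrows and dual bases\<close>

text \<open>Pairing with \<open>c j\<close> reads off the coefficient of \<open>g j\<close>.\<close>

lemma dual_family:
  fixes g c :: "'i \<Rightarrow> 'a::euclidean_space"
  assumes fin: "finite I" and dual: "\<And>i j. i \<in> I \<Longrightarrow> j \<in> I \<Longrightarrow> inner (g i) (c j) = (if i = j then 1 else 0)"
  shows "inj_on g I" "independent (g ` I)"
    and "DIM('a) \<le> card I \<Longrightarrow> y = (\<Sum>i\<in>I. inner y (c i) *\<^sub>R g i)"
proof -
  show inj: "inj_on g I"
    by (rule inj_onI) (metis dual zero_neq_one)
  have coef: "inner (\<Sum>i\<in>I. a i *\<^sub>R g i) (c j) = a j" if "j \<in> I" for a j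
  proof -
    have "inner (\<Sum>i\<in>I. a i *\<^sub>R g i) (c j) = (\<Sum>i\<in>I. if i = j then a i else 0)"
      unfolding inner_sum_left by (rule sum.cong) (use dual that in auto)
    then show ?thesis using fin that by simp
  qed
  have sm: "(\<Sum>v\<in>g ` I. f v *\<^sub>R v) = (\<Sum>i\<in>I. f (g i) *\<^sub>R g i)" for f
    by (simp add: sum.reindex[OF inj])
  show ind: "independent (g ` I)"
  proof (rule independent_if_scalars_zero)
    show "finite (g ` I)" using fin by simp
    fix f x assume s: "(\<Sum>v\<in>g ` I. f v *\<^sub>R v) = 0" and x: "x \<in> g ` I"
    obtain j where j: "j \<in> I" "x = g j" using x by blast
    have "f (g j) = inner (\<Sum>i\<in>I. f (g i) *\<^sub>R g i) (c j)" using coef[OF j(1)] by simp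
    then show "f x = 0" using s sm j by simp
  qed
  show "y = (\<Sum>i\<in>I. inner y (c i) *\<^sub>R g i)" if d: "DIM('a) \<le> card I"
  proof -
    have "UNIV \<subseteq> span (g ` I)"
      by (rule card_ge_dim_independent) (use ind d card_image[OF inj] in \<open>auto simp: dim_UNIV\<close>)
    then have "y \<in> span (g ` I)" by blast
    then obtain u where "y = (\<Sum>v\<in>g ` I. u v *\<^sub>R v)" using fin by (auto simp: span_finite)
    then have y: "y = (\<Sum>i\<in>I. u (g i) *\<^sub>R g i)" using sm by simp
    have "(\<Sum>i\<in>I. inner y (c i) *\<^sub>R g i) = (\<Sum>i\<in>I. u (g i) *\<^sub>R g i)"
      by (rule sum.cong) (use coef y in auto)
    then show ?thesis using y by simp
  qed
qed

lemma ori_eqD: "ori b w = ori c w' \<Longrightarrow> w = w' \<or> w = winv w'"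
  by (cases b; cases c) (simp_all, metis winv_winv, metis winv_winv)

context blossom_quiver begin

section \<open>The order of marked walks at an arrow\<close>

lemma rcommon_props:
  assumes "xs ! p = ys ! q"
  shows "p + rcommon (xs, p) (ys, q) < length xs \<Longrightarrow> q + rcommon (xs, p) (ys, q) < length ys \<Longrightarrow>
      rsep xs p ys q (rcommon (xs, p) (ys, q))"
    and "rsep xs p ys q r \<Longrightarrow> rcommon (xs, p) (ys, q) = r"
proof -
  let ?Q = "\<lambda>r. \<not> (p + r < length xs \<and> q + r < length ys \<and> xs ! (p + r) = ys ! (q + r))"
  have e: "rcommon (xs, p) (ys, q) = (LEAST r. ?Q r)" by (simp add: rcommon_def)
  have ex: "?Q (length xs)" by simp
  have L: "?Q (LEAST r. ?Q r)" by (rule LeastI[of ?Q, OF ex])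
  have M: "\<not> ?Q l" if "l < (LEAST r. ?Q r)" for l using not_less_Least[OF that] .
  show "rsep xs p ys q (rcommon (xs, p) (ys, q))"
    if a: "p + rcommon (xs, p) (ys, q) < length xs" "q + rcommon (xs, p) (ys, q) < length ys"
  proof -
    have ne: "xs ! (p + (LEAST r. ?Q r)) \<noteq> ys ! (q + (LEAST r. ?Q r))" using L a e by auto
    have "(LEAST r. ?Q r) \<noteq> 0"
    proof
      assume "(LEAST r. ?Q r) = 0"
      then show False using ne assms by simp
    qed
    then have "1 \<le> (LEAST r. ?Q r)" by simp
    moreover have "\<forall>l<(LEAST r. ?Q r). xs ! (p + l) = ys ! (q + l)" using M by blast
    ultimately show ?thesis using ne a unfolding rsep_def e by blast
  qed
  show "rcommon (xs, p) (ys, q) = r" if a: "rsep xs p ys q r"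
    unfolding e
  proof (rule Least_equality)
    show "?Q r" using a by (simp add: rsep_def)
    fix l assume l: "?Q l"
    show "r \<le> l"
    proof (rule ccontr)
      assume "\<not> r \<le> l"
      then show False using a l by (auto simp: rsep_def)
    qed
  qed
qed

text \<open>\<open>lcommon\<close> counts the common letters strictly to the left of the mark,
  whereas \<open>lsep\<close> and \<open>rcommon\<close> count from the mark itself; hence the
  \<open>Suc\<close>.\<close>

lemma lcommon_props:
  assumes "xs ! p = ys ! q"
  shows "lcommon (xs, p) (ys, q) < p \<Longrightarrow> lcommon (xs, p) (ys, q) < q \<Longrightarrow>
      lsep xs p ys q (Suc (lcommon (xs, p) (ys, q)))"
    and "lsep xs p ys q r \<Longrightarrow> Suc (lcommon (xs, p) (ys, q)) = r"
proof -
  let ?Q = "\<lambda>r. \<not> (r < p \<and> r < q \<and> xs ! (p - r - 1) = ys ! (q - r - 1))"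
  have e: "lcommon (xs, p) (ys, q) = (LEAST r. ?Q r)" by (simp add: lcommon_def)
  have ex: "?Q p" by simp
  have L: "?Q (LEAST r. ?Q r)" by (rule LeastI[of ?Q, OF ex])
  have M: "\<not> ?Q l" if "l < (LEAST r. ?Q r)" for l using not_less_Least[OF that] .
  show "lsep xs p ys q (Suc (lcommon (xs, p) (ys, q)))"
    if a: "lcommon (xs, p) (ys, q) < p" "lcommon (xs, p) (ys, q) < q"
  proof -
    let ?l = "lcommon (xs, p) (ys, q)"
    have ne: "xs ! (p - ?l - 1) \<noteq> ys ! (q - ?l - 1)" using L a e by auto
    have "xs ! (p - l) = ys ! (q - l)" if "l < Suc ?l" for l
    proof (cases l)
      case 0
      then show ?thesis using assms by simp
    next
      case (Suc l')
      then have "\<not> ?Q l'" using M[of l'] that e by simp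
      then show ?thesis using Suc by simp
    qed
    then show ?thesis unfolding lsep_def using ne a by simp
  qed
  show "Suc (lcommon (xs, p) (ys, q)) = r" if a: "lsep xs p ys q r"
  proof -
    have r: "1 \<le> r" "r \<le> p" "r \<le> q" and c: "\<And>l. l < r \<Longrightarrow> xs ! (p - l) = ys ! (q - l)" and ne: "xs ! (p - r) \<noteq> ys ! (q - r)"
      using a by (auto simp: lsep_def)
    have "(LEAST r. ?Q r) = r - 1"
    proof (rule Least_equality)
      have "p - (r - 1) - 1 = p - r" "q - (r - 1) - 1 = q - r" using r by auto
      then show "?Q (r - 1)" using ne by simp
      fix l assume l: "?Q l"
      show "r - 1 \<le> l"
      proof (rule ccontr)
        assume "\<not> r - 1 \<le> l"
        then have "Suc l < r" by simp
        then have "xs ! (p - Suc l) = ys ! (q - Suc l)" "l < p" "l < q" using c r by auto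
        then show False using l by simp
      qed
    qed
    then show ?thesis using e r by simp
  qed
qed

text \<open>At a forward mark the marked walk separates from every other coherent walk by a backward
  letter on either side, which makes it the larger one.\<close>

lemma mk_cc_prec:
  assumes "walk_word xs" "walk_word ys" "coherent x xs" "marked x ys q" "xs ! p = ys ! q" "snd (ys ! q)" "p < length xs"
  shows "cc_prec (xs, p) (ys, q)"
proof -
  let ?R = "rcommon (xs, p) (ys, q)" and ?l = "lcommon (xs, p) (ys, q)"
  have sym: "rsep ys q xs p r" if "rsep xs p ys q r" for r using that by (auto simp: rsep_def)
  have syml: "lsep ys q xs p r" if "lsep xs p ys q r" for r using that by (auto simp: lsep_def)
  have c: "chain xs" "chain ys" using assms wk_chain by auto
  have "snd (xs ! (p + ?R)) \<and> \<not> snd (ys ! (q + ?R))" if "p + ?R < length xs" "q + ?R < length ys"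
    using mk_rsep[OF c(2,1) assms(4,3) sym[OF rcommon_props(1)[OF assms(5) that]]] assms(6) by simp
  moreover have "snd (xs ! (p - ?l - 1)) \<and> \<not> snd (ys ! (q - ?l - 1))" if "?l < p" "?l < q"
    using mk_lsep[OF c(2,1) assms(4,3) syml[OF lcommon_props(1)[OF assms(5) that]] assms(7)] assms(6) by simp
  ultimately show ?thesis by (simp add: cc_prec_def Let_def)
qed

lemma cc_prec_antisym:
  assumes "walk_word xs" "walk_word ys" "p < length xs" "q < length ys" "xs ! p = ys ! q"
    "cc_prec (xs, p) (ys, q)" "cc_prec (ys, q) (xs, p)"
  shows "xs = ys \<and> p = q"
proof (rule agree[OF assms(1-5)])
  have e': "ys ! q = xs ! p" using assms(5) by simp
  show "\<not> rsep xs p ys q r" for r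
  proof
    assume a: "rsep xs p ys q r"
    then have b: "rsep ys q xs p r" by (auto simp: rsep_def)
    have "p + r < length xs" "q + r < length ys" using a by (auto simp: rsep_def)
    then show False using assms(6,7) rcommon_props(2)[OF assms(5) a] rcommon_props(2)[OF e' b]
      by (simp add: cc_prec_def Let_def)
  qed
  show "\<not> lsep xs p ys q r" for r
  proof
    assume a: "lsep xs p ys q r"
    then have b: "lsep ys q xs p r" by (auto simp: lsep_def)
    have "lcommon (xs, p) (ys, q) = r - 1" "lcommon (ys, q) (xs, p) = r - 1"
      using lcommon_props(2)[OF assms(5) a] lcommon_props(2)[OF e' b] by auto
    moreover have "r - 1 < p" "r - 1 < q" using a by (auto simp: lsep_def)
    ultimately show False using assms(6,7) by (simp add: cc_prec_def Let_def)
  qed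
qed

section \<open>Coherent walks of a vector and their distinguished arrows\<close>

definition coherent_walks :: "real^'v \<Rightarrow> ('v + 'x, 'c) str set set" where
  "coherent_walks x = {W \<in> walks B. \<not> straight W \<and> coherent x (word_of W)}"

definition allstop :: "real^'v \<Rightarrow> bool" where
  "allstop x \<longleftrightarrow> (\<forall>l\<in>L. stops x l)"

lemma straight_rl: "straight W \<longleftrightarrow> (\<forall>l\<in>set (word_of W). snd l) \<or> (\<forall>l\<in>set (word_of W). \<not> snd l)"
  by (simp add: straight_def word_of_def)

lemma straight_ty: "straight W \<Longrightarrow> \<not> substring_type d (word_of W) i k"
proof
  assume s: "straight W" and t: "substring_type d (word_of W) i k"
  have "i - 1 < length (word_of W)" "i + k < length (word_of W)" using t by (auto simp: substring_type_def)
  then have "word_of W ! (i - 1) \<in> set (word_of W)" "word_of W ! (i + k) \<in> set (word_of W)" by (auto intro: nth_mem)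
  then have "snd (word_of W ! (i - 1)) = snd (word_of W ! (i + k))" using s unfolding straight_rl by blast
  then show False using t unfolding substring_type_def by blast
qed

lemma straight_coherent: "straight W \<Longrightarrow> coherent x (word_of W)"
  using straight_ty by (auto simp: coherent_def)

lemma Fx_straight: "coherent_walks x \<union> straight_walks B = {W \<in> walks B. coherent x (word_of W)}"
  using straight_coherent by (auto simp: coherent_walks_def straight_walks_def)

lemma arrow_mark:
  assumes "allstop x" "a \<in> arrs B"
  obtains W k where "W \<in> walks B" "coherent x (word_of W)" "marked x (word_of W) k" "fst (word_of W ! k) = a"
proof -
  have "stops x (a, True)" "stops x (a, False)" using assms by (auto simp: allstop_def L_def)
  then obtain w p where w: "walk_word w" "marked x w p" "w ! p = (a, True)" using greedy_walk[OF assms(2)] by blast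
  obtain W b where W: "W \<in> walks B" "word_of W = ori b w" using walk_of[OF w(1)] by blast
  have p: "p < length w" using w by (simp add: marked_def)
  have co: "coherent x (word_of W)" using mk_coherent[OF w(2)] coherent_ori[OF wk_chain[OF w(1)]] W by simp
  show thesis
  proof (cases b)
    case True
    then show thesis using that[of W p] W w co by simp
  next
    case False
    then have "marked x (word_of W) (length w - 1 - p)" using mk_winv[OF wk_chain[OF w(1)] w(2)] W by simp
    moreover have "fst (word_of W ! (length w - 1 - p)) = a"
      using W False p w by (simp add: winv_nth)
    ultimately show thesis using that W co by blast
  qed
qed

lemma orient_eq:
  assumes "W \<in> walks B"
  shows "orient B (W, k) = (ori (snd (word_of W ! k)) (word_of W), if snd (word_of W ! k) then k else length (word_of W) - 1 - k)"
proof -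
  have ne: "word_of W \<noteq> []" using walk_rl(1)[OF assms] by (simp add: walk_word_def)
  have "snd (str_inv B (rep W)) = winv (word_of W)"
    using walk_rl(2)[OF assms] str_inv_wstr[OF ne] by simp
  then show ?thesis by (simp add: orient_def word_of_def)
qed

lemma orient_props:
  assumes W: "W \<in> walks B" and k: "k < length (word_of W)"
  obtains z p where "orient B (W, k) = (z, p)" "walk_word z" "p < length z" "z ! p = (fst (word_of W ! k), True)"
    "coherent x (word_of W) \<Longrightarrow> coherent x z" "marked x (word_of W) k \<Longrightarrow> marked x z p"
    "z = ori (snd (word_of W ! k)) (word_of W)"
proof -
  let ?s = "snd (word_of W ! k)"
  let ?z = "ori ?s (word_of W)" and ?p = "if ?s then k else length (word_of W) - 1 - k"
  have w: "walk_word (word_of W)" "chain (word_of W)" using walk_rl[OF W] wk_chain by auto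
  have "?z ! ?p = (fst (word_of W ! k), True)"
    using k by (cases ?s) (auto simp: winv_nth linv_def prod_eq_iff)
  moreover have "marked x (word_of W) k \<Longrightarrow> marked x ?z ?p" using mk_winv[OF w(2)] by auto
  moreover have "?p < length ?z" using k by (cases ?s) auto
  ultimately show thesis
    using that[of ?z ?p] orient_eq[OF W, of k] wk_ori[OF w(1), of ?s] coherent_ori[OF w(2), of x ?s] by blast
qed

text \<open>A marked position dominates all coherent walks at its arrow. Conversely every arrow
  carries a mark, and antisymmetry identifies the maximum with it.\<close>

lemma dist_pos_eq:
  assumes st: "allstop x" and W: "W \<in> walks B" "coherent x (word_of W)"
  shows "dist_pos B (coherent_walks x) W = {k. marked x (word_of W) k}"
proof -
  let ?S = "{W \<in> walks B. coherent x (word_of W)}"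
  have mks: "(W', k) \<in> marks B ?S a \<longleftrightarrow> W' \<in> walks B \<and> coherent x (word_of W') \<and> k < length (word_of W') \<and> fst (word_of W' ! k) = a" for W' k a
    by (auto simp: marks_def word_of_def)
  have prec: "cc_prec (orient B (W', k')) (orient B (W1, k))"
    if h: "W1 \<in> walks B" "marked x (word_of W1) k" "W' \<in> walks B" "coherent x (word_of W')" "k' < length (word_of W')"
      "fst (word_of W' ! k') = fst (word_of W1 ! k)" for W' k' W1 k
  proof -
    have k: "k < length (word_of W1)" using h by (simp add: marked_def)
    obtain z p where z: "orient B (W1, k) = (z, p)" "walk_word z" "p < length z" "z ! p = (fst (word_of W1 ! k), True)" "marked x z p"
      using orient_props[OF h(1) k, of x] h(2) by metis
    obtain z' p' where z': "orient B (W', k') = (z', p')" "walk_word z'" "p' < length z'" "z' ! p' = (fst (word_of W' ! k'), True)" "coherent x z'"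
      using orient_props[OF h(3,5), of x] h(4) by metis
    show ?thesis unfolding z(1) z'(1)
      by (rule mk_cc_prec[OF z'(2) z(2) z'(5) z(5)]) (use z z' h in auto)
  qed
  have kA: "fst (word_of W ! k) \<in> arrs B" if "k < length (word_of W)" for k
    using chain_L[OF wk_chain[OF walk_rl(1)[OF W(1)]] that] by (simp add: L_def)
  show ?thesis
  proof (rule set_eqI, unfold mem_Collect_eq, rule iffI)
    fix k assume "k \<in> dist_pos B (coherent_walks x) W"
    then obtain a where a: "a \<in> arrs B" "(W, k) \<in> marks B ?S a"
      and mx: "\<And>m'. m' \<in> marks B ?S a \<Longrightarrow> m' \<noteq> (W, k) \<Longrightarrow> cc_prec (orient B m') (orient B (W, k))"
      unfolding dist_pos_def Fx_straight by blast
    have k: "k < length (word_of W)" "fst (word_of W ! k) = a" using a mks by auto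
    obtain W1 k1 where m: "W1 \<in> walks B" "coherent x (word_of W1)" "marked x (word_of W1) k1" "fst (word_of W1 ! k1) = a"
      using arrow_mark[OF st a(1)] by blast
    have k1: "k1 < length (word_of W1)" using m by (simp add: marked_def)
    show "marked x (word_of W) k"
    proof (cases "(W1, k1) = (W, k)")
      case True
      then show ?thesis using m by simp
    next
      case False
      have p1: "cc_prec (orient B (W1, k1)) (orient B (W, k))" using mx[of "(W1, k1)"] mks m k1 False by simp
      have p2: "cc_prec (orient B (W, k)) (orient B (W1, k1))" using prec[OF m(1,3) W k(1)] k m by simp
      obtain z p where z: "orient B (W1, k1) = (z, p)" "walk_word z" "p < length z" "z ! p = (fst (word_of W1 ! k1), True)"
        "z = ori (snd (word_of W1 ! k1)) (word_of W1)"
        using orient_props[OF m(1) k1] by metis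
      obtain z' p' where z': "orient B (W, k) = (z', p')" "walk_word z'" "p' < length z'" "z' ! p' = (fst (word_of W ! k), True)"
        "z' = ori (snd (word_of W ! k)) (word_of W)"
        using orient_props[OF W(1) k(1)] by metis
      have eq: "z = z' \<and> p = p'"
        by (rule cc_prec_antisym[OF z(2) z'(2) z(3) z'(3)]) (use z z' p1 p2 m k in auto)
      have "word_of W1 = word_of W \<and> snd (word_of W1 ! k1) = snd (word_of W ! k)"
      proof (cases "snd (word_of W1 ! k1) = snd (word_of W ! k)")
        case True
        then have "word_of W1 = word_of W" using eq z(5) z'(5) by (metis ori_def winv_winv)
        then show ?thesis using True by blast
      next
        case False
        then have "word_of W1 = winv (word_of W)" using eq z(5) z'(5) by (metis ori_def winv_winv)
        then show ?thesis using rl_winv[OF m(1) W(1)] by blast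
      qed
      then have "W1 = W" "snd (word_of W ! k1) = snd (word_of W ! k)" using rl_inj[OF m(1) W(1)] by auto
      moreover have "p = (if snd (word_of W1 ! k1) then k1 else length (word_of W1) - 1 - k1)"
        "p' = (if snd (word_of W ! k) then k else length (word_of W) - 1 - k)"
        using orient_eq[OF m(1), of k1] orient_eq[OF W(1), of k] z(1) z'(1) by auto
      ultimately have "k1 = k" using eq k(1) k1 by (auto split: if_splits)
      then show ?thesis using False \<open>W1 = W\<close> by blast
    qed
  next
    fix k assume k: "marked x (word_of W) k"
    then have kl: "k < length (word_of W)" by (simp add: marked_def)
    show "k \<in> dist_pos B (coherent_walks x) W"
      unfolding dist_pos_def Fx_straight
    proof (intro CollectI bexI conjI ballI impI)
      show "(W, k) \<in> marks B ?S (fst (word_of W ! k))" using mks W kl by simp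
      show "fst (word_of W ! k) \<in> arrs B" using kA kl by simp
      fix m' assume m': "m' \<in> marks B ?S (fst (word_of W ! k))"
      obtain W' k' where e: "m' = (W', k')" by (cases m')
      show "cc_prec (orient B m') (orient B (W, k))"
        unfolding e by (rule prec[OF W(1) k]) (use m' e mks in auto)
    qed
  qed
qed

section \<open>Counting arrows and marks\<close>

lemma card_arrs: "card (arrs B) = 2 * CARD('v) + card {a \<in> arrs B. \<not> isl (tgt B a)}"
proof -
  have e: "arrs B = (\<Union>v. {a \<in> arrs B. tgt B a = Inl v}) \<union> {a \<in> arrs B. \<not> isl (tgt B a)}"
    by (auto simp: isl_def)
  have "card (\<Union>v. {a \<in> arrs B. tgt B a = Inl v}) = (\<Sum>v\<in>UNIV. card {a \<in> arrs B. tgt B a = Inl v})"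
    by (rule card_UN_disjoint) (use finite_arrs in auto)
  also have "\<dots> = 2 * CARD('v)" by (simp add: in_two)
  finally have "card (\<Union>v. {a \<in> arrs B. tgt B a = Inl v}) = 2 * CARD('v)" .
  moreover have "card ((\<Union>v. {a \<in> arrs B. tgt B a = Inl v}) \<union> {a \<in> arrs B. \<not> isl (tgt B a)}) =
     card (\<Union>v. {a \<in> arrs B. tgt B a = Inl v}) + card {a \<in> arrs B. \<not> isl (tgt B a)}"
    by (rule card_Un_disjoint) (use finite_arrs in auto)
  ultimately show ?thesis using e by simp
qed

text \<open>Read forward, a straight walk ends with an arrow into a blossom vertex and is determined
  backwards from it. This bounds the straight walks by the second summand in
  \<open>card_arrs\<close>.\<close>

lemma straight_inj:
  obtains f where "inj_on f (straight_walks B)" "f ` straight_walks B \<subseteq> {a \<in> arrs B. \<not> isl (tgt B a)}"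
proof -
  define fw where "fw = (\<lambda>W. ori (\<forall>l\<in>set (word_of W). snd l) (word_of W))"
  have fw: "walk_word (fw W) \<and> (\<forall>k<length (fw W). snd (fw W ! k))" if "W \<in> straight_walks B" for W
  proof -
    have W: "W \<in> walks B" "straight W" using that by (auto simp: straight_walks_def)
    have "snd (fw W ! k)" if "k < length (fw W)" for k
    proof (cases "\<forall>l\<in>set (word_of W). snd l")
      case True
      then have "fw W = word_of W" by (simp add: fw_def)
      then show ?thesis using True that by simp
    next
      case False
      then have s: "\<forall>l\<in>set (word_of W). \<not> snd l" using W straight_rl by blast
      have "(\<forall>l\<in>set (word_of W). snd l) = False" using False by (rule eq_False[THEN iffD2])
      then have "fw W = winv (word_of W)" unfolding fw_def by (simp only: ori_False)
      then show ?thesis using that s by (simp add: winv_nth)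
    qed
    then show ?thesis using wk_ori[OF walk_rl(1)[OF W(1)]] by (simp add: fw_def)
  qed
  define f where "f = (\<lambda>W. fst (last (fw W)))"
  have ll: "last (fw W) = (f W, True) \<and> length (fw W) > 0" if "W \<in> straight_walks B" for W
  proof -
    have ne: "fw W \<noteq> []" using fw[OF that] by (simp add: walk_word_def)
    then have "snd (last (fw W))" using fw[OF that] by (simp add: last_conv_nth)
    then show ?thesis using ne by (simp add: f_def prod_eq_iff)
  qed
  have "inj_on f (straight_walks B)"
  proof (rule inj_onI)
    fix W W' assume W: "W \<in> straight_walks B" "W' \<in> straight_walks B" "f W = f W'"
    let ?p = "length (fw W) - 1" and ?p' = "length (fw W') - 1"
    have ne: "fw W \<noteq> []" "fw W' \<noteq> []" using ll W by auto
    have c: "chain (fw W)" "chain (fw W')" using fw W wk_chain by auto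
    have "fw W = fw W' \<and> ?p = ?p'"
    proof (rule agree)
      show "walk_word (fw W)" "walk_word (fw W')" using fw W by auto
      show p: "?p < length (fw W)" "?p' < length (fw W')" using ne by auto
      show "fw W ! ?p = fw W' ! ?p'" using ll W ne by (metis last_conv_nth)
      show "\<not> rsep (fw W) ?p (fw W') ?p' r" for r by (auto simp: rsep_def)
      show "\<not> lsep (fw W) ?p (fw W') ?p' r" for r
      proof
        assume a: "lsep (fw W) ?p (fw W') ?p' r"
        then have "1 \<le> r" "\<forall>l<r. fw W ! (?p - l) = fw W' ! (?p' - l)" unfolding lsep_def by blast+
        then have "fw W ! (?p - (r - 1)) = fw W' ! (?p' - (r - 1))" by (metis diff_less less_le_trans zero_less_one)
        then have r: "1 \<le> r" "r \<le> ?p" "r \<le> ?p'" "fw W ! (?p - (r - 1)) = fw W' ! (?p' - (r - 1))"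
          "fw W ! (?p - r) \<noteq> fw W' ! (?p' - r)" using a unfolding lsep_def by blast+
        have e: "?p - (r - 1) - 1 = ?p - r" "?p' - (r - 1) - 1 = ?p' - r" using r by auto
        have b: "1 \<le> ?p - (r - 1)" "?p - (r - 1) < length (fw W)" "1 \<le> ?p' - (r - 1)" "?p' - (r - 1) < length (fw W')"
          using r p by linarith+
        have "ok (fw W ! (?p - r)) (fw W ! (?p - (r - 1)))"
          using chain_ok[OF c(1) b(1,2)] unfolding e(1) .
        moreover have "ok (fw W' ! (?p' - r)) (fw W ! (?p - (r - 1)))"
          using chain_ok[OF c(2) b(3,4)] unfolding e(2) r(4) .
        moreover have "snd (fw W ! (?p - r))" "snd (fw W' ! (?p' - r))"
          using fw[OF W(1)] fw[OF W(2)] p by (metis less_imp_diff_less)+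
        ultimately show False using ok_unique_left r(5) by blast
      qed
    qed
    then have "word_of W = word_of W' \<or> word_of W = winv (word_of W')" unfolding fw_def by (intro ori_eqD) (rule conjunct1)
    moreover have "W \<in> walks B" "W' \<in> walks B" using W by (auto simp: straight_walks_def)
    ultimately show "W = W'" using rl_winv[of W W'] rl_inj[of W W'] by blast
  qed
  moreover have "f ` straight_walks B \<subseteq> {a \<in> arrs B. \<not> isl (tgt B a)}"
  proof
    fix a assume "a \<in> f ` straight_walks B"
    then obtain W where W: "W \<in> straight_walks B" "a = f W" by blast
    have "\<not> isl (ltgt B (last (fw W)))" "last (fw W) \<in> L"
      using fw[OF W(1)] by (auto simp: walk_word_def chain_def)
    then show "a \<in> {a \<in> arrs B. \<not> isl (tgt B a)}" using ll[OF W(1)] W by (simp add: L_def)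
  qed
  ultimately show thesis using that by blast
qed

text \<open>Every arrow carries a mark, and a walk has at most one mark of each sign.\<close>

lemma card_Fx_ge:
  assumes st: "allstop x" and fin: "finite (coherent_walks x)"
  shows "CARD('v) \<le> card (coherent_walks x)"
proof -
  have "\<exists>W k. W \<in> walks B \<and> coherent x (word_of W) \<and> marked x (word_of W) k \<and> fst (word_of W ! k) = a" if "a \<in> arrs B" for a
    using arrow_mark[OF st that] by metis
  then obtain Wf kf where m: "\<And>a. a \<in> arrs B \<Longrightarrow> Wf a \<in> walks B \<and> coherent x (word_of (Wf a)) \<and> marked x (word_of (Wf a)) (kf a) \<and>
      fst (word_of (Wf a) ! kf a) = a" by metis
  define h where "h = (\<lambda>a. (Wf a, snd (word_of (Wf a) ! kf a)))"
  have inj: "inj_on h (arrs B)"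
  proof (rule inj_onI)
    fix a b assume ab: "a \<in> arrs B" "b \<in> arrs B" "h a = h b"
    then have e: "Wf a = Wf b" "snd (word_of (Wf a) ! kf a) = snd (word_of (Wf a) ! kf b)" by (auto simp: h_def)
    then have "kf a = kf b" using mk_unique[of x "word_of (Wf a)" "kf a" "kf b"] m[OF ab(1)] m[OF ab(2)] by simp
    then show "a = b" using m[OF ab(1)] m[OF ab(2)] e by metis
  qed
  let ?St = "straight_walks B"
  obtain f where f: "inj_on f ?St" "f ` ?St \<subseteq> {a \<in> arrs B. \<not> isl (tgt B a)}" using straight_inj by blast
  have finO: "finite {a \<in> arrs B. \<not> isl (tgt B a)}" using finite_arrs by simp
  have finS: "finite ?St" using finite_imageD[OF _ f(1)] f(2) finO finite_subset by blast
  have cS: "card ?St \<le> card {a \<in> arrs B. \<not> isl (tgt B a)}" using card_inj_on_le[OF f finO] .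
  \<comment> \<open>A bending walk accounts for at most two marks, a straight one for at most one
    because its letters have a single sign. Comparison with \<open>card_arrs\<close> leaves
    \<open>2 * CARD('v) \<le> 2 * card (coherent_walks x)\<close>.\<close>
  let ?T = "coherent_walks x \<times> (UNIV :: bool set) \<union> (\<lambda>W. (W, snd (hd (word_of W)))) ` ?St"
  have "h ` arrs B \<subseteq> ?T"
  proof
    fix y assume "y \<in> h ` arrs B"
    then obtain a where a: "a \<in> arrs B" "y = h a" by blast
    note ma = m[OF a(1)]
    show "y \<in> ?T"
    proof (cases "straight (Wf a)")
      case False
      then show ?thesis using a ma by (auto simp: h_def coherent_walks_def)
    next
      case True
      have k: "kf a < length (word_of (Wf a))" using ma by (simp add: marked_def)
      then have "word_of (Wf a) ! kf a \<in> set (word_of (Wf a))" "hd (word_of (Wf a)) \<in> set (word_of (Wf a))" by (auto intro: hd_in_set)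
      then have "snd (word_of (Wf a) ! kf a) = snd (hd (word_of (Wf a)))" using True straight_rl by metis
      moreover have "Wf a \<in> ?St" using True ma by (simp add: straight_walks_def)
      ultimately show ?thesis using a by (auto simp: h_def)
    qed
  qed
  then have "card (arrs B) \<le> card ?T" using fin finS by (intro card_inj_on_le[OF inj]) auto
  also have "\<dots> \<le> card (coherent_walks x \<times> (UNIV :: bool set)) + card ((\<lambda>W. (W, snd (hd (word_of W)))) ` ?St)"
    by (rule card_Un_le)
  also have "\<dots> \<le> 2 * card (coherent_walks x) + card ?St"
    using card_image_le[OF finS, of "\<lambda>W. (W, snd (hd (word_of W)))"] by (simp add: card_cartesian_product)
  finally show ?thesis using cS card_arrs by simp
qed

text \<open>A bending word has letters of both signs, hence exactly one mark of each. The sign of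
  the right mark is the type of the string between them and the sign of the c-vector.\<close>

lemma Fx_marks:
  assumes st: "allstop x" and W: "W \<in> coherent_walks x"
  obtains k1 k2 d where "marked x (word_of W) k1" "marked x (word_of W) k2" "k1 < k2" "snd (word_of W ! k1) = (\<not> d)" "snd (word_of W ! k2) = d"
    "cvec B (coherent_walks x) W = sg d *\<^sub>R mv (word_of W) {Suc k1..k2}"
proof -
  let ?w = "word_of W"
  have Ww: "W \<in> walks B" "\<not> straight W" "coherent x ?w" using W by (auto simp: coherent_walks_def)
  obtain q1 q2 where "q1 < length ?w" "snd (?w ! q1)" "q2 < length ?w" "\<not> snd (?w ! q2)"
    using Ww(2) unfolding straight_rl by (metis in_set_conv_nth)
  then obtain a b where ab: "marked x ?w a" "snd (?w ! a) = True" "marked x ?w b" "snd (?w ! b) = False"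
    using mk_exists[OF Ww(3)] by metis
  have all: "k = a \<or> k = b" if "marked x ?w k" for k
    using mk_unique[OF that ab(1)] mk_unique[OF that ab(3)] ab by (cases "snd (?w ! k)") auto
  have dp: "dist_pos B (coherent_walks x) W = {a, b}" using dist_pos_eq[OF st Ww(1,3)] ab all by auto
  have ne: "a \<noteq> b" using ab by auto
  define k1 where "k1 = min a b"
  define k2 where "k2 = max a b"
  define d where "d = snd (?w ! k2)"
  have k12: "k1 < k2" "marked x ?w k1" "marked x ?w k2" "snd (?w ! k1) = (\<not> d)" "snd (?w ! k2) = d"
    using ne ab unfolding k1_def k2_def d_def by (auto simp: min_def max_def)
  have mm: "Min (dist_pos B (coherent_walks x) W) = k1" "Max (dist_pos B (coherent_walks x) W) = k2"
    unfolding dp k1_def k2_def by simp_all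
  have "{i. k1 < i \<and> i \<le> k2 \<and> vtx B (rep W) i = Inl v} = {i \<in> {Suc k1..k2}. pv B ?w i = Inl v}" for v
    using walk_rl(2)[OF Ww(1)] vtx_wstr by auto
  then have "cvec B (coherent_walks x) W = sg d *\<^sub>R mv ?w {Suc k1..k2}"
    using k12(4,5) unfolding cvec_def Let_def mm word_of_def[symmetric] by (cases d) (auto simp: mv_def sg_def)
  then show thesis using that k12 by blast
qed

lemma Fx_dual:
  assumes st: "allstop x" and W: "W \<in> coherent_walks x" "W' \<in> coherent_walks x"
  shows "inner (gvec B W) (cvec B (coherent_walks x) W') = (if W = W' then 1 else 0)"
proof -
  obtain k1 k2 d where k: "marked x (word_of W') k1" "marked x (word_of W') k2" "k1 < k2" "snd (word_of W' ! k1) = (\<not> d)" "snd (word_of W' ! k2) = d"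
    "cvec B (coherent_walks x) W' = sg d *\<^sub>R mv (word_of W') {Suc k1..k2}" using Fx_marks[OF st W(2)] by blast
  have w: "W \<in> walks B" "W' \<in> walks B" "coherent x (word_of W)" using W by (auto simp: coherent_walks_def)
  have "inner (gvec B W) (cvec B (coherent_walks x) W') = sg d * inner (gv (word_of W)) (mv (word_of W') {Suc k1..k2})"
    using k(6) gvec_gv[OF w(1)] by simp
  also have "\<dots> = (if word_of W = word_of W' then 1 else 0)"
    by (rule dual_inner[OF walk_rl(1)[OF w(2)] walk_rl(1)[OF w(1)] w(3) k(1-5) rl_winv[OF w(1,2)]])
  finally show ?thesis using rl_inj[OF w(1,2)] by auto
qed

text \<open>The distinguished string is a top or a bottom substring, so coherence gives the sign. By
  duality these numbers are the coordinates of \<open>x\<close> with respect to the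
  g-vectors.\<close>

lemma Fx_nonneg:
  assumes st: "allstop x" and W: "W \<in> coherent_walks x"
  shows "0 \<le> inner x (cvec B (coherent_walks x) W)"
proof -
  obtain k1 k2 d where k: "marked x (word_of W) k1" "marked x (word_of W) k2" "k1 < k2" "snd (word_of W ! k1) = (\<not> d)" "snd (word_of W ! k2) = d"
    "cvec B (coherent_walks x) W = sg d *\<^sub>R mv (word_of W) {Suc k1..k2}" using Fx_marks[OF st W] by blast
  have "coherent x (word_of W)" using W by (simp add: coherent_walks_def)
  moreover have "k2 < length (word_of W)" using k by (simp add: marked_def)
  ultimately have "(\<not> snd (word_of W ! k1) \<and> snd (word_of W ! k2) \<longrightarrow> T x (word_of W) k1 \<le> T x (word_of W) k2) \<and>
      (snd (word_of W ! k1) \<and> \<not> snd (word_of W ! k2) \<longrightarrow> T x (word_of W) k2 < T x (word_of W) k1)"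
    using k(3) unfolding coherent_T by blast
  then show ?thesis using k(4-6) inner_T'[OF k(3), of x "word_of W"] by (cases d) (auto simp: sg_def)
qed

end

section \<open>Completeness of the fan\<close>

text \<open>Coordinates are rounded down to multiples of \<open>1 / K\<close>, with \<open>K\<close>
  so large that the errors add up to less than the radius. Integrality after scaling is what the
  periodicity argument requires.\<close>

lemma rational_point:
  fixes U :: "(real^'n) set"
  assumes "open U" "U \<noteq> {}"
  obtains z and q :: real where "z \<in> U" "0 < q" "\<And>v. (q *\<^sub>R z) $ v \<in> \<int>"
proof -
  obtain z0 where z0: "z0 \<in> U" using assms by blast
  obtain e where e: "0 < e" "ball z0 e \<subseteq> U" using assms(1) z0 openE by blast
  obtain K :: nat where K: "real CARD('n) / e < real K" using reals_Archimedean2 by blast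
  have cn: "0 < real CARD('n)" by simp
  then have "0 < real CARD('n) / e" using e(1) by (rule divide_pos_pos)
  then have K0: "0 < real K" using K by linarith
  define z where "z = (\<chi> v. of_int \<lfloor>real K * z0 $ v\<rfloor> / real K)"
  have c: "\<bar>(z - z0) $ v\<bar> \<le> 1 / real K" for v
  proof -
    have "(z - z0) $ v = (of_int \<lfloor>real K * z0 $ v\<rfloor> - real K * z0 $ v) / real K"
      using K0 by (simp add: z_def field_simps)
    moreover have "\<bar>of_int \<lfloor>real K * z0 $ v\<rfloor> - real K * z0 $ v\<bar> \<le> 1" by linarith
    ultimately show ?thesis using K0 by (simp add: divide_right_mono)
  qed
  have "norm (z - z0) \<le> (\<Sum>v\<in>UNIV. \<bar>(z - z0) $ v\<bar>)" by (rule norm_le_l1_cart)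
  also have "\<dots> \<le> (\<Sum>v\<in>(UNIV :: 'n set). 1 / real K)" by (rule sum_mono) (rule c)
  also have "\<dots> = real CARD('n) / real K" by simp
  also have "\<dots> < e" using K K0 e by (simp add: field_simps)
  finally have "z \<in> U" using e(2) by (auto simp: dist_norm norm_minus_commute)
  moreover have "(real K *\<^sub>R z) $ v \<in> \<int>" for v using K0 by (simp add: z_def)
  ultimately show thesis using that K0 by blast
qed

text \<open>A proper subspace is closed with empty interior, and both properties pass to finite
  unions.\<close>

lemma avoid_subspaces:
  fixes U :: "'a::euclidean_space set"
  assumes "finite I" "open U" "U \<noteq> {}" "\<And>S. S \<in> I \<Longrightarrow> subspace S \<and> dim S < DIM('a)"
  obtains y where "y \<in> U" "\<And>S. S \<in> I \<Longrightarrow> y \<notin> S"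
proof -
  have "closed (\<Union>I) \<and> interior (\<Union>I) = {}" using assms(1,4)
  proof (induction I rule: finite_induct)
    case (insert S I)
    have "closed S" "interior S = {}" using insert.prems closed_subspace empty_interior_lowdim by blast+
    then show ?case using insert interior_closed_Un_empty_interior[of S "\<Union>I"] by auto
  qed simp
  then have "\<not> U \<subseteq> \<Union>I" using assms(2,3) interior_maximal by blast
  then show thesis using that by blast
qed

lemma orthogonal_span:
  assumes "u \<in> span S" "\<And>u. u \<in> S \<Longrightarrow> inner u m = 0"
  shows "inner u m = 0"
  using assms(1) by (induction rule: span_induct_alt) (simp_all add: inner_add_left assms(2))

locale finite_blossom_quiver = blossom_quiver B
  for B :: "('v::finite + 'x, 'c) bquiver" +
  assumes finite_nk: "finite (nk_complex B)"
begin

abbreviation g :: "('v + 'x, 'c) str set \<Rightarrow> real^'v" where "g \<equiv> gvec B"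

lemma finite_bend: "finite {W \<in> nsk_walks B. \<not> straight W}"
proof -
  have "(\<lambda>W. {W}) ` {W \<in> nsk_walks B. \<not> straight W} \<subseteq> nk_complex B" by (auto simp: nk_complex_def)
  then have "finite ((\<lambda>W. {W}) ` {W \<in> nsk_walks B. \<not> straight W})" using finite_nk finite_subset by blast
  then show ?thesis by (rule finite_imageD) simp
qed

lemma nkD:
  assumes "F \<in> nk_complex B"
  shows "finite F" "\<And>W. W \<in> F \<Longrightarrow> W \<in> walks B \<and> \<not> straight W \<and> W \<in> nsk_walks B"
    "\<And>W W'. W \<in> F \<Longrightarrow> W' \<in> F \<Longrightarrow> nokiss (word_of W) (word_of W')"
proof -
  have sub: "F \<subseteq> {W \<in> nsk_walks B. \<not> straight W}" using assms by (simp add: nk_complex_def)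
  show "finite F" using sub finite_bend finite_subset by blast
  show w: "\<And>W. W \<in> F \<Longrightarrow> W \<in> walks B \<and> \<not> straight W \<and> W \<in> nsk_walks B"
    using sub by (auto simp: nsk_walks_def)
  show "nokiss (word_of W) (word_of W')" if "W \<in> F" "W' \<in> F" for W W'
  proof -
    have "\<not> kisses B W W' \<and> \<not> kisses B W' W"
      using assms that w[OF that(1)] by (cases "W = W'") (auto simp: nk_complex_def nsk_walks_def)
    then show ?thesis using nokiss_iff w that by blast
  qed
qed

lemma nkI:
  assumes "\<And>W. W \<in> F \<Longrightarrow> W \<in> walks B \<and> \<not> straight W" "\<And>W W'. W \<in> F \<Longrightarrow> W' \<in> F \<Longrightarrow> nokiss (word_of W) (word_of W')"
  shows "F \<in> nk_complex B"
  using assms nokiss_iff by (auto simp: nk_complex_def nsk_walks_def)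

lemma Fx_nk: "coherent_walks x \<in> nk_complex B"
proof (rule nkI)
  show "W \<in> walks B \<and> \<not> straight W" if "W \<in> coherent_walks x" for W using that by (simp add: coherent_walks_def)
  show "nokiss (word_of W) (word_of W')" if "W \<in> coherent_walks x" "W' \<in> coherent_walks x" for W W'
    using that coherent_nokiss[OF wk_chain[OF walk_rl(1)]] by (auto simp: coherent_walks_def)
qed

text \<open>Before completeness, these are the faces whose g-vectors are known to form a basis;
  afterwards every facet turns out to be one of them.\<close>

definition good :: "('v + 'x, 'c) str set set \<Rightarrow> bool" where
  "good F \<longleftrightarrow> (\<exists>x. allstop x \<and> F = coherent_walks x)"

lemma good_nk: "good F \<Longrightarrow> F \<in> nk_complex B"
  using Fx_nk by (auto simp: good_def)

lemma good_dual:
  assumes "good F" "W \<in> F" "W' \<in> F"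
  shows "inner (g W) (cvec B F W') = (if W = W' then 1 else 0)"
proof -
  obtain x where x: "allstop x" "F = coherent_walks x" using assms(1) by (auto simp: good_def)
  show ?thesis using Fx_dual[OF x(1)] assms(2,3) unfolding x(2) by blast
qed

text \<open>Counting arrows provides enough walks, and the c-vectors make their g-vectors
  independent.\<close>

lemma good_basis:
  assumes F: "good F"
  shows "inj_on g F" "independent (g ` F)" "card F = CARD('v)"
    "y = (\<Sum>W\<in>F. inner y (cvec B F W) *\<^sub>R g W)" "span (g ` F) = UNIV"
proof -
  have fin: "finite F" using nkD(1)[OF good_nk[OF F]] .
  note df = dual_family[of F g "cvec B F", OF fin good_dual[OF F]]
  show inj: "inj_on g F" and ind: "independent (g ` F)" using df by auto
  have ge: "CARD('v) \<le> card F" using F card_Fx_ge fin by (auto simp: good_def)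
  have "card (g ` F) \<le> DIM(real^'v)" using independent_bound[OF ind] by simp
  then show "card F = CARD('v)" using ge card_image[OF inj] by simp
  show e: "y = (\<Sum>W\<in>F. inner y (cvec B F W) *\<^sub>R g W)" for y using df(3)[of y] ge by simp
  have "y \<in> span (g ` F)" for y
    by (subst e[of y]) (intro span_sum span_scale span_base imageI)
  then show "span (g ` F) = UNIV" by blast
qed

text \<open>Coefficients are indexed by walks rather than by vectors, because injectivity of
  \<open>g\<close> on an arbitrary face is established only later.\<close>

definition K :: "('v + 'x, 'c) str set set \<Rightarrow> (real^'v) set" where
  "K F = {y. \<exists>a. (\<forall>W\<in>F. 0 \<le> a W) \<and> y = (\<Sum>W\<in>F. a W *\<^sub>R g W)}"

definition covered :: "(real^'v) set" where
  "covered = \<Union>(K ` {F. good F})"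

text \<open>The coefficients are the pairings with the c-vectors; in this description the cone is
  visibly closed.\<close>

lemma K_dual:
  assumes F: "good F"
  shows "K F = {y. \<forall>W\<in>F. 0 \<le> inner y (cvec B F W)}"
proof -
  have fin: "finite F" using nkD(1)[OF good_nk[OF F]] .
  have "inner (\<Sum>W\<in>F. a W *\<^sub>R g W) (cvec B F W') = a W'" if "W' \<in> F" for a W'
  proof -
    have "inner (\<Sum>W\<in>F. a W *\<^sub>R g W) (cvec B F W') = (\<Sum>W\<in>F. if W = W' then a W else 0)"
      unfolding inner_sum_left by (rule sum.cong) (use good_dual[OF F _ that] in auto)
    then show ?thesis using fin that by simp
  qed
  then have "K F \<subseteq> {y. \<forall>W\<in>F. 0 \<le> inner y (cvec B F W)}" unfolding K_def by auto
  moreover have "{y. \<forall>W\<in>F. 0 \<le> inner y (cvec B F W)} \<subseteq> K F"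
  proof
    fix y assume "y \<in> {y. \<forall>W\<in>F. 0 \<le> inner y (cvec B F W)}"
    then show "y \<in> K F" unfolding K_def
      by (intro CollectI exI[of _ "\<lambda>W. inner y (cvec B F W)"] conjI good_basis(4)[OF F]) simp
  qed
  ultimately show ?thesis by blast
qed

lemma closed_GG: "closed covered"
  unfolding covered_def
proof (rule closed_Union)
  have "{F. good F} \<subseteq> nk_complex B" using good_nk by blast
  then show "finite (K ` {F. good F})" using finite_nk finite_subset by blast
  show "\<forall>S\<in>K ` {F. good F}. closed S"
  proof
    fix S assume "S \<in> K ` {F. good F}"
    then obtain F where F: "good F" "S = K F" by blast
    have "S = (\<Inter>W\<in>F. {y. 0 \<le> inner (cvec B F W) y})" unfolding F(2) K_dual[OF F(1)] by (auto simp: inner_commute)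
    then show "closed S" by (simp add: closed_INT closed_halfspace_ge)
  qed
qed

lemma allstop_GG: "allstop x \<Longrightarrow> x \<in> covered"
proof -
  assume st: "allstop x"
  then have F: "good (coherent_walks x)" by (auto simp: good_def)
  have "x \<in> K (coherent_walks x)" unfolding K_dual[OF F] using Fx_nonneg[OF st] by blast
  then show ?thesis using F by (auto simp: covered_def)
qed

lemma GG_scale: assumes "q *\<^sub>R z \<in> covered" "0 < q" shows "z \<in> covered"
proof -
  obtain F where F: "good F" "q *\<^sub>R z \<in> K F" using assms(1) by (auto simp: covered_def)
  have "z \<in> K F" using F(2) assms(2) unfolding K_dual[OF F(1)] by (auto simp: zero_le_mult_iff)
  then show ?thesis using F(1) by (auto simp: covered_def)
qed

lemma strict_scale: "0 < q \<Longrightarrow> strict (q *\<^sub>R z) w \<longleftrightarrow> strict z w"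
  unfolding strict_def by (simp add: zero_less_mult_iff mult.left_commute)

lemma strict_open: "open {z. strict z w}"
proof -
  let ?A = "{(d, i, k). substring_type d w i k}"
  have fin: "finite ?A"
    by (rule finite_subset[of _ "UNIV \<times> {..length w} \<times> {..length w}"]) (auto simp: substring_type_def)
  have "{z. strict z w} = (\<Inter>(d, i, k)\<in>?A. {z. 0 < sg d * inner z (mv w {i..i + k})})"
    by (auto simp: strict_def)
  moreover have "open {z. 0 < sg d * inner z (mv w {i..i + k})}" for d i k
    by (intro open_Collect_less continuous_intros)
  ultimately show ?thesis using fin by (auto intro!: open_INT)
qed

text \<open>As \<open>covered\<close> is closed, an uncovered \<open>z\<close> has uncovered points
  nearby that are integral up to scaling. If a greedy word failed to stop for such a point, a
  nonzero vector would be orthogonal to the point and to the g-vectors of \<open>F0\<close>, which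
  together span the space.\<close>

lemma near_GG:
  assumes F: "good F" and F0: "F0 \<subseteq> F" and cd: "CARD('v) \<le> Suc (card F0)"
    and z: "\<And>W. W \<in> F0 \<Longrightarrow> strict z (word_of W)" "z \<notin> span (g ` F0) \<or> F0 = F"
  shows "z \<in> covered"
proof (rule ccontr)
  assume nz: "z \<notin> covered"
  have fin: "finite F" "finite F0" using nkD(1)[OF good_nk[OF F]] F0 finite_subset by auto
  define U where "U = ({z. \<forall>W\<in>F0. strict z (word_of W)} \<inter> (if F0 = F then UNIV else - span (g ` F0))) - covered"
  have op: "open {z. \<forall>W\<in>F0. strict z (word_of W)}"
  proof -
    have "{z. \<forall>W\<in>F0. strict z (word_of W)} = (\<Inter>W\<in>F0. {z. strict z (word_of W)})" by blast
    then show ?thesis using fin strict_open by (auto intro!: open_INT)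
  qed
  have "closed (span (g ` F0))" by (simp add: closed_subspace)
  then have "open U" unfolding U_def using op closed_GG by (auto intro!: open_Diff open_Int)
  moreover have "z \<in> U" using z nz by (auto simp: U_def)
  ultimately obtain y q where y: "y \<in> U" "0 < q" "\<And>v. (q *\<^sub>R y) $ v \<in> \<int>" using rational_point[of U] by blast
  have st: "strict (q *\<^sub>R y) (word_of W)" if "W \<in> F0" for W using y that strict_scale by (auto simp: U_def)
  have "allstop (q *\<^sub>R y)"
  proof (rule ccontr)
    assume "\<not> allstop (q *\<^sub>R y)"
    then obtain l where "l \<in> L" "\<not> stops (q *\<^sub>R y) l" by (auto simp: allstop_def)
    then obtain m :: "real^'v" where m: "m \<noteq> 0" "inner (q *\<^sub>R y) m = 0"
      "\<And>w. walk_word w \<Longrightarrow> coherent (q *\<^sub>R y) w \<Longrightarrow> inner (gv w) m = 0"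
      using nonstop_vector[of l "q *\<^sub>R y"] y(3) by blast
    have gm: "inner (g W) m = 0" if "W \<in> F0" for W
    proof -
      have W: "W \<in> walks B" using nkD(2)[OF good_nk[OF F]] that F0 by blast
      show ?thesis using m(3)[OF walk_rl(1)[OF W] strict_coherent[OF st[OF that]]] gvec_gv[OF W] by simp
    qed
    let ?S = "insert y (g ` F0)"
    have "span ?S = UNIV"
    proof (cases "F0 = F")
      case True
      then show ?thesis using good_basis(5)[OF F] span_mono[of "g ` F0" ?S] by blast
    next
      case False
      then have ny: "y \<notin> span (g ` F0)" using y(1) by (auto simp: U_def)
      have ind: "independent ?S"
        using independent_insertI[OF ny] independent_mono[OF good_basis(2)[OF F]] F0 by blast
      have "card ?S = Suc (card F0)"
        using ny fin span_base[of y] card_image[OF inj_on_subset[OF good_basis(1)[OF F] F0]] by (metis card_insert_disjoint finite_imageI)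
      then have "UNIV \<subseteq> span ?S" by (intro card_ge_dim_independent) (use ind cd in \<open>auto simp: dim_UNIV\<close>)
      then show ?thesis by blast
    qed
    then have "m \<in> span ?S" by simp
    moreover have "inner u m = 0" if "u \<in> ?S" for u using that gm m(2) y(2) by auto
    ultimately have "inner m m = 0" using orthogonal_span by blast
    then show False using m(1) by simp
  qed
  then have "y \<in> covered" using allstop_GG GG_scale y(2) by blast
  then show False using y(1) by (simp add: U_def)
qed

lemma K_strict:
  assumes F: "F \<in> nk_complex B" and a: "\<And>W. W \<in> F \<Longrightarrow> 0 \<le> a W" and W: "W \<in> F" "0 < a W"
  shows "strict (\<Sum>W\<in>F. a W *\<^sub>R g W) (word_of W)"
    and "\<And>W' d i k. W' \<in> F \<Longrightarrow> substring_type d (word_of W') i k \<Longrightarrow> 0 \<le> sg d * inner (\<Sum>W\<in>F. a W *\<^sub>R g W) (mv (word_of W') {i..i + k})"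
proof -
  have inj: "inj_on word_of F" by (rule inj_onI) (use nkD(2)[OF F] rl_inj in blast)
  define a' where "a' = (\<lambda>w. a (the_inv_into F word_of w))"
  have a': "a' (word_of W) = a W" if "W \<in> F" for W using the_inv_into_f_f[OF inj that] by (simp add: a'_def)
  have e: "(\<Sum>W\<in>F. a W *\<^sub>R g W) = (\<Sum>w\<in>word_of ` F. a' w *\<^sub>R gv w)"
    by (simp add: sum.reindex[OF inj]) (rule sum.cong, use a' gvec_gv nkD(2)[OF F] in auto)
  have ge: "a W' \<le> sg d * inner (\<Sum>W\<in>F. a W *\<^sub>R g W) (mv (word_of W') {i..i + k})" if "W' \<in> F" "substring_type d (word_of W') i k" for W' d i k
    unfolding e a'[OF that(1), symmetric]
    by (rule sum_inner_ge) (use nkD[OF F] walk_rl(1) a a' that in auto)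
  show "strict (\<Sum>W\<in>F. a W *\<^sub>R g W) (word_of W)"
    unfolding strict_def using ge[OF W(1)] W(2) by (meson less_le_trans)
  show "0 \<le> sg d * inner (\<Sum>W\<in>F. a W *\<^sub>R g W) (mv (word_of W') {i..i + k})" if "W' \<in> F" "substring_type d (word_of W') i k" for W' d i k
    using ge[OF that] a[OF that(1)] by linarith
qed

text \<open>A generic segment leaves the closed union of cones through a face of codimension at most one. Near
  such a point an obstruction to termination would be orthogonal to that face and to a vector
  outside its span.\<close>

lemma complete: "covered = UNIV"
proof (rule ccontr)
  assume "covered \<noteq> UNIV"
  then obtain x where x: "x \<notin> covered" by blast
  let ?n = "CARD('v)"
  let ?U = "{y :: real^'v. \<forall>v. 0 < y $ v}"
  have oU: "open ?U"
  proof -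
    have "?U = (\<Inter>v. {y. 0 < y $ v})" by blast
    moreover have "open {y :: real^'v. 0 < y $ v}" for v by (intro open_Collect_less continuous_intros)
    ultimately show ?thesis by auto
  qed
  have neU: "?U \<noteq> {}"
  proof -
    have "(\<chi> v. 1) \<in> ?U" by simp
    then show ?thesis by blast
  qed
  have UG: "y \<in> covered" if "y \<in> ?U" for y
    by (rule allstop_GG) (use stops_positive that in \<open>auto simp: allstop_def\<close>)
  \<comment> \<open>Proper subspaces to be avoided by the starting point \<open>y\<close>. The first
    family keeps the segment, short of \<open>x\<close>, away from faces of codimension at least
    two; the second makes it cross walls transversally.\<close>
  define I where "I = {span (insert x (g ` F0)) |F0. (\<exists>F. good F \<and> F0 \<subseteq> F) \<and> Suc (Suc (card F0)) \<le> ?n} \<union>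
      {span (g ` F0) |F0. (\<exists>F. good F \<and> F0 \<subseteq> F) \<and> Suc (card F0) \<le> ?n}"
  have fF0: "finite {F0. \<exists>F. good F \<and> F0 \<subseteq> F}"
  proof -
    have "{F0. \<exists>F. good F \<and> F0 \<subseteq> F} \<subseteq> Pow {W \<in> nsk_walks B. \<not> straight W}"
      using good_nk by (fastforce simp: nk_complex_def)
    then show ?thesis using finite_bend finite_subset by blast
  qed
  have finI: "finite I"
  proof -
    have "I \<subseteq> (\<lambda>F0. span (insert x (g ` F0))) ` {F0. \<exists>F. good F \<and> F0 \<subseteq> F} \<union> (\<lambda>F0. span (g ` F0)) ` {F0. \<exists>F. good F \<and> F0 \<subseteq> F}"
      unfolding I_def by blast
    then show ?thesis using fF0 finite_subset by blast
  qed
  have subI: "subspace S \<and> dim S < DIM(real^'v)" if S: "S \<in> I" for S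
  proof -
    have fin: "finite F0" if "good F" "F0 \<subseteq> F" for F F0 using that nkD(1)[OF good_nk] finite_subset by blast
    consider F F0 where "S = span (insert x (g ` F0))" "good F" "F0 \<subseteq> F" "Suc (Suc (card F0)) \<le> ?n"
      | F F0 where "S = span (g ` F0)" "good F" "F0 \<subseteq> F" "Suc (card F0) \<le> ?n" using S unfolding I_def by blast
    then show ?thesis
    proof cases
      case 1
      have f: "finite F0" using fin 1 by blast
      have "dim S \<le> card (insert x (g ` F0))" unfolding 1(1) dim_span by (rule dim_le_card') (use f in simp)
      also have "\<dots> \<le> Suc (card (g ` F0))" by (rule card_insert_le_m1) (simp_all add: card_insert_if f)
      also have "\<dots> \<le> Suc (card F0)" using card_image_le[OF f] by simp
      finally show ?thesis using 1 by simp
    next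
      case 2
      have f: "finite F0" using fin 2 by blast
      have "dim S \<le> card (g ` F0)" unfolding 2(1) dim_span by (rule dim_le_card') (use f in simp)
      also have "\<dots> \<le> card F0" using card_image_le[OF f] by simp
      finally show ?thesis using 2 by simp
    qed
  qed
  obtain y where y: "y \<in> ?U" "\<And>S. S \<in> I \<Longrightarrow> y \<notin> S" using avoid_subspaces[OF finI oU neU subI] by blast
  define p where "p = (\<lambda>t :: real. (1 - t) *\<^sub>R y + t *\<^sub>R x)"
  define A where "A = {0..1} \<inter> p -` covered"
  have cp: "continuous_on UNIV p" unfolding p_def by (intro continuous_intros)
  have "closed (p -` covered)" by (rule closed_vimage[OF closed_GG cp])
  then have clA: "closed A" unfolding A_def by (intro closed_Int) auto
  have A0: "0 \<in> A" using UG[OF y(1)] by (simp add: A_def p_def)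
  have bA: "bdd_above A" by (auto simp: A_def)
  \<comment> \<open>The last covered parameter; the contradiction is a covered parameter beyond
    it.\<close>
  define t where "t = Sup A"
  have tA: "t \<in> A" unfolding t_def by (rule closed_contains_Sup[OF _ bA clA]) (use A0 in blast)
  have t1: "t < 1"
  proof -
    have "t \<le> 1" "p t \<in> covered" using tA by (auto simp: A_def)
    then show ?thesis using x by (cases "t = 1") (auto simp: p_def)
  qed
  have t0: "0 \<le> t" using tA by (simp add: A_def)
  obtain F where F: "good F" "p t \<in> K F" using tA by (auto simp: A_def covered_def)
  have Fnk: "F \<in> nk_complex B" using good_nk[OF F(1)] .
  obtain a where a: "\<And>W. W \<in> F \<Longrightarrow> 0 \<le> a W" "p t = (\<Sum>W\<in>F. a W *\<^sub>R g W)" using F(2) by (auto simp: K_def)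
  have fin: "finite F" using nkD(1)[OF Fnk] .
  \<comment> \<open>The face with \<open>p t\<close> in its relative interior. Its walks are strict
    at \<open>p t\<close>, hence also at nearby points.\<close>
  define F0 where "F0 = {W \<in> F. 0 < a W}"
  have F0F: "F0 \<subseteq> F" by (auto simp: F0_def)
  have "p t = (\<Sum>W\<in>F0. a W *\<^sub>R g W)" unfolding a(2)
    by (rule sum.mono_neutral_right) (use fin a(1) in \<open>force simp: F0_def\<close>)+
  moreover have "(\<Sum>W\<in>F0. a W *\<^sub>R g W) \<in> span (g ` F0)" by (intro span_sum span_scale span_base imageI)
  ultimately have pt: "p t \<in> span (g ` F0)" by simp
  have st: "strict (p t) (word_of W)" if "W \<in> F0" for W
    unfolding a(2) by (rule K_strict(1)[OF Fnk]) (use that a(1) in \<open>auto simp: F0_def\<close>)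
  have cd: "?n \<le> Suc (card F0)"
  proof (rule ccontr)
    assume "\<not> ?thesis"
    then have "span (insert x (g ` F0)) \<in> I" unfolding I_def using F(1) F0F by auto
    then have "y \<notin> span (insert x (g ` F0))" using y(2) by blast
    moreover have "y = (1 / (1 - t)) *\<^sub>R (p t - t *\<^sub>R x)" using t1 by (simp add: p_def)
    moreover have "p t \<in> span (insert x (g ` F0))" using pt span_mono[of "g ` F0" "insert x (g ` F0)"] by blast
    moreover have "x \<in> span (insert x (g ` F0))" by (simp add: span_base)
    ultimately show False by (metis span_diff span_scale)
  qed
  define V where "V = {z. \<forall>W\<in>F0. strict z (word_of W)}"
  have "V = (\<Inter>W\<in>F0. {z. strict z (word_of W)})" by (auto simp: V_def)
  moreover have "finite F0" using fin F0F finite_subset by blast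
  ultimately have oV: "open V" using strict_open by (auto intro!: open_INT)
  have "open (p -` V)" by (rule open_vimage[OF oV cp])
  moreover have "t \<in> p -` V" using st by (simp add: V_def)
  ultimately obtain e where e: "0 < e" "ball t e \<subseteq> p -` V" using openE by blast
  define s where "s = min (t + e / 2) 1"
  have s: "t < s" "s \<le> 1" "s \<in> ball t e" using e t1 by (auto simp: s_def dist_real_def)
  have sV: "p s \<in> V" using e(2) s(3) by blast
  have "p s \<notin> span (g ` F0) \<or> F0 = F"
  proof (rule ccontr)
    assume n: "\<not> ?thesis"
    then have "F0 \<subset> F" using F0F by blast
    then have "card F0 < card F" using fin by (rule psubset_card_mono[rotated])
    then have "Suc (card F0) \<le> ?n" using good_basis(3)[OF F(1)] by simp
    then have "span (g ` F0) \<in> I" unfolding I_def using F(1) F0F by auto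
    then have "y \<notin> span (g ` F0)" using y(2) by blast
    moreover have "p s \<in> span (g ` F0)" using n by blast
    moreover have "y = (1 / (s - t)) *\<^sub>R (s *\<^sub>R p t - t *\<^sub>R p s)"
    proof -
      have "s *\<^sub>R p t - t *\<^sub>R p s = (s - t) *\<^sub>R y" by (simp add: p_def algebra_simps)
      then show ?thesis using s(1) by simp
    qed
    ultimately show False using pt by (metis span_diff span_scale)
  qed
  then have "p s \<in> covered" by (intro near_GG[OF F(1) F0F cd]) (use sV in \<open>auto simp: V_def\<close>)
  then have "s \<in> A" using s t0 by (simp add: A_def)
  then have "s \<le> t" unfolding t_def by (rule cSup_upper[OF _ bA])
  then show False using s by simp
qed

text \<open>By completeness the sum of the g-vectors of \<open>F\<close> lies in the cone of some
  good \<open>F'\<close>. There the walks of \<open>F\<close> satisfy their sign conditions strictly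
  and those of \<open>F'\<close> weakly, so they do not kiss, and maximality gives
  \<open>F' \<subseteq> F\<close>. Hence \<open>F\<close> spans, which rules out a non-terminating
  greedy word for this integral vector.\<close>

lemma facet_good:
  assumes F: "F \<in> facets B"
  shows "good F" "\<And>W. W \<in> F \<Longrightarrow> strict (\<Sum>W\<in>F. g W) (word_of W)"
proof -
  have Fnk: "F \<in> nk_complex B" and mx: "\<And>G. G \<in> nk_complex B \<Longrightarrow> F \<subseteq> G \<Longrightarrow> G = F" using F by (auto simp: facets_def)
  let ?x = "\<Sum>W\<in>F. g W"
  have st: "strict ?x (word_of W)" if "W \<in> F" for W
    using K_strict(1)[OF Fnk, of "\<lambda>_. 1" W] that by simp
  show "\<And>W. W \<in> F \<Longrightarrow> strict (\<Sum>W\<in>F. g W) (word_of W)" by (rule st)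
  obtain F' where F': "good F'" "?x \<in> K F'" using complete by (auto simp: covered_def)
  obtain a where a: "\<And>W. W \<in> F' \<Longrightarrow> 0 \<le> a W" "?x = (\<Sum>W\<in>F'. a W *\<^sub>R g W)" using F'(2) by (auto simp: K_def)
  have F'nk: "F' \<in> nk_complex B" using good_nk[OF F'(1)] .
  have F'ge: "0 \<le> sg d * inner ?x (mv (word_of W') {i..i + k})" if "W' \<in> F'" "substring_type d (word_of W') i k" for W' d i k
  proof (cases "\<exists>W\<in>F'. 0 < a W")
    case True
    then show ?thesis using K_strict(2)[OF F'nk a(1) _ _ that] a(2) by auto
  next
    case False
    then have "\<forall>W\<in>F'. a W = 0" using a(1) by force
    then have "?x = 0" using a(2) by simp
    then show ?thesis by simp
  qed
  have nk: "nokiss (word_of W) (word_of W')" if "W \<in> F" "W' \<in> F'" for W W'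
    unfolding nokiss_def
  proof (intro allI equals0I)
    fix d r assume r: "r \<in> kiss_occs d (word_of W) (word_of W')"
    obtain b i j k where e: "r = (b, i, j, k)" by (cases r)
    have c: "chain (word_of W)" using nkD(2)[OF Fnk that(1)] walk_rl(1) wk_chain by blast
    have t: "substring_type d (ori b (word_of W)) j k" "substring_type (\<not> d) (word_of W') i k" using r e by (auto simp: kiss_occs_def)
    have "0 < sg d * inner ?x (mv (ori b (word_of W)) {j..j + k})"
      using strict_ori[OF c st[OF that(1)], of b] t(1) unfolding strict_def by blast
    moreover have "0 \<le> sg (\<not> d) * inner ?x (mv (word_of W') {i..i + k})" by (rule F'ge[OF that(2) t(2)])
    moreover have "inner ?x (mv (word_of W') {i..i + k}) = inner ?x (mv (ori b (word_of W)) {j..j + k})"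
      using kset_inner r e by blast
    ultimately show False by simp
  qed
  have "F \<union> F' \<in> nk_complex B"
  proof (rule nkI)
    show "W \<in> walks B \<and> \<not> straight W" if "W \<in> F \<union> F'" for W using that nkD(2)[OF Fnk] nkD(2)[OF F'nk] by blast
    show "nokiss (word_of W) (word_of W')" if "W \<in> F \<union> F'" "W' \<in> F \<union> F'" for W W'
    proof -
      have w: "W \<in> walks B" "W' \<in> walks B" using that nkD(2)[OF Fnk] nkD(2)[OF F'nk] by blast+
      have sy: "nokiss (word_of W') (word_of W) \<Longrightarrow> nokiss (word_of W) (word_of W')" using nokiss_iff[OF w] nokiss_iff[OF w(2,1)] by blast
      show ?thesis using that nk[of W W'] nk[of W' W] sy nkD(3)[OF Fnk] nkD(3)[OF F'nk] by blast
    qed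
  qed
  then have "F' \<subseteq> F" using mx by blast
  then have sp: "span (g ` F) = UNIV" using good_basis(5)[OF F'(1)] span_mono[of "g ` F'" "g ` F"] by blast
  have int: "?x $ v \<in> \<int>" for v
  proof -
    have "g W $ v \<in> \<int>" for W by (simp add: gvec_def)
    then show ?thesis by (simp add: sum_component Ints_sum)
  qed
  have "allstop ?x"
  proof (rule ccontr)
    assume "\<not> allstop ?x"
    then obtain l where "l \<in> L" "\<not> stops ?x l" by (auto simp: allstop_def)
    then obtain m :: "real^'v" where m: "m \<noteq> 0" "\<And>w. walk_word w \<Longrightarrow> coherent ?x w \<Longrightarrow> inner (gv w) m = 0"
      using nonstop_vector[of l ?x] int by blast
    have gm: "inner (g W) m = 0" if "W \<in> F" for W
    proof -
      have W: "W \<in> walks B" using nkD(2)[OF Fnk] that by blast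
      show ?thesis using m(2)[OF walk_rl(1)[OF W] strict_coherent[OF st[OF that]]] gvec_gv[OF W] by simp
    qed
    have "m \<in> span (g ` F)" using sp by simp
    moreover have "inner u m = 0" if "u \<in> g ` F" for u using that gm by blast
    ultimately have "inner m m = 0" using orthogonal_span by blast
    then show False using m(1) by simp
  qed
  moreover have "F = coherent_walks ?x"
  proof (rule mx[symmetric])
    show "coherent_walks ?x \<in> nk_complex B" by (rule Fx_nk)
    show "F \<subseteq> coherent_walks ?x" using nkD(2)[OF Fnk] st strict_coherent by (auto simp: coherent_walks_def)
  qed
  ultimately show "good F" unfolding good_def by blast
qed

lemma nk_facet: assumes "F \<in> nk_complex B" obtains F' where "F' \<in> facets B" "F \<subseteq> F'"
proof -
  have "finite {G \<in> nk_complex B. F \<subseteq> G}" using finite_nk by simp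
  moreover have "F \<in> {G \<in> nk_complex B. F \<subseteq> G}" using assms by simp
  ultimately obtain G where G: "G \<in> {G \<in> nk_complex B. F \<subseteq> G}" "\<forall>H\<in>{G \<in> nk_complex B. F \<subseteq> G}. G \<subseteq> H \<longrightarrow> H = G"
    using finite_has_maximal[of "{G \<in> nk_complex B. F \<subseteq> G}"] by (metis (no_types, lifting) empty_iff)
  then have "G \<in> facets B" unfolding facets_def by blast
  then show thesis using that G by blast
qed

text \<open>Good faces all have the same cardinality, so a good face inside a facet is the
  facet.\<close>

lemma facet_cover: obtains F where "F \<in> facets B" "y \<in> K F"
proof -
  obtain F0 where F0: "good F0" "y \<in> K F0" using complete by (auto simp: covered_def)
  obtain F where F: "F \<in> facets B" "F0 \<subseteq> F" using nk_facet[OF good_nk[OF F0(1)]] by blast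
  have "finite F" using F nkD(1) by (auto simp: facets_def)
  then have "card F0 = card F \<Longrightarrow> F0 = F" using F(2) card_subset_eq by blast
  then have "F0 = F" using good_basis(3)[OF F0(1)] good_basis(3)[OF facet_good(1)[OF F(1)]] by simp
  then show thesis using that F F0 by blast
qed

end

section \<open>The polytope\<close>

lemma sum_tight:
  fixes f h :: "'i \<Rightarrow> real"
  assumes "finite I" "\<And>i. i \<in> I \<Longrightarrow> f i \<le> h i" "sum h I \<le> sum f I" "i \<in> I"
  shows "f i = h i"
proof (rule ccontr)
  assume "f i \<noteq> h i"
  then have "f i < h i" using assms(2)[OF assms(4)] by simp
  then have "sum f I < sum h I" using assms by (intro sum_strict_mono_ex1) auto
  then show False using assms(3) by simp
qed

context finite_blossom_quiver begin

lemma finite_nsk: "finite (nsk_walks B)"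
proof -
  obtain f where f: "inj_on f (straight_walks B)" "f ` straight_walks B \<subseteq> {a \<in> arrs B. \<not> isl (tgt B a)}"
    using straight_inj by blast
  have "finite (f ` straight_walks B)" by (rule finite_subset[OF f(2)]) (use finite_arrs in simp)
  then have "finite (straight_walks B)" using finite_imageD f(1) by blast
  moreover have "nsk_walks B \<subseteq> {W \<in> nsk_walks B. \<not> straight W} \<union> straight_walks B"
    by (auto simp: nsk_walks_def straight_walks_def)
  ultimately show ?thesis using finite_bend finite_subset by blast
qed

lemma nsk_walk: "W \<in> nsk_walks B \<Longrightarrow> W \<in> walks B"
  by (simp add: nsk_walks_def)

lemma straight_g: assumes "W \<in> walks B" "straight W" shows "g W = 0"
proof -
  have c: "chain (word_of W)" using walk_rl(1)[OF assms(1)] wk_chain by blast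
  have "\<not> top_occ B (rep W) (i, i)" "\<not> bot_occ B (rep W) (i, i)" for i
    using top_bot_occ[OF c, of True i i] top_bot_occ[OF c, of False i i] straight_ty[OF assms(2)]
      walk_rl(2)[OF assms(1)] by auto
  then show ?thesis by (simp add: gvec_def vec_eq_iff)
qed

lemma KN_kset: "W \<in> walks B \<Longrightarrow> W' \<in> walks B \<Longrightarrow>
    KN B W W' = card (kiss_occs True (word_of W) (word_of W')) + card (kiss_occs False (word_of W) (word_of W'))"
  using kiss_count_kset[of W W'] by (simp add: KN_def)

text \<open>The vertex of a facet is a sum, over all non-self-kissing walks, of maximisers of the functional
  given by an interior point of the cone of the facet; maximality turns the inequality
  \<open>clo_le\<close> into an equality on the facet.\<close>

lemma facet_pt:
  assumes F: "F \<in> facets B"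
  shows "\<And>W. W \<in> F \<Longrightarrow> inner (g W) (pt B F) = kappa B W"
    and "\<And>W. W \<in> nsk_walks B \<Longrightarrow> inner (g W) (pt B F) \<le> kappa B W"
    and "\<And>W. W \<in> nsk_walks B \<Longrightarrow> \<not> straight W \<Longrightarrow> W \<notin> F \<Longrightarrow> inner (g W) (pt B F) < kappa B W"
proof -
  have gF: "good F" using facet_good(1)[OF F] .
  have Fnk: "F \<in> nk_complex B" and mx: "\<And>G. G \<in> nk_complex B \<Longrightarrow> F \<subseteq> G \<Longrightarrow> G = F" using F by (auto simp: facets_def)
  have fin: "finite F" using nkD(1)[OF Fnk] .
  define x where "x = (\<Sum>W\<in>F. g W)"
  have st: "strict x (word_of W)" if "W \<in> F" for W using facet_good(2)[OF F that] by (simp add: x_def)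
  let ?mx = "\<lambda>d W S. closed_set (\<not> d) (word_of W) S \<and>
     (\<forall>S'. closed_set (\<not> d) (word_of W) S' \<longrightarrow> sg d * inner x (mv (word_of W) S') \<le> sg d * inner x (mv (word_of W) S))"
  \<comment> \<open>One maximiser for each walk and type. With \<open>d = True\<close> it accounts
    for the kisses of a tested walk to this one, with \<open>d = False\<close> for those in the
    other direction.\<close>
  define S where "S = (\<lambda>d W. SOME S. ?mx d W S)"
  have S: "?mx d W (S d W)" for d W
  proof -
    obtain S0 where "?mx d W S0" using clo_max_exists[of "\<not> d" "word_of W" "sg d" x] by metis
    then show ?thesis unfolding S_def by (rule someI)
  qed
  define p where "p = (\<Sum>W'\<in>nsk_walks B. sg True *\<^sub>R mv (word_of W') (S True W') + sg False *\<^sub>R mv (word_of W') (S False W'))"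
  define t where "t = (\<lambda>d W W'. sg d * inner (gv (word_of W)) (mv (word_of W') (S d W')))"
  have ip: "inner (g W) p = (\<Sum>W'\<in>nsk_walks B. t True W W' + t False W W')" if "W \<in> walks B" for W
    unfolding p_def t_def gvec_gv[OF that] by (simp add: inner_sum_right inner_add_right)
  have kap: "kappa B W = (\<Sum>W'\<in>nsk_walks B. real (card (kiss_occs True (word_of W) (word_of W'))) + real (card (kiss_occs False (word_of W) (word_of W'))))"
    if "W \<in> walks B" for W
    unfolding kappa_def of_nat_sum by (rule sum.cong) (use KN_kset[OF that nsk_walk] in auto)
  have le: "t d W W' \<le> real (card (kiss_occs d (word_of W) (word_of W')))" if "W \<in> walks B" "W' \<in> walks B" for d W W'
    unfolding t_def by (rule clo_le) (use that walk_rl(1) wk_chain S in blast)+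
  have eq: "t d W W' = real (card (kiss_occs d (word_of W) (word_of W')))" if "W \<in> F" "W' \<in> walks B" for d W W'
    unfolding t_def
  proof (rule clo_max[of _ _ x])
    have "W \<in> walks B" using nkD(2)[OF Fnk that(1)] by blast
    then show "walk_word (word_of W)" by (rule walk_rl(1))
    show "chain (word_of W')" using walk_rl(1)[OF that(2)] by (rule wk_chain)
    show "strict x (word_of W)" by (rule st[OF that(1)])
    show "closed_set (\<not> d) (word_of W') (S d W')" using S by blast
    show "sg d * inner x (mv (word_of W') S') \<le> sg d * inner x (mv (word_of W') (S d W'))" if "closed_set (\<not> d) (word_of W') S'" for S'
      using S that by blast
  qed
  \<comment> \<open>This yields strictness: a walk outside \<open>F\<close> kisses some walk of
    \<open>F\<close>, at which the summand is zero.\<close>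
  have emp: "t d W W' = 0" if "W' \<in> F" for d W W'
  proof -
    have "S d W' = {}" by (rule clo_max_empty[OF st[OF that], of d]) (use S in blast)+
    then show ?thesis by (simp add: t_def)
  qed
  have tight: "inner (g W) p = kappa B W" if "W \<in> F" for W
  proof -
    have W: "W \<in> walks B" using nkD(2)[OF Fnk that] by blast
    show ?thesis unfolding ip[OF W] kap[OF W] by (rule sum.cong) (use eq[OF that nsk_walk] in auto)
  qed
  have "inner (g W) (pt B F) = kappa B W" if "W \<in> F" for W
  proof -
    have "inner (g W) (pt B F) = (\<Sum>W'\<in>F. if W' = W then kappa B W' else 0)"
      unfolding pt_def inner_sum_right by (rule sum.cong) (use good_dual[OF gF that] in auto)
    then show ?thesis using fin that by simp
  qed
  \<comment> \<open>Both points have the same pairings with the g-vectors of \<open>F\<close>, which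
    span.\<close>
  then have "inner u (pt B F - p) = 0" if "u \<in> g ` F" for u
    using that tight by (auto simp: inner_diff_right)
  then have "inner (pt B F - p) (pt B F - p) = 0"
    using orthogonal_span[of "pt B F - p" "g ` F" "pt B F - p"] good_basis(5)[OF gF] by auto
  then have pp: "pt B F = p" by simp
  show "\<And>W. W \<in> F \<Longrightarrow> inner (g W) (pt B F) = kappa B W" unfolding pp by (rule tight)
  show "inner (g W) (pt B F) \<le> kappa B W" if "W \<in> nsk_walks B" for W
    unfolding pp ip[OF nsk_walk[OF that]] kap[OF nsk_walk[OF that]]
    by (rule sum_mono) (use le[OF nsk_walk[OF that] nsk_walk] in \<open>auto intro: add_mono\<close>)
  show "inner (g W) (pt B F) < kappa B W" if W: "W \<in> nsk_walks B" "\<not> straight W" "W \<notin> F" for W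
  proof -
    have Ww: "W \<in> walks B" using nsk_walk[OF W(1)] .
    have "\<exists>W'\<in>F. \<not> nokiss (word_of W) (word_of W')"
    proof (rule ccontr)
      assume n: "\<not> ?thesis"
      have "insert W F \<in> nk_complex B"
      proof (rule nkI)
        show "V \<in> walks B \<and> \<not> straight V" if "V \<in> insert W F" for V using that nkD(2)[OF Fnk] Ww W by blast
        fix V V' assume V: "V \<in> insert W F" "V' \<in> insert W F"
        have ww: "V \<in> walks B" "V' \<in> walks B" using V nkD(2)[OF Fnk] Ww by blast+
        have self: "nokiss (word_of W) (word_of W)" using nokiss_iff[OF Ww Ww] W(1) by (simp add: nsk_walks_def)
        show "nokiss (word_of V) (word_of V')"
          using V n self nkD(3)[OF Fnk] nokiss_iff[OF ww] nokiss_iff[OF ww(2,1)] by blast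
      qed
      then show False using mx[of "insert W F"] W(3) by blast
    qed
    then obtain W' where W': "W' \<in> F" "\<not> nokiss (word_of W) (word_of W')" by blast
    have W'n: "W' \<in> nsk_walks B" using nkD(2)[OF Fnk W'(1)] by blast
    obtain d where "kiss_occs d (word_of W) (word_of W') \<noteq> {}" using W'(2) by (auto simp: nokiss_def)
    then have "0 < card (kiss_occs d (word_of W) (word_of W'))" using finite_kset by (simp add: card_gt_0_iff)
    then have pos: "0 < card (kiss_occs True (word_of W) (word_of W')) + card (kiss_occs False (word_of W) (word_of W'))" by (cases d) auto
    show ?thesis
      unfolding pp ip[OF Ww] kap[OF Ww]
    proof (rule sum_strict_mono_ex1[OF finite_nsk])
      show "\<forall>V\<in>nsk_walks B. t True W V + t False W V \<le> real (card (kiss_occs True (word_of W) (word_of V))) + real (card (kiss_occs False (word_of W) (word_of V)))"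
        using le[OF Ww nsk_walk] by (auto intro: add_mono)
      show "\<exists>V\<in>nsk_walks B. t True W V + t False W V < real (card (kiss_occs True (word_of W) (word_of V))) + real (card (kiss_occs False (word_of W) (word_of V)))"
        using emp[OF W'(1)] pos W'n by (intro bexI[of _ W']) auto
    qed
  qed
qed

section \<open>The two descriptions of the polytope\<close>

lemma K_inner_le:
  assumes "finite F" "\<And>W. W \<in> F \<Longrightarrow> W \<in> nsk_walks B" "\<And>W. W \<in> F \<Longrightarrow> 0 \<le> a W" "q \<in> asso_halfspaces B"
  shows "inner (\<Sum>W\<in>F. a W *\<^sub>R g W) q \<le> (\<Sum>W\<in>F. a W * kappa B W)"
  unfolding inner_sum_left
  by (rule sum_mono) (use assms in \<open>auto simp: asso_halfspaces_def intro: mult_left_mono\<close>)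

lemma pt_halfspaces: "F \<in> facets B \<Longrightarrow> pt B F \<in> asso_halfspaces B"
  using facet_pt(2) by (simp add: asso_halfspaces_def)

lemma facet_nsk: "F \<in> facets B \<Longrightarrow> W \<in> F \<Longrightarrow> W \<in> nsk_walks B"
  using nkD(2) by (auto simp: facets_def)

lemma facet_finite: "F \<in> facets B \<Longrightarrow> finite F"
  using nkD(1) by (auto simp: facets_def)

lemma pt_inner:
  assumes "F \<in> facets B"
  shows "inner (\<Sum>W\<in>F. a W *\<^sub>R g W) (pt B F) = (\<Sum>W\<in>F. a W * kappa B W)"
  unfolding inner_sum_left by (rule sum.cong) (use facet_pt(1)[OF assms] in auto)

text \<open>Separate a point outside the hull by a functional. Its negative lies in the cone of some
  facet, and the vertex of that facet maximises it over all the halfspaces.\<close>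

lemma halfspaces_eq_hull: "asso_hull B = asso_halfspaces B"
proof
  have "convex (asso_halfspaces B)"
  proof -
    have "asso_halfspaces B = (\<Inter>W\<in>nsk_walks B. {q. inner (g W) q \<le> kappa B W})"
      by (auto simp: asso_halfspaces_def)
    then show ?thesis by (simp add: convex_INT convex_halfspace_le)
  qed
  then show "asso_hull B \<subseteq> asso_halfspaces B"
    unfolding asso_hull_def using pt_halfspaces by (intro hull_minimal) auto
  show "asso_halfspaces B \<subseteq> asso_hull B"
  proof (rule ccontr)
    assume "\<not> ?thesis"
    then obtain q where q: "q \<in> asso_halfspaces B" "q \<notin> asso_hull B" by blast
    have "finite (facets B)" using finite_nk by (rule finite_subset[rotated]) (auto simp: facets_def)
    then have "closed (asso_hull B)" unfolding asso_hull_def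
      by (intro compact_imp_closed compact_convex_hull finite_imp_compact) simp
    moreover have "convex (asso_hull B)" by (simp add: asso_hull_def)
    ultimately obtain c b where cb: "inner c q < b" "\<forall>y\<in>asso_hull B. b < inner c y"
      using separating_hyperplane_closed_point[of "asso_hull B" q] q(2) by blast
    obtain F where F: "F \<in> facets B" "- c \<in> K F" using facet_cover by blast
    obtain a where a: "\<And>W. W \<in> F \<Longrightarrow> 0 \<le> a W" "- c = (\<Sum>W\<in>F. a W *\<^sub>R g W)" using F(2) by (auto simp: K_def)
    have "inner (- c) q \<le> inner (- c) (pt B F)"
      unfolding a(2) pt_inner[OF F(1)] by (rule K_inner_le) (use F facet_finite facet_nsk a(1) q in auto)
    moreover have "pt B F \<in> asso_hull B" unfolding asso_hull_def using F(1) by (intro hull_inc) blast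
    ultimately show False using cb by force
  qed
qed

section \<open>Cones of faces as normal cones\<close>

lemma nonneg_span_K: assumes "F \<in> nk_complex B" shows "nonneg_span (g ` F) = K F"
proof -
  obtain F' where F': "F' \<in> facets B" "F \<subseteq> F'" using nk_facet[OF assms] by blast
  have inj: "inj_on g F" using inj_on_subset[OF good_basis(1)[OF facet_good(1)[OF F'(1)]] F'(2)] .
  show ?thesis
  proof
    show "nonneg_span (g ` F) \<subseteq> K F"
    proof
      fix y assume "y \<in> nonneg_span (g ` F)"
      then obtain c where c: "\<forall>v\<in>g ` F. 0 \<le> c v" "y = (\<Sum>v\<in>g ` F. c v *\<^sub>R v)" by (auto simp: nonneg_span_def)
      then have "y = (\<Sum>W\<in>F. c (g W) *\<^sub>R g W)" by (simp add: sum.reindex[OF inj])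
      then show "y \<in> K F" using c(1) unfolding K_def by (intro CollectI exI[of _ "\<lambda>W. c (g W)"]) auto
    qed
    show "K F \<subseteq> nonneg_span (g ` F)"
    proof
      fix y assume "y \<in> K F"
      then obtain a where a: "\<forall>W\<in>F. 0 \<le> a W" "y = (\<Sum>W\<in>F. a W *\<^sub>R g W)" by (auto simp: K_def)
      define c where "c = (\<lambda>v. a (the_inv_into F g v))"
      have ca: "c (g W) = a W" if "W \<in> F" for W using the_inv_into_f_f[OF inj that] by (simp add: c_def)
      have "(\<Sum>v\<in>g ` F. c v *\<^sub>R v) = y" unfolding a(2) sum.reindex[OF inj] comp_def
        by (rule sum.cong) (use ca in auto)
      then show "y \<in> nonneg_span (g ` F)" unfolding nonneg_span_def
        using a(1) ca by (intro CollectI exI[of _ c]) auto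
    qed
  qed
qed

text \<open>On \<open>G\<close> the functional \<open>c\<close> attains the bound obtained by adding
  the inequalities with weights \<open>a W\<close>, so each inequality of positive weight is
  tight.\<close>

lemma normal_cone_tight:
  assumes c: "c \<in> normal_cone (asso_halfspaces B) G" and G: "G \<subseteq> asso_halfspaces B"
  obtains F a where "F \<in> facets B" "\<And>W. W \<in> F \<Longrightarrow> 0 \<le> a W" "c = (\<Sum>W\<in>F. a W *\<^sub>R g W)"
    "\<And>W q. W \<in> F \<Longrightarrow> 0 < a W \<Longrightarrow> q \<in> G \<Longrightarrow> inner (g W) q = kappa B W"
proof -
  obtain F where F: "F \<in> facets B" "c \<in> K F" using facet_cover by blast
  obtain a where a: "\<And>W. W \<in> F \<Longrightarrow> 0 \<le> a W" "c = (\<Sum>W\<in>F. a W *\<^sub>R g W)" using F(2) by (auto simp: K_def)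
  have "inner (g W) q = kappa B W" if W: "W \<in> F" "0 < a W" and q: "q \<in> G" for W q
  proof -
    have "inner c (pt B F) \<le> inner c q" using c q pt_halfspaces[OF F(1)] by (auto simp: normal_cone_def)
    then have "(\<Sum>W\<in>F. a W * kappa B W) \<le> (\<Sum>W\<in>F. a W * inner (g W) q)"
      unfolding a(2) pt_inner[OF F(1)] by (simp add: inner_sum_left)
    then have "a W * inner (g W) q = a W * kappa B W"
      by (rule sum_tight[OF facet_finite[OF F(1)], rotated])
        (use W a(1) facet_nsk[OF F(1)] q G in \<open>auto simp: asso_halfspaces_def intro!: mult_left_mono\<close>)
    then show ?thesis using W by simp
  qed
  then show thesis using that F(1) a by blast
qed

lemma K_normal_cone:
  assumes "finite F" "\<And>W. W \<in> F \<Longrightarrow> W \<in> nsk_walks B" "\<And>W q. W \<in> F \<Longrightarrow> q \<in> G \<Longrightarrow> inner (g W) q = kappa B W"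
  shows "K F \<subseteq> normal_cone (asso_halfspaces B) G"
proof
  fix c assume "c \<in> K F"
  then obtain a where a: "\<And>W. W \<in> F \<Longrightarrow> 0 \<le> a W" "c = (\<Sum>W\<in>F. a W *\<^sub>R g W)" by (auto simp: K_def)
  have "inner c y \<le> inner c q" if "q \<in> G" "y \<in> asso_halfspaces B" for q y
  proof -
    have "inner c q = (\<Sum>W\<in>F. a W * kappa B W)" unfolding a(2) inner_sum_left
      by (rule sum.cong) (use assms(3) that in auto)
    then show ?thesis unfolding a(2) using K_inner_le[OF assms(1,2) a(1) that(2)] by simp
  qed
  then show "c \<in> normal_cone (asso_halfspaces B) G" by (auto simp: normal_cone_def)
qed

lemma K_supp:
  assumes "finite F'" "finite F" "\<And>W. W \<in> F' \<Longrightarrow> 0 \<le> a W" "\<And>W. W \<in> F' \<Longrightarrow> 0 < a W \<Longrightarrow> W \<in> F"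
  shows "(\<Sum>W\<in>F'. a W *\<^sub>R g W) \<in> K F"
proof -
  let ?a = "\<lambda>W. if W \<in> F' then a W else 0"
  have "(\<Sum>W\<in>F'. a W *\<^sub>R g W) = (\<Sum>W\<in>F' \<inter> F. a W *\<^sub>R g W)"
    by (rule sum.mono_neutral_right) (use assms in force)+
  also have "\<dots> = (\<Sum>W\<in>F. ?a W *\<^sub>R g W)"
    by (rule sum.mono_neutral_cong_left) (use assms in auto)
  finally show ?thesis unfolding K_def using assms(3) by (intro CollectI exI[of _ ?a]) auto
qed

lemma K_in_normal_fan:
  assumes F: "F \<in> nk_complex B"
  shows "K F \<in> normal_fan (asso_halfspaces B)"
proof -
  let ?P = "asso_halfspaces B"
  define x where "x = (\<Sum>W\<in>F. g W)"
  define b where "b = (\<Sum>W\<in>F. kappa B W)"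
  \<comment> \<open>The face exposed by the sum of the g-vectors: tightness for the sum means
    tightness for every walk of \<open>F\<close>.\<close>
  define G where "G = ?P \<inter> {q. inner x q = b}"
  have fin: "finite F" and nsk: "\<And>W. W \<in> F \<Longrightarrow> W \<in> nsk_walks B" using nkD[OF F] by auto
  have xb: "inner x q \<le> b" if "q \<in> ?P" for q
    using K_inner_le[OF fin nsk _ that, of "\<lambda>_. 1"] by (simp add: x_def b_def)
  have "convex ?P" unfolding halfspaces_eq_hull[symmetric] by (simp add: asso_hull_def)
  then have face: "G face_of ?P" unfolding G_def by (rule face_of_Int_supporting_hyperplane_le) (rule xb)
  have tight: "inner (g W) q = kappa B W" if "W \<in> F" "q \<in> G" for W q
    by (rule sum_tight[OF fin _ _ that(1)])
      (use nsk that in \<open>auto simp: G_def asso_halfspaces_def x_def b_def inner_sum_left\<close>)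
  have Gt: "q \<in> G" if "q \<in> ?P" "\<And>W. W \<in> F \<Longrightarrow> inner (g W) q = kappa B W" for q
    using that by (simp add: G_def x_def b_def inner_sum_left)
  obtain F1 where F1: "F1 \<in> facets B" "F \<subseteq> F1" using nk_facet[OF F] by blast
  have p1: "pt B F1 \<in> G" using Gt[OF pt_halfspaces[OF F1(1)]] facet_pt(1)[OF F1(1)] F1(2) by blast
  have "K F = normal_cone ?P G"
  proof
    show "K F \<subseteq> normal_cone ?P G" by (rule K_normal_cone[OF fin nsk tight])
    show "normal_cone ?P G \<subseteq> K F"
    proof
      fix c assume c: "c \<in> normal_cone ?P G"
      have GP: "G \<subseteq> ?P" by (auto simp: G_def)
      obtain F' a where F': "F' \<in> facets B" "\<And>W. W \<in> F' \<Longrightarrow> 0 \<le> a W" "c = (\<Sum>W\<in>F'. a W *\<^sub>R g W)"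
        "\<And>W q. W \<in> F' \<Longrightarrow> 0 < a W \<Longrightarrow> q \<in> G \<Longrightarrow> inner (g W) q = kappa B W"
        by (rule normal_cone_tight[OF c GP], rule that)
      have "W \<in> F" if W: "W \<in> F'" "0 < a W" for W
      proof (rule ccontr)
        assume nF: "W \<notin> F"
        have Wn: "W \<in> nsk_walks B" "\<not> straight W" using W F'(1) nkD(2) by (auto simp: facets_def)
        have "inner (g W) (pt B F1) = kappa B W" using F'(4)[OF W p1] .
        then have W1: "W \<in> F1" using facet_pt(3)[OF F1(1) Wn] by force
        \<comment> \<open>By duality a step along \<open>- ?c\<close> from the vertex of
          \<open>F1\<close> relaxes the inequality of \<open>W\<close> and keeps the other walks of
          \<open>F1\<close> tight. The remaining bending walks are strict there and tolerate a small
          step. The result is a point of \<open>G\<close> that is not tight at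
          \<open>W\<close>.\<close>
        let ?c = "cvec B F1 W"
        let ?R = "{V \<in> nsk_walks B. \<not> straight V} - F1"
        define U where "U = {q. \<forall>V\<in>?R. inner (g V) q < kappa B V}"
        have "U = (\<Inter>V\<in>?R. {q. inner (g V) q < kappa B V})" by (auto simp: U_def)
        then have "open U" using finite_bend by (auto intro!: open_INT open_halfspace_lt)
        moreover have "pt B F1 \<in> U" using facet_pt(3)[OF F1(1)] by (auto simp: U_def)
        ultimately obtain r where r: "0 < r" "ball (pt B F1) r \<subseteq> U" using openE by blast
        define e where "e = r / (2 * (norm ?c + 1))"
        have nc: "0 < norm ?c + 1" using norm_ge_zero[of ?c] by linarith
        have e0: "0 < e" unfolding e_def using r nc by simp
        have "e * norm ?c < r"
        proof -
          have "e * norm ?c \<le> e * (norm ?c + 1)" using e0 by simp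
          also have "\<dots> = r / 2" unfolding e_def using nc by (simp add: field_simps)
          finally show ?thesis using r by simp
        qed
        define q where "q = pt B F1 - e *\<^sub>R ?c"
        have "dist (pt B F1) q < r" using \<open>e * norm ?c < r\<close> e0 by (simp add: q_def dist_norm)
        then have qU: "q \<in> U" using r(2) by auto
        have iq: "inner (g V) q = kappa B V - (if V = W then e else 0)" if "V \<in> F1" for V
          using facet_pt(1)[OF F1(1) that] good_dual[OF facet_good(1)[OF F1(1)] that W1]
          by (auto simp: q_def inner_diff_right)
        have "inner (g V) q \<le> kappa B V" if V: "V \<in> nsk_walks B" for V
        proof -
          consider "V \<in> F1" | "straight V" | "V \<in> ?R" using V by blast
          then show ?thesis
          proof cases
            case 1
            then show ?thesis using iq e0 by simp
          next
            case 2
            then show ?thesis using straight_g[OF nsk_walk[OF V]] by (simp add: kappa_def sum_nonneg)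
          next
            case 3
            then have "inner (g V) q < kappa B V" using qU unfolding U_def by blast
            then show ?thesis by simp
          qed
        qed
        then have "q \<in> ?P" by (simp add: asso_halfspaces_def)
        then have "q \<in> G" by (rule Gt) (use iq F1(2) nF in auto)
        then have "inner (g W) q = kappa B W" using F'(4)[OF W] by blast
        then show False using iq[OF W1] e0 by simp
      qed
      then show "c \<in> K F" unfolding F'(3) by (intro K_supp facet_finite[OF F'(1)] fin F'(2))
    qed
  qed
  then show ?thesis unfolding normal_fan_def using face p1 by blast
qed

text \<open>\<open>F\<close> consists of the bending walks tight on \<open>G\<close>. For two of
  them the sum of the g-vectors lies in the cone of a facet whose vertex maximises it. That vertex
  is then tight at both walks, so both belong to the facet and do not kiss.\<close>

lemma normal_fan_in_K:
  assumes G: "G face_of asso_halfspaces B" "G \<noteq> {}"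
  obtains F where "F \<in> nk_complex B" "normal_cone (asso_halfspaces B) G = K F"
proof -
  let ?P = "asso_halfspaces B"
  define F where "F = {W \<in> nsk_walks B. \<not> straight W \<and> (\<forall>q\<in>G. inner (g W) q = kappa B W)}"
  have GP: "G \<subseteq> ?P" using face_of_imp_subset[OF G(1)] .
  obtain q where q: "q \<in> G" using G(2) by blast
  have nk: "nokiss (word_of W1) (word_of W2)" if W: "W1 \<in> F" "W2 \<in> F" for W1 W2
  proof -
    have n: "W1 \<in> nsk_walks B" "W2 \<in> nsk_walks B" "\<not> straight W1" "\<not> straight W2" using W by (auto simp: F_def)
    obtain F' where F': "F' \<in> facets B" "g W1 + g W2 \<in> K F'" using facet_cover by blast
    obtain a where a: "\<And>W. W \<in> F' \<Longrightarrow> 0 \<le> a W" "g W1 + g W2 = (\<Sum>W\<in>F'. a W *\<^sub>R g W)" using F'(2) by (auto simp: K_def)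
    have "inner (g W1 + g W2) q \<le> inner (g W1 + g W2) (pt B F')"
      unfolding a(2) pt_inner[OF F'(1)] by (rule K_inner_le) (use F' facet_finite facet_nsk a(1) q GP in auto)
    then have "kappa B W1 + kappa B W2 \<le> inner (g W1) (pt B F') + inner (g W2) (pt B F')"
      using W q by (simp add: F_def inner_add_left)
    then have "W1 \<in> F'" "W2 \<in> F'"
      using facet_pt(2,3)[OF F'(1) n(1)] facet_pt(2,3)[OF F'(1) n(2)] n(3,4) by force+
    then show ?thesis using nkD(3) F'(1) by (auto simp: facets_def)
  qed
  have F: "F \<in> nk_complex B" by (rule nkI) (use nk nsk_walk in \<open>auto simp: F_def\<close>)
  have "normal_cone ?P G = K F"
  proof
    show "K F \<subseteq> normal_cone ?P G" by (rule K_normal_cone) (use nkD(1)[OF F] in \<open>auto simp: F_def\<close>)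
    show "normal_cone ?P G \<subseteq> K F"
    proof
      fix c assume c: "c \<in> normal_cone ?P G"
      obtain F' a where F': "F' \<in> facets B" "\<And>W. W \<in> F' \<Longrightarrow> 0 \<le> a W" "c = (\<Sum>W\<in>F'. a W *\<^sub>R g W)"
        "\<And>W q. W \<in> F' \<Longrightarrow> 0 < a W \<Longrightarrow> q \<in> G \<Longrightarrow> inner (g W) q = kappa B W"
        by (rule normal_cone_tight[OF c GP], rule that)
      have "W \<in> F" if "W \<in> F'" "0 < a W" for W
        using F'(4)[OF that] nkD(2)[of F' W] F'(1) that(1) by (auto simp: F_def facets_def)
      then show "c \<in> K F" unfolding F'(3) by (intro K_supp facet_finite[OF F'(1)] nkD(1)[OF F] F'(2))
    qed
  qed
  then show thesis using that F by blast
qed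

theorem g_fan_normal_fan: "g_fan B = normal_fan (asso_hull B)"
proof
  show "g_fan B \<subseteq> normal_fan (asso_hull B)"
    unfolding halfspaces_eq_hull g_fan_def using nonneg_span_K K_in_normal_fan by auto
  show "normal_fan (asso_hull B) \<subseteq> g_fan B"
  proof
    fix C assume "C \<in> normal_fan (asso_hull B)"
    then obtain G where G: "C = normal_cone (asso_halfspaces B) G" "G face_of asso_halfspaces B" "G \<noteq> {}"
      unfolding halfspaces_eq_hull normal_fan_def by blast
    obtain F where F: "F \<in> nk_complex B" "normal_cone (asso_halfspaces B) G = K F"
      using normal_fan_in_K[OF G(2,3)] by blast
    then have "C = nonneg_span (g ` F)" using G(1) nonneg_span_K by simp
    then show "C \<in> g_fan B" unfolding g_fan_def using F(1) by blast
  qed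
qed

end

section \<open>Blossoming quivers\<close>

text \<open>Gentleness bounds both kinds by one, and blossoming makes the total two.\<close>

lemma two_split:
  assumes "card {c \<in> A. P c} = 2" "card {c \<in> A. P c \<and> \<not> R c} \<le> 1" "card {c \<in> A. P c \<and> R c} \<le> 1"
  shows "\<exists>!c. c \<in> A \<and> P c \<and> \<not> R c"
proof -
  have fin: "finite {c \<in> A. P c}" using assms(1) by (metis card.infinite zero_neq_numeral)
  have "{c \<in> A. P c} = {c \<in> A. P c \<and> \<not> R c} \<union> {c \<in> A. P c \<and> R c}" by blast
  then have "card {c \<in> A. P c} \<le> card {c \<in> A. P c \<and> \<not> R c} + card {c \<in> A. P c \<and> R c}"
    by (metis card_Un_le)
  then have "card {c \<in> A. P c \<and> \<not> R c} = 1" using assms by simp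
  then obtain c where "{c \<in> A. P c \<and> \<not> R c} = {c}" by (rule card_1_singletonE)
  then show ?thesis by (intro ex1I[of _ c]) blast+
qed

lemma bloss_admissible:
  assumes adm: "admissible Q" and rels: "{(a, b). (Inl a, Inl b) \<in> Rs} = rels Q"
  shows "admissible (bloss Q N Rs)"
proof -
  let ?B = "bloss Q N Rs"
  obtain n where n: "\<And>ps. is_path Q ps \<Longrightarrow> length ps = n \<Longrightarrow> \<exists>k. Suc k < length ps \<and> (ps ! k, ps ! Suc k) \<in> rels Q"
    using adm unfolding admissible_def by blast
  \<comment> \<open>The two extra arrows leave room for a blossom arrow at each end; in between the
    path stays in \<open>Q\<close>, because no path passes through a blossom vertex.\<close>
  have "\<exists>k. Suc k < length ps \<and> (ps ! k, ps ! Suc k) \<in> rels ?B" if ps: "is_path ?B ps" "length ps = n + 2" for ps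
  proof -
    have step: "btgt Q (ps ! k) = bsrc Q (ps ! Suc k)" if "Suc k < length ps" for k
      using ps(1) that by (auto simp: is_path_def bloss_def)
    have "set ps \<subseteq> Inl ` arrs Q \<union> Inr ` N" using ps(1) by (simp add: is_path_def bloss_def)
    then have arr: "ps ! k \<in> Inl ` arrs Q \<union> Inr ` N" if "k < length ps" for k
      using nth_mem[OF that] by blast
    have inl: "\<exists>a\<in>arrs Q. ps ! Suc k = Inl a" if k: "k < n" for k
    proof (cases "ps ! Suc k")
      case (Inl a)
      then show ?thesis using arr[of "Suc k"] k ps(2) by auto
    next
      case (Inr y)
      obtain v ou i where y: "y = (v, ou, i)" by (cases y)
      have s1: "btgt Q (ps ! k) = bsrc Q (Inr (v, ou, i))" "btgt Q (Inr (v, ou, i)) = bsrc Q (ps ! Suc (Suc k))"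
        using step[of k] step[of "Suc k"] k ps(2) Inr y by auto
      have ns: "bsrc Q c \<noteq> Inr (v, True, i)" for c :: "'b + 'a blo"
      proof (cases c)
        case (Inr z)
        then show ?thesis by (cases z) auto
      qed simp
      have nt: "btgt Q c \<noteq> Inr (v, False, i)" for c :: "'b + 'a blo"
      proof (cases c)
        case (Inr z)
        then show ?thesis by (cases z) auto
      qed simp
      show ?thesis using s1 ns nt by (cases ou) (metis bsrc.simps(2) btgt.simps(2))+
    qed
    define qs where "qs = map (\<lambda>k. projl (ps ! Suc k)) [0..<n]"
    have q: "ps ! Suc k = Inl (qs ! k)" "qs ! k \<in> arrs Q" if "k < n" for k
      using inl[OF that] that by (auto simp: qs_def)
    have "is_path Q qs" unfolding is_path_def
    proof (intro conjI allI impI)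
      show "set qs \<subseteq> arrs Q" using q(2) by (auto simp: in_set_conv_nth qs_def)
      fix k assume "Suc k < length qs"
      then have k: "Suc k < n" by (simp add: qs_def)
      then show "tgt Q (qs ! k) = src Q (qs ! Suc k)"
        using step[of "Suc k"] q(1)[of k] q(1)[of "Suc k"] ps(2) by simp
    qed
    then obtain k where k: "Suc k < n" "(qs ! k, qs ! Suc k) \<in> rels Q" using n[of qs] by (auto simp: qs_def)
    then have "(ps ! Suc k, ps ! Suc (Suc k)) \<in> rels ?B" using rels q(1)[of k] q(1)[of "Suc k"] by (auto simp: bloss_def)
    then show ?thesis using k ps(2) by (intro exI[of _ "Suc k"]) simp
  qed
  then show ?thesis unfolding admissible_def by blast
qed

lemma bloss_blossom_quiver:
  fixes Q :: "('v::finite, 'a) bquiver"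
  assumes V: "verts Q = UNIV" and Q: "gentle_bound_quiver Q" and bl: "is_blossoming Q N Rs"
  shows "blossom_quiver (bloss Q N Rs)"
proof -
  let ?B = "bloss Q N Rs"
  have sel: "src ?B = bsrc Q" "tgt ?B = btgt Q" "verts ?B = Inl ` verts Q \<union> Inr ` N" "arrs ?B = Inl ` arrs Q \<union> Inr ` N"
    by (simp_all add: bloss_def)
  have gen: "gentle ?B" and two: "\<And>v. card {c \<in> arrs ?B. btgt Q c = Inl v} = 2" "\<And>v. card {c \<in> arrs ?B. bsrc Q c = Inl v} = 2"
    and rel: "{(a, b). (Inl a, Inl b) \<in> Rs} = rels Q"
    using bl V by (auto simp: is_blossoming_def)
  show ?thesis
  proof
    show "finite (arrs ?B)" using gen by (simp add: gentle_def)
    show "Inl v \<in> verts ?B" for v using V by (simp add: sel)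
    show "src ?B a \<in> verts ?B \<and> tgt ?B a \<in> verts ?B" if "a \<in> arrs ?B" for a using gen that by (auto simp: gentle_def)
    show "card {a \<in> arrs ?B. tgt ?B a = Inl v} = 2" "card {a \<in> arrs ?B. src ?B a = Inl v} = 2" for v
      using two by (simp_all add: sel)
    show "\<exists>!c. c \<in> arrs ?B \<and> src ?B c = Inl v \<and> (a, c) \<notin> rels ?B" if a: "a \<in> arrs ?B" "tgt ?B a = Inl v" for a v
    proof (rule two_split)
      show "card {c \<in> arrs ?B. src ?B c = Inl v} = 2" using two by (simp add: sel)
      have "card {c \<in> arrs ?B. src ?B c = tgt ?B a \<and> (a, c) \<notin> rels ?B} \<le> 1 \<and> card {c \<in> arrs ?B. src ?B c = tgt ?B a \<and> (a, c) \<in> rels ?B} \<le> 1"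
        using gen a(1) unfolding gentle_def by blast
      then show "card {c \<in> arrs ?B. src ?B c = Inl v \<and> (a, c) \<notin> rels ?B} \<le> 1" "card {c \<in> arrs ?B. src ?B c = Inl v \<and> (a, c) \<in> rels ?B} \<le> 1"
        using a(2) by auto
    qed
    show "\<exists>!a. a \<in> arrs ?B \<and> tgt ?B a = Inl v \<and> (a, c) \<notin> rels ?B" if c: "c \<in> arrs ?B" "src ?B c = Inl v" for c v
    proof (rule two_split)
      show "card {a \<in> arrs ?B. tgt ?B a = Inl v} = 2" using two by (simp add: sel)
      have "card {a \<in> arrs ?B. tgt ?B a = src ?B c \<and> (a, c) \<notin> rels ?B} \<le> 1 \<and> card {a \<in> arrs ?B. tgt ?B a = src ?B c \<and> (a, c) \<in> rels ?B} \<le> 1"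
        using gen c(1) unfolding gentle_def by blast
      then show "card {a \<in> arrs ?B. tgt ?B a = Inl v \<and> (a, c) \<notin> rels ?B} \<le> 1" "card {a \<in> arrs ?B. tgt ?B a = Inl v \<and> (a, c) \<in> rels ?B} \<le> 1"
        using c(2) by auto
    qed
    show "l = l'" if "fst l \<in> arrs ?B" "fst l' \<in> arrs ?B" "lsrc ?B l = Inr y" "lsrc ?B l' = Inr y" for l l' y
    proof -
      \<comment> \<open>A blossom vertex carries the name of its arrow, so the letter leaving it is
        that arrow, read backward exactly when it points to the blossom.\<close>
      have "l = (Inr y, \<not> fst (snd y))" if "lsrc ?B l = Inr y" for l
      proof -
        obtain a d where ad: "l = (a, d)" by (cases l)
        show ?thesis
        proof (cases a)
          case (Inl c)
          then show ?thesis using that ad by (cases d) (simp_all add: sel)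
        next
          case (Inr z)
          obtain v ou i where "z = (v, ou, i)" by (cases z)
          then show ?thesis using that ad Inr by (cases d; cases ou) (auto simp: sel)
        qed
      qed
      then show ?thesis using that by metis
    qed
    show "admissible ?B" using bloss_admissible Q rel by (auto simp: gentle_bound_quiver_def)
  qed
qed

theorem theorem12p21:
  fixes Q :: "('v::finite, 'a) bquiver"
    and N :: "'v blo set"
    and Rs :: "(('a + 'v blo) \<times> ('a + 'v blo)) set"
  assumes "verts Q = UNIV"
    and "gentle_bound_quiver Q"
    and "is_blossoming Q N Rs"
    and "finite (nk_complex (bloss Q N Rs))"
  shows "asso_hull (bloss Q N Rs) = asso_halfspaces (bloss Q N Rs) \<and>
         g_fan (bloss Q N Rs) = normal_fan (asso_hull (bloss Q N Rs))"
proof -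
  interpret finite_blossom_quiver "bloss Q N Rs"
    by (intro finite_blossom_quiver.intro bloss_blossom_quiver finite_blossom_quiver_axioms.intro assms)
  show ?thesis using halfspaces_eq_hull g_fan_normal_fan by blast
qed

end
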